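(* Let $n\ge3$, let $\alpha_n:=\sqrt{\frac{n+1}{2n}}$ and let $\alpha\in[0,1]$. If $\alpha\ge\alpha_n$, then the $(n-1)$-dimensional cone $\mathbf{\Delta}^n_+$ is an $\alpha$-sliding minimiser in the half-space $\mathbb{R}^n_+$ with respect to the sliding boundary $\Gamma=\partial\mathbb{R}^n_+$.
   Context: Let $\mathbb{R}^n_+:=\{(x_1,\dots,x_n)\in\mathbb{R}^n: x_1\ge 0\}$ and $\Gamma:=\{(x_1,\dots,x_n)\in\mathbb{R}^n: x_1=0\}$. $\mathcal{H}^{n-1}$ denotes the $(n-1)$-dimensional Hausdorff measure. Energy: for $\alpha\in[0,1]$ and $E\subset\mathbb{R}^n_+$, $J_\alpha(E):=\mathcal{H}^{n-1}(E\setminus\Gamma)+\alpha\,\mathcal{H}^{n-1}(E\cap\Gamma)$. Sliding competitor: let $E\subset\mathbb{R}^n_+$ have locally finite $\mathcal{H}^{n-1}$ measure. A set $F$ is a sliding competitor to $E$ if there is a continuous function $\phi:[0,1]\times E\to\mathbb{R}^n$ such that, writing $\phi_t(x)=\phi(t,x)$: (1) $\phi_0$ is the identity; (2) $F=\phi_1(E)$; (3) $\phi_1$ is Lipschitz; (4) setting $W_t:=\{x\in E:\phi_t(x)\ne x\}$ for $t\in[0,1]$ and $W:=\bigcup_{t\in[0,1]}W_t$, there is a compact set $K\subset\mathbb{R}^n$ with $\phi([0,1]\times W)\subset K$; (5) for every $t\in[0,1]$, $\phi_t(x)\in\mathbb{R}^n_+$ for all $x\in E$, and $\phi_t(x)\in\Gamma$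 for all $x\in E\cap\Gamma$. $\alpha$-sliding minimiser: $E$ is an $\alpha$-sliding minimiser in $\mathbb{R}^n_+$ with respect to $\Gamma$ if $J_\alpha(E\setminus F)\le J_\alpha(F\setminus E)$ for every sliding competitor $F$ to $E$. The cone over a set $A$, $\mathrm{cone}(A)$, is the union of all half-lines starting from the origin and intersecting $A$. The cone $\mathbf{\Delta}^n_+$: let $\Delta^n=[p_1,\dots,p_{n+1}]\subset\mathbb{R}^n$ be the regular $n$-simplex (convex hull of its vertices) with barycentre at the origin and vertices on the unit sphere, placed as follows. For $1\le j\le n$ let $a_j:=\sqrt{\frac{(n+1)(n-j+1)}{n(n-j+2)}}$. For $1\le k\le n$ the vertex $p_k$ has $j$-th coordinate equal to $\frac{a_j}{n-j+1}$ if $j<k$, to $-a_k$ if $j=k$, and to $0$ if $j>k$; the vertex $p_{n+1}$ has $j$-th coordinate $\frac{a_j}{n-j+1}$ for all $1\le j\le n$. In particular $p_1=(-1,0,\dots,0)$ and all the other vertices have first coordinate $\frac1n$. Let $\mathrm{sk}_{n-2}(\Delta^n)$ be the union of all the $(n-2)$-dimensional faces of $\Delta^n$, let $\mathbf{\Delta}^n:=\mathrm{cone}(\mathrm{sk}_{n-2}(\Delta^n))$ (a cone of dimension $n-1$), and set $\mathbf{\Delta}^n_+:=\mathbf{\Delta}^n\cap\mathbb{R}^n_+$. *)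

theory Defs
  imports "HOL-Analysis.Analysis"
begin

section \<open>Hausdorff measure\<close>

text \<open>Hausdorff outer measure of integer dimension \<open>m\<close>, with the usual normalisation
  \<open>\<omega>\<^sub>m (diam U / 2)^m\<close>, where \<open>\<omega>\<^sub>m\<close> is the volume of the unit \<open>m\<close>-ball.
  The library's \<open>diameter\<close> is meaningful only for bounded sets, hence the boundedness
  condition on coverings. The weight of the empty set has to be fixed separately, since
  \<open>0 ^ 0 = 1\<close>.\<close>

definition hausdorff_weight :: "nat \<Rightarrow> 'a::metric_space set \<Rightarrow> ennreal" where
  "hausdorff_weight m U =
     (if U = {} then 0 else ennreal (unit_ball_vol (real m) * (diameter U / 2) ^ m))"

definition hausdorff_premeasure :: "nat \<Rightarrow> real \<Rightarrow> 'a::metric_space set \<Rightarrow> ennreal" where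
  "hausdorff_premeasure m \<delta> A =
     (INF U\<in>{U :: nat \<Rightarrow> 'a set. A \<subseteq> (\<Union>i. U i) \<and> (\<forall>i. bounded (U i) \<and> diameter (U i) \<le> \<delta>)}.
        \<Sum>i. hausdorff_weight m (U i))"

definition hausdorff_measure :: "nat \<Rightarrow> 'a::metric_space set \<Rightarrow> ennreal" where
  "hausdorff_measure m A = (SUP \<delta>\<in>{0<..}. hausdorff_premeasure m \<delta> A)"

definition locally_finite_hausdorff :: "nat \<Rightarrow> 'a::metric_space set \<Rightarrow> bool" where
  "locally_finite_hausdorff m A \<longleftrightarrow>
     (\<forall>x. \<exists>V. open V \<and> x \<in> V \<and> hausdorff_measure m (A \<inter> V) < \<infinity>)"


section \<open>Half-space and sliding boundary\<close>

text \<open>The space is \<open>\<real>\<^sup>n\<close> with \<open>n = CARD('n)\<close>; the linear order on the index type orders the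
  coordinates, so that \<open>Min UNIV\<close> is the index of the first one.\<close>

definition half_space :: "(real^'n::{finite,linorder}) set" where
  "half_space = {x. x $ Min UNIV \<ge> 0}"

definition sliding_boundary :: "(real^'n::{finite,linorder}) set" where
  "sliding_boundary = {x. x $ Min UNIV = 0}"


section \<open>Sliding minimisers\<close>

definition sliding_energy :: "real \<Rightarrow> (real^'n::{finite,linorder}) set \<Rightarrow> ennreal" where
  "sliding_energy \<alpha> E =
     hausdorff_measure (CARD('n) - 1) (E - sliding_boundary) +
     ennreal \<alpha> * hausdorff_measure (CARD('n) - 1) (E \<inter> sliding_boundary)"

definition sliding_competitor ::
    "(real^'n::{finite,linorder}) set \<Rightarrow> (real^'n::{finite,linorder}) set \<Rightarrow> bool" where
  "sliding_competitor E F \<longleftrightarrow>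
     (\<exists>\<phi> :: real \<Rightarrow> real^'n::{finite,linorder} \<Rightarrow> real^'n::{finite,linorder}.
        continuous_on ({0..1} \<times> E) (\<lambda>(t, x). \<phi> t x) \<and>
        (\<forall>x\<in>E. \<phi> 0 x = x) \<and>
        F = \<phi> 1 ` E \<and>
        (\<exists>L. L-lipschitz_on E (\<phi> 1)) \<and>
        (let W = (\<Union>t\<in>{0..1}. {x \<in> E. \<phi> t x \<noteq> x}) in
           \<exists>K. compact K \<and> (\<lambda>(t, x). \<phi> t x) ` ({0..1} \<times> W) \<subseteq> K) \<and>
        (\<forall>t\<in>{0..1}. (\<forall>x\<in>E. \<phi> t x \<in> half_space) \<and>
                    (\<forall>x\<in>E \<inter> sliding_boundary. \<phi> t x \<in> sliding_boundary)))"

text \<open>Being contained in the half-space and having locally finite measure, which are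
  preconditions for speaking of competitors to \<open>E\<close>, are part of being a minimiser.\<close>

definition sliding_minimiser :: "real \<Rightarrow> (real^'n::{finite,linorder}) set \<Rightarrow> bool" where
  "sliding_minimiser \<alpha> E \<longleftrightarrow>
     E \<subseteq> half_space \<and>
     locally_finite_hausdorff (CARD('n) - 1) E \<and>
     (\<forall>F. sliding_competitor E F \<longrightarrow> sliding_energy \<alpha> (E - F) \<le> sliding_energy \<alpha> (F - E))"


section \<open>The cone over the skeleton of the regular simplex\<close>

definition half_line :: "'a::real_vector \<Rightarrow> 'a set" where
  "half_line v = {t *\<^sub>R v | t. t \<ge> 0}"

definition cone_over :: "'a::real_vector set \<Rightarrow> 'a set" where
  "cone_over A = \<Union>{half_line v | v. v \<noteq> 0 \<and> half_line v \<inter> A \<noteq> {}}"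

text \<open>Coordinates are numbered from 1.\<close>

definition coord_number :: "'n::{finite,linorder} \<Rightarrow> nat" where
  "coord_number i = card {..i}"

definition simplex_coeff :: "nat \<Rightarrow> nat \<Rightarrow> real" where
  "simplex_coeff n j =
     sqrt (((real n + 1) * (real n - real j + 1)) / (real n * (real n - real j + 2)))"

text \<open>Vertices are numbered from \<open>1\<close> to \<open>n + 1\<close>. For \<open>k = n + 1\<close> every coordinate number is
  less than \<open>k\<close>, so only the first branch applies.\<close>

definition simplex_vertex :: "nat \<Rightarrow> real^'n::{finite,linorder}" where
  "simplex_vertex k = (\<chi> i. let n = CARD('n); j = coord_number i in
     if j < k then simplex_coeff n j / (real n - real j + 1)
     else if j = k then - simplex_coeff n k
     else 0)"

definition regular_simplex :: "(real^'n::{finite,linorder}) set" where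
  "regular_simplex = convex hull (simplex_vertex ` {1..CARD('n) + 1})"

definition skeleton :: "int \<Rightarrow> 'a::euclidean_space set \<Rightarrow> 'a set" where
  "skeleton d P = \<Union>{S. S face_of P \<and> aff_dim S = d}"

definition simplex_cone :: "(real^'n::{finite,linorder}) set" where
  "simplex_cone = cone_over (skeleton (int CARD('n) - 2) regular_simplex)"

definition simplex_half_cone :: "(real^'n::{finite,linorder}) set" where
  "simplex_half_cone = simplex_cone \<inter> half_space"

end

theory Submission
  imports Defs
begin

text \<open>The cone is compared with a competitor \<open>F\<close> by a paired calibration. Attach to each cell \<open>i\<close> cut out
  by the cone a constant vector \<open>w i\<close> such that the differences \<open>w i - w j\<close> are the unit normals of the
  walls, \<open>w i\<close> is parallel to the boundary of the half-space for every cell that touches it along an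
  open set, and the inward flux of \<open>w 1\<close>, for the cell meeting it only at the origin, is \<open>\<alpha>\<^sub>n\<close>. The
  total flux of the \<open>w i\<close> out of the cells is the area of the cone. A sliding competitor still
  separates the cells far away from each other, and the first cell from the part of the boundary it
  does not cover; so its complement splits into regions with the same flux at infinity, and the flux
  through their boundaries is at most the area of \<open>F\<close> in the open half-space plus \<open>\<alpha>\<^sub>n\<close> times its area
  in the boundary.

  The divergence theorem for regions bounded by a closed set of finite Hausdorff measure comes from
  slicing by lines. Almost every line in a direction \<open>e\<close> meets the set finitely often, and counting the
  hits gives a measure dominated by the Hausdorff measure. Its density with respect to the Hausdorff
  measure is the component along \<open>e\<close> of the flux density, up to sign. At almost every point at most
  two regions have nonzero density, with opposite vectors of norm at most 1. The ratio of Hausdorff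
  and Lebesgue measure on hyperplanes cancels from the comparison.\<close>


section \<open>Hausdorff measure on Borel sets\<close>

text \<open>The walls dictate the constant. As \<open>w i - w j\<close> has to be the unit normal of
  a wall pointing into cell i, the vectors are determined up to one common summand. Tangency to the
  boundary for all cells but the first fixes the component of that summand along the normal
  \<open>u\<close>, and the flux left to \<open>w 1\<close> is \<open>\<alpha>\<^sub>n\<close>. A
  boundary weight \<alpha> of at least this size pays for whatever a competitor sends through the
  boundary. Two obstacles shape the argument. The complement of a competitor may have complicated
  regions without any given normal or orientation, so the divergence theorem is drawn from two facts
  only: the regions are open and the set between them has locally finite area. And the flux of
  \<open>w 1\<close> must not leak through boundary points that the competitor leaves bare, which is
  a topological statement about points arbitrarily close to the moving part of the set. No limit at
  infinity is taken: fluxes are tested against a cutoff that is 1 around the place where the two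
  sets differ, and its gradient lives where the regions of both coincide.\<close>

lemma hausdorff_premeasure_le:
  assumes "A \<subseteq> (\<Union>i. U i)" "\<And>i. bounded (U i)" "\<And>i. diameter (U i) \<le> \<delta>"
  shows "hausdorff_premeasure m \<delta> A \<le> (\<Sum>i::nat. hausdorff_weight m (U i))"
  unfolding hausdorff_premeasure_def by (rule INF_lower) (use assms in auto)

lemma hausdorff_premeasure_approx:
  assumes "hausdorff_premeasure m \<delta> A < c"
  obtains U :: "nat \<Rightarrow> 'a::metric_space set"
  where "A \<subseteq> (\<Union>i. U i)" "\<And>i. bounded (U i)" "\<And>i. diameter (U i) \<le> \<delta>"
    "(\<Sum>i. hausdorff_weight m (U i)) < c"
  using assms unfolding hausdorff_premeasure_def INF_less_iff by auto

lemma hausdorff_premeasure_mono: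
  "A \<subseteq> B \<Longrightarrow> hausdorff_premeasure m \<delta> A \<le> hausdorff_premeasure m \<delta> B"
  unfolding hausdorff_premeasure_def by (intro INF_superset_mono) auto

lemma hausdorff_premeasure_antimono:
  "\<delta> \<le> \<epsilon> \<Longrightarrow> hausdorff_premeasure m \<epsilon> A \<le> hausdorff_premeasure m \<delta> A"
  unfolding hausdorff_premeasure_def by (intro INF_superset_mono) (auto intro: order_trans)

lemma hausdorff_premeasure_empty: "\<delta> > 0 \<Longrightarrow> hausdorff_premeasure m \<delta> {} = 0"
  using hausdorff_premeasure_le[of "{}" "\<lambda>_. {}" \<delta> m] by (simp add: hausdorff_weight_def)

text \<open>Coverings of the \<open>A n\<close> with errors e/2^(n+1) are merged into a single
  sequence along \<open>prod_decode\<close>; the errors add up to e.\<close>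

lemma hausdorff_premeasure_countable_subadditive:
  fixes A :: "nat \<Rightarrow> 'a::metric_space set"
  shows "hausdorff_premeasure m \<delta> (\<Union>i. A i) \<le> (\<Sum>i. hausdorff_premeasure m \<delta> (A i))"
proof (rule ennreal_le_epsilon)
  fix e :: real
  let ?O = "hausdorff_premeasure m \<delta>"
  assume e: "0 < e" "(\<Sum>n. ?O (A n)) < top"
  then have *: "?O (A n) < ?O (A n) + e * (1/2)^Suc n" for n
    by (auto simp add: less_top dest!: ennreal_suminf_lessD)
  have "\<exists>U::nat \<Rightarrow> 'a set. A n \<subseteq> (\<Union>i. U i) \<and> (\<forall>i. bounded (U i) \<and> diameter (U i) \<le> \<delta>) \<and>
      (\<Sum>i. hausdorff_weight m (U i)) \<le> ?O (A n) + e * (1/2)^Suc n" for n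
    using hausdorff_premeasure_approx[OF *[of n]] by (metis order_less_imp_le)
  then obtain B :: "nat \<Rightarrow> nat \<Rightarrow> 'a set"
    where B: "\<And>n. A n \<subseteq> (\<Union>i. B n i)" "\<And>n i. bounded (B n i) \<and> diameter (B n i) \<le> \<delta>"
      "\<And>n. (\<Sum>i. hausdorff_weight m (B n i)) \<le> ?O (A n) + e * (1/2)^Suc n"
    by metis
  define C where "C = case_prod B o prod_decode"
  have "(\<Union>i. A i) \<subseteq> (\<Union>i. C i)"
    using B(1) by (auto simp add: C_def subset_eq) (metis prod.case prod_encode_inverse)
  then have "?O (\<Union>i. A i) \<le> (\<Sum>i. hausdorff_weight m (C i))"
    by (rule hausdorff_premeasure_le) (use B(2) in \<open>auto simp: C_def split_beta\<close>)
  also have "\<dots> = (\<Sum>n. \<Sum>i. hausdorff_weight m (B n i))"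
    unfolding C_def comp_def by (intro suminf_ennreal_2dimen) auto
  also have "\<dots> \<le> (\<Sum>n. ?O (A n) + e * (1/2) ^ Suc n)"
    by (intro suminf_le suminf_nonneg allI B(3)) auto
  also have "\<dots> = (\<Sum>n. ?O (A n)) + (\<Sum>n. ennreal e * ennreal ((1/2) ^ Suc n))"
    using \<open>0 < e\<close> by (subst suminf_add[symmetric])
      (auto simp del: ennreal_suminf_cmult simp add: ennreal_mult[symmetric])
  also have "\<dots> = (\<Sum>n. ?O (A n)) + e"
    unfolding ennreal_suminf_cmult
    by (subst suminf_ennreal_eq[OF zero_le_power power_half_series]) auto
  finally show "?O (\<Union>i. A i) \<le> (\<Sum>n. ?O (A n)) + e" .
qed

lemma hausdorff_premeasure_le_measure:
  "\<delta> > 0 \<Longrightarrow> hausdorff_premeasure m \<delta> A \<le> hausdorff_measure m A"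
  unfolding hausdorff_measure_def by (rule SUP_upper) auto

lemma hausdorff_measure_mono: "A \<subseteq> B \<Longrightarrow> hausdorff_measure m A \<le> hausdorff_measure m B"
  unfolding hausdorff_measure_def by (intro SUP_mono) (use hausdorff_premeasure_mono in blast)

lemma hausdorff_measure_empty [simp]: "hausdorff_measure m {} = 0"
  unfolding hausdorff_measure_def by (simp add: hausdorff_premeasure_empty bot_ennreal)

lemma hausdorff_measure_countable_subadditive:
  fixes A :: "nat \<Rightarrow> 'a::metric_space set"
  shows "hausdorff_measure m (\<Union>i. A i) \<le> (\<Sum>i. hausdorff_measure m (A i))"
  unfolding hausdorff_measure_def[of m "\<Union>i. A i"]
proof (rule SUP_least)
  fix \<delta> :: real assume "\<delta> \<in> {0<..}"
  then show "hausdorff_premeasure m \<delta> (\<Union>i. A i) \<le> (\<Sum>i. hausdorff_measure m (A i))"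
    using hausdorff_premeasure_countable_subadditive[of m \<delta> A]
    by (auto elim!: order_trans intro!: suminf_le hausdorff_premeasure_le_measure)
qed

lemma hausdorff_outer_measure_space: "outer_measure_space UNIV (hausdorff_measure m)"
  unfolding outer_measure_space_def positive_def increasing_def countably_subadditive_def
  by (simp add: hausdorff_measure_mono hausdorff_measure_countable_subadditive)

lemma hausdorff_measure_Un_le:
  "hausdorff_measure m (A \<union> B) \<le> hausdorff_measure m A + hausdorff_measure m B"
proof -
  have "hausdorff_measure m (A \<union> B) \<le> (\<Sum>i. hausdorff_measure m ((\<lambda>i::nat. if i = 0 then A else if i = 1 then B else {}) i))"
    by (rule order_trans[OF hausdorff_measure_mono hausdorff_measure_countable_subadditive])
      (auto split: if_splits)
  also have "\<dots> = (\<Sum>i\<in>{0,1}. hausdorff_measure m ((\<lambda>i::nat. if i = 0 then A else if i = 1 then B else {}) i))"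
    by (rule suminf_finite) auto
  finally show ?thesis by simp
qed

text \<open>A covering set of diameter below \<open>d\<close> cannot meet both \<open>A\<close> and
  \<open>B\<close>, so every fine covering of the union splits into a covering of \<open>A\<close>
  and one of \<open>B\<close> without counting any weight twice.\<close>

lemma hausdorff_measure_separated:
  fixes A B :: "'a::metric_space set"
  assumes d: "d > 0" "\<And>x y. x \<in> A \<Longrightarrow> y \<in> B \<Longrightarrow> dist x y \<ge> d"
  shows "hausdorff_measure m A + hausdorff_measure m B \<le> hausdorff_measure m (A \<union> B)"
proof -
  have pre: "hausdorff_premeasure m \<delta> A + hausdorff_premeasure m \<delta> B \<le> hausdorff_premeasure m \<delta> (A \<union> B)"
    if \<delta>: "0 < \<delta>" "\<delta> < d" for \<delta>
    unfolding hausdorff_premeasure_def[of m \<delta> "A \<union> B"]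
  proof (rule INF_greatest)
    fix U :: "nat \<Rightarrow> 'a set"
    assume "U \<in> {U. A \<union> B \<subseteq> (\<Union>i. U i) \<and> (\<forall>i. bounded (U i) \<and> diameter (U i) \<le> \<delta>)}"
    then have U: "A \<union> B \<subseteq> (\<Union>i. U i)" "\<And>i. bounded (U i)" "\<And>i. diameter (U i) \<le> \<delta>" by auto
    let ?V = "\<lambda>i. if U i \<inter> A = {} then {} else U i"
    let ?W = "\<lambda>i. if U i \<inter> A = {} then U i else {}"
    have "hausdorff_premeasure m \<delta> A \<le> (\<Sum>i. hausdorff_weight m (?V i))"
    proof (rule hausdorff_premeasure_le)
      show "A \<subseteq> (\<Union>i. ?V i)" using U(1) by fastforce
    qed (use U \<delta> in auto)
    moreover have "hausdorff_premeasure m \<delta> B \<le> (\<Sum>i. hausdorff_weight m (?W i))"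
    proof (rule hausdorff_premeasure_le)
      show "B \<subseteq> (\<Union>i. ?W i)"
      proof
        fix y assume y: "y \<in> B"
        then obtain i where i: "y \<in> U i" using U by auto
        have "U i \<inter> A = {}"
        proof (rule ccontr)
          assume "U i \<inter> A \<noteq> {}"
          then obtain x where x: "x \<in> U i" "x \<in> A" by auto
          have "dist x y \<le> diameter (U i)" using diameter_bounded_bound[OF U(2)] x i by auto
          with U(3)[of i] d(2)[OF x(2) y] \<delta> show False by auto
        qed
        with i show "y \<in> (\<Union>i. ?W i)" by auto
      qed
    qed (use U \<delta> in auto)
    ultimately have "hausdorff_premeasure m \<delta> A + hausdorff_premeasure m \<delta> B \<le>
        (\<Sum>i. hausdorff_weight m (?V i)) + (\<Sum>i. hausdorff_weight m (?W i))"
      by (rule add_mono)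
    also have "\<dots> = (\<Sum>i. hausdorff_weight m (?V i) + hausdorff_weight m (?W i))"
      by (rule suminf_add) auto
    also have "\<dots> = (\<Sum>i. hausdorff_weight m (U i))"
      by (rule suminf_cong) (simp add: hausdorff_weight_def)
    finally show "hausdorff_premeasure m \<delta> A + hausdorff_premeasure m \<delta> B \<le> (\<Sum>i. hausdorff_weight m (U i))" .
  qed
  \<comment> \<open>Premeasures grow as \<delta> shrinks. Hence only \<delta> below \<open>d\<close>
    matter, and the two suprema add up because the family is directed.\<close>
  have "hausdorff_measure m A + hausdorff_measure m B =
      (SUP \<delta>\<in>{0<..<d}. hausdorff_premeasure m \<delta> A + hausdorff_premeasure m \<delta> B)"
  proof -
    have *: "hausdorff_measure m A = (SUP \<delta>\<in>{0<..<d}. hausdorff_premeasure m \<delta> A)" for A :: "'a set"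
      unfolding hausdorff_measure_def
    proof (rule antisym)
      show "(SUP \<delta>\<in>{0<..}. hausdorff_premeasure m \<delta> A) \<le> (SUP \<delta>\<in>{0<..<d}. hausdorff_premeasure m \<delta> A)"
      proof (rule SUP_mono)
        fix \<delta> :: real assume "\<delta> \<in> {0<..}"
        then show "\<exists>\<epsilon>\<in>{0<..<d}. hausdorff_premeasure m \<delta> A \<le> hausdorff_premeasure m \<epsilon> A"
          using d by (intro bexI[of _ "min \<delta> (d/2)"] hausdorff_premeasure_antimono) auto
      qed
    qed (intro SUP_subset_mono, auto)
    have "(SUP \<delta>\<in>{0<..<d}. hausdorff_premeasure m \<delta> A + hausdorff_premeasure m \<delta> B) =
      (SUP \<delta>\<in>{0<..<d}. hausdorff_premeasure m \<delta> A) + (SUP \<delta>\<in>{0<..<d}. hausdorff_premeasure m \<delta> B)"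
    proof (rule SUP_add_directed_ennreal)
      fix \<delta> \<epsilon> :: real assume "\<delta> \<in> {0<..<d}" "\<epsilon> \<in> {0<..<d}"
      then show "\<exists>k\<in>{0<..<d}. hausdorff_premeasure m \<delta> A + hausdorff_premeasure m \<epsilon> B
          \<le> hausdorff_premeasure m k A + hausdorff_premeasure m k B"
        by (intro bexI[of _ "min \<delta> \<epsilon>"] add_mono hausdorff_premeasure_antimono) auto
    qed
    then show ?thesis by (simp add: *)
  qed
  also have "\<dots> \<le> hausdorff_measure m (A \<union> B)"
    by (rule SUP_least) (use pre hausdorff_premeasure_le_measure order_trans in fastforce)
  finally show ?thesis .
qed

lemma hausdorff_measure_UN_separated:
  fixes R :: "nat \<Rightarrow> 'a::metric_space set"
  assumes "\<And>i j. i < j \<Longrightarrow> \<exists>d>0. \<forall>x\<in>R i. \<forall>y\<in>R j. dist x y \<ge> d" 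
  shows "(\<Sum>i<n. hausdorff_measure m (R i)) \<le> hausdorff_measure m (\<Union>i<n. R i)"
proof (induction n)
  case (Suc n)
  have "\<exists>d>0. \<forall>i<k. \<forall>x\<in>R i. \<forall>y\<in>R n. dist x y \<ge> d" if "k \<le> n" for k
    using that
  proof (induction k)
    case 0 then show ?case by (auto intro: exI[of _ 1])
  next
    case (Suc k)
    then obtain d where d: "d>0" "\<forall>i<k. \<forall>x\<in>R i. \<forall>y\<in>R n. dist x y \<ge> d" by auto
    obtain d' where d': "d'>0" "\<forall>x\<in>R k. \<forall>y\<in>R n. dist x y \<ge> d'" using assms[of k n] Suc by auto
    show ?case
      by (rule exI[of _ "min d d'"]) (use d d' in \<open>auto simp: less_Suc_eq min_le_iff_disj\<close>)
  qed
  from this[of n] obtain d where d: "d>0" "\<forall>i<n. \<forall>x\<in>R i. \<forall>y\<in>R n. dist x y \<ge> d" by auto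
  have "hausdorff_measure m (\<Union>i<n. R i) + hausdorff_measure m (R n) \<le> hausdorff_measure m ((\<Union>i<n. R i) \<union> R n)"
    by (rule hausdorff_measure_separated[OF d(1)]) (use d(2) in auto)
  also have "(\<Union>i<n. R i) \<union> R n = (\<Union>i<Suc n. R i)" by (auto simp: less_Suc_eq)
  finally show ?case using Suc by (auto elim!: order_trans[rotated] intro: add_mono)
qed auto

text \<open>Caratheodory's criterion. The shells \<open>R i\<close> of points whose distance to \<open>C\<close> lies in
  \<open>[1/(i+2), 1/(i+1))\<close> are separated as soon as their indices differ by at least two, so the sum
  of their measures is finite and its tails vanish.\<close>

lemma closed_hausdorff_lambda_system:
  fixes C :: "'a::metric_space set"
  assumes "closed C"
  shows "C \<in> lambda_system UNIV UNIV (hausdorff_measure m)"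
proof -
  let ?H = "hausdorff_measure m"
  interpret sigma_algebra UNIV "UNIV :: 'a set set" using sigma_algebra_Pow[of UNIV] by simp
  have le: "?H (A \<inter> C) + ?H (A - C) \<le> ?H A" for A
  proof (cases "C = {} \<or> ?H A = top")
    case False
    then have fin: "?H A < top" and C: "C \<noteq> {}" by (auto simp: top.not_eq_extremum)
    define g where "g x = infdist x C" for x
    define B where "B k = {x\<in>A. g x \<ge> 1/real (Suc k)}" for k
    define R where "R k = {x\<in>A. g x < 1/real (Suc k) \<and> g x \<ge> 1/real (Suc (Suc k))}" for k
    have lip: "g x \<le> g y + dist x y" for x y
      using infdist_triangle[of x C y] by (simp add: g_def)
    have sep: "\<exists>d>0. \<forall>x\<in>R i. \<forall>y\<in>R j. dist x y \<ge> d" if "i + 2 \<le> j" for i j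
    proof (intro exI[of _ "1/real (Suc (Suc i)) - 1/real (Suc j)"] conjI ballI)
      show "0 < 1/real (Suc (Suc i)) - 1/real (Suc j)" using that by (auto intro!: divide_strict_left_mono)
      fix x y assume "x \<in> R i" "y \<in> R j"
      then show "1/real (Suc (Suc i)) - 1/real (Suc j) \<le> dist x y" using lip[of x y] by (auto simp: R_def)
    qed
    have RA: "R i \<subseteq> A" for i by (auto simp: R_def)
    \<comment> \<open>Shells of equal parity have indices at least two apart, so each parity class
      contributes at most \<open>?H A\<close>.\<close>
    have even: "(\<Sum>i<n. ?H (R (2*i))) \<le> ?H A" for n
      by (rule order_trans[OF hausdorff_measure_UN_separated hausdorff_measure_mono])
        (rule sep, simp, use RA in blast)
    have odd: "(\<Sum>i<n. ?H (R (2*i+1))) \<le> ?H A" for n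
      by (rule order_trans[OF hausdorff_measure_UN_separated hausdorff_measure_mono])
        (rule sep, simp, use RA in blast)
    have split: "(\<Sum>i<2*n. f i) = (\<Sum>i<n. f (2*i)) + (\<Sum>i<n. f (2*i+1))" for f :: "nat \<Rightarrow> ennreal" and n
      by (induction n) (auto simp: ac_simps)
    have "(\<Sum>i<n. ?H (R i)) \<le> ?H A + ?H A" for n
    proof -
      have "(\<Sum>i<n. ?H (R i)) \<le> (\<Sum>i<2*n. ?H (R i))" by (rule sum_mono2) auto
      also have "\<dots> \<le> ?H A + ?H A" unfolding split using even odd by (rule add_mono)
      finally show ?thesis .
    qed
    then have "(\<Sum>i. ?H (R i)) \<le> ?H A + ?H A" by (intro suminf_le_const) auto
    also have "\<dots> < top" using fin by simp
    finally have finR: "(\<Sum>i. ?H (R i)) \<noteq> top" by simp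
    have cov: "A - C \<subseteq> B k \<union> (\<Union>i. R (i + k))" for k
    proof
      fix x assume x: "x \<in> A - C"
      then have "g x \<noteq> 0" using in_closed_iff_infdist_zero[OF assms C] by (auto simp: g_def)
      then have gx: "g x > 0" using infdist_nonneg[of x C] by (auto simp: g_def)
      show "x \<in> B k \<union> (\<Union>i. R (i + k))"
      proof (cases "g x \<ge> 1/real (Suc k)")
        case False
        obtain j where j: "1/real (Suc j) \<le> g x"
          using gx reals_Archimedean[of "g x"] unfolding inverse_eq_divide by (meson less_imp_le)
        \<comment> \<open>By minimality of \<open>l\<close> the value \<open>g x\<close> is below
          1/l, which places \<open>x\<close> in the shell of index \<open>l - 1\<close>; this index
          is at least \<open>k\<close>.\<close>
        define l where "l = (LEAST j. 1/real (Suc j) \<le> g x)"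
        have l: "1/real (Suc l) \<le> g x" unfolding l_def by (rule LeastI[of _ j]) (rule j)
        have "k < l"
        proof (rule ccontr)
          assume "\<not> k < l"
          then have "1/real (Suc k) \<le> 1/real (Suc l)" by (simp add: field_simps)
          with l False show False by auto
        qed
        have "\<not> 1/real (Suc (l-1)) \<le> g x" using not_less_Least[of "l-1" "\<lambda>j. 1/real (Suc j) \<le> g x"] \<open>k<l\<close>
          unfolding l_def[symmetric] by auto
        then have "x \<in> R (l-1)" using x l \<open>k<l\<close> by (simp add: R_def)
        then show ?thesis using \<open>k<l\<close> by (auto intro!: exI[of _ "l-1-k"])
      qed (use x in \<open>auto simp: B_def\<close>)
    qed
    have key: "?H (A \<inter> C) + ?H (A - C) \<le> ?H A + (\<Sum>i. ?H (R (i + k)))" for k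
    proof -
      have "?H (A \<inter> C) + ?H (B k) \<le> ?H ((A \<inter> C) \<union> B k)"
      proof (rule hausdorff_measure_separated[of "1/real (Suc k)"])
        fix x y assume "x \<in> A \<inter> C" "y \<in> B k"
        then show "1/real (Suc k) \<le> dist x y"
          using infdist_le[of x C y] by (auto simp: B_def g_def dist_commute)
      qed auto
      also have "\<dots> \<le> ?H A" by (rule hausdorff_measure_mono) (auto simp: B_def)
      finally have 1: "?H (A \<inter> C) + ?H (B k) \<le> ?H A" .
      have "?H (A - C) \<le> ?H (B k) + (\<Sum>i. ?H (R (i + k)))"
        by (rule order_trans[OF hausdorff_measure_mono[OF cov[of k]]
              order_trans[OF hausdorff_measure_Un_le]])
          (intro add_mono order_refl hausdorff_measure_countable_subadditive)
      then have "?H (A \<inter> C) + ?H (A - C) \<le> (?H (A \<inter> C) + ?H (B k)) + (\<Sum>i. ?H (R (i + k)))"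
        by (metis add.assoc add_left_mono)
      also have "\<dots> \<le> ?H A + (\<Sum>i. ?H (R (i + k)))" using 1 by (rule add_right_mono)
      finally show ?thesis .
    qed
    have "(\<lambda>k. \<Sum>i. ?H (R (i + k))) \<longlonglongrightarrow> 0"
    proof -
      have fr: "?H (R i) \<noteq> top" for i
        using fin hausdorff_measure_mono[of "R i" A m] by (auto simp: R_def top.not_eq_extremum)
      define r where "r i = enn2real (?H (R i))" for i
      have r: "?H (R i) = ennreal (r i)" "r i \<ge> 0" for i using fr by (auto simp: r_def top.not_eq_extremum)
      have sm: "summable r"
        by (rule summable_suminf_not_top) (use r finR in auto)
      then have "(\<lambda>k. \<Sum>i. r (i + k)) \<longlonglongrightarrow> 0" by (rule suminf_exist_split2)
      then have "(\<lambda>k. ennreal (\<Sum>i. r (i + k))) \<longlonglongrightarrow> ennreal 0" by (rule tendsto_ennrealI)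
      moreover have "(\<Sum>i. ?H (R (i + k))) = ennreal (\<Sum>i. r (i + k))" for k
        unfolding r(1) using sm by (intro suminf_ennreal2 r(2)) (simp add: summable_iff_shift)
      ultimately show ?thesis by simp
    qed
    then have "(\<lambda>k. ?H A + (\<Sum>i. ?H (R (i + k)))) \<longlonglongrightarrow> ?H A + 0"
      by (intro tendsto_add tendsto_const) auto
    from LIMSEQ_le_const[OF this] key show ?thesis by auto
  qed auto
  have "?H (A \<inter> C) + ?H (A - C) = ?H A" for A
    by (rule antisym[OF le]) (metis hausdorff_measure_Un_le Int_Diff_Un)
  then show ?thesis
    unfolding lambda_system_def by (auto simp: Int_commute Diff_eq)
qed

section \<open>Hausdorff measure as a Borel measure, and its behaviour under distance-decreasing
  maps\<close>

definition hmeas :: "nat \<Rightarrow> 'a::metric_space measure" where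
  "hmeas m = measure_of UNIV (sets borel) (hausdorff_measure m)"

lemma measure_space_hausdorff: "measure_space UNIV (sets borel) (hausdorff_measure m :: 'a::metric_space set \<Rightarrow> _)"
proof -
  interpret sigma_algebra UNIV "UNIV :: 'a set set" using sigma_algebra_Pow[of UNIV] by simp
  let ?L = "lambda_system UNIV UNIV (hausdorff_measure m :: 'a set \<Rightarrow> _)"
  have ms: "measure_space UNIV ?L (hausdorff_measure m)"
    by (rule caratheodory_lemma[OF hausdorff_outer_measure_space])
  then interpret L: sigma_algebra UNIV ?L by (simp add: measure_space_def)
  have "sets borel \<subseteq> ?L"
    unfolding borel_eq_closed
    using L.sigma_sets_subset[of "Collect closed"] closed_hausdorff_lambda_system[where 'a='a]
    by (auto simp: sets_measure_of)
  then show ?thesis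
    using ms sets.sigma_algebra_axioms[of "borel :: 'a measure"] by (auto intro: measure_down)
qed

lemma space_hmeas [simp]: "space (hmeas m) = UNIV"
  and sets_hmeas [measurable_cong, simp]: "sets (hmeas m) = sets borel"
  unfolding hmeas_def
   apply (simp add: space_measure_of_conv)
  using sets.sigma_sets_eq[of borel] by (simp add: sets_measure_of_conv)

lemma emeasure_hmeas: "B \<in> sets borel \<Longrightarrow> emeasure (hmeas m) B = hausdorff_measure m B"
  using measure_space_hausdorff[of m, where 'a='a]
  unfolding hmeas_def measure_space_def by (intro emeasure_measure_of_sigma) auto

text \<open>Each covering set is cut down to \<open>A\<close> before it is mapped, since
  \<open>f\<close> is controlled only there; the image of such a piece has no larger
  diameter.\<close>

lemma hausdorff_measure_lipschitz_image:
  fixes f :: "'a::metric_space \<Rightarrow> 'b::metric_space"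
  assumes f: "\<And>x y. x \<in> A \<Longrightarrow> y \<in> A \<Longrightarrow> dist (f x) (f y) \<le> dist x y"
  shows "hausdorff_measure m (f ` A) \<le> hausdorff_measure m A"
  unfolding hausdorff_measure_def
proof (rule SUP_mono, rule bexI)
  fix \<delta> :: real assume \<delta>: "\<delta> \<in> {0<..}"
  show "hausdorff_premeasure m \<delta> (f ` A) \<le> hausdorff_premeasure m \<delta> A"
    unfolding hausdorff_premeasure_def[of m \<delta> A]
  proof (rule INF_greatest)
    fix U :: "nat \<Rightarrow> 'a set"
    assume "U \<in> {U. A \<subseteq> (\<Union>i. U i) \<and> (\<forall>i. bounded (U i) \<and> diameter (U i) \<le> \<delta>)}"
    then have U: "A \<subseteq> (\<Union>i. U i)" "\<And>i. bounded (U i)" "\<And>i. diameter (U i) \<le> \<delta>" by auto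
    have d: "dist u v \<le> diameter (U i)" if "u \<in> f ` (U i \<inter> A)" "v \<in> f ` (U i \<inter> A)" for u v i
      using that f diameter_bounded_bound[OF U(2), of _ i] by (clarsimp, meson order_trans)
    have bd: "bounded (f ` (U i \<inter> A))" for i
      using d[of _ i] unfolding bounded_two_points by blast
    have dd: "diameter (f ` (U i \<inter> A)) \<le> diameter (U i)" for i
    proof (rule ccontr)
      \<comment> \<open>A value strictly between the two diameters: two points of the image are
        further apart than \<open>?e\<close>, which exceeds the bound \<open>d\<close> on their
        distance.\<close>
      let ?e = "(diameter (U i) + diameter (f ` (U i \<inter> A))) / 2"
      assume "\<not> ?thesis"
      then have "0 < ?e" "?e < diameter (f ` (U i \<inter> A))" "diameter (U i) < ?e"
        using diameter_ge_0[OF U(2), of i] by auto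
      with diameter_bounded(2)[OF bd[of i]] obtain u v
        where "u \<in> f ` (U i \<inter> A)" "v \<in> f ` (U i \<inter> A)" "?e < dist u v" by blast
      with d[of u i v] \<open>diameter (U i) < ?e\<close> show False by linarith
    qed
    have "hausdorff_premeasure m \<delta> (f ` A) \<le> (\<Sum>i. hausdorff_weight m (f ` (U i \<inter> A)))"
    proof (rule hausdorff_premeasure_le)
      have "A \<subseteq> (\<Union>i. U i \<inter> A)" using U(1) by auto
      then show "f ` A \<subseteq> (\<Union>i. f ` (U i \<inter> A))" unfolding image_UN[symmetric] by (rule image_mono)
    qed (use bd order_trans[OF dd U(3)] in auto)
    also have "\<dots> \<le> (\<Sum>i. hausdorff_weight m (U i))"
      by (intro suminf_le summableI)
        (auto simp: hausdorff_weight_def diameter_ge_0[OF bd]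
          intro!: ennreal_leI mult_left_mono power_mono divide_right_mono dd)
    finally show "hausdorff_premeasure m \<delta> (f ` A) \<le> (\<Sum>i. hausdorff_weight m (U i))" .
  qed
qed

lemma hausdorff_measure_isometry:
  fixes f :: "'a::metric_space \<Rightarrow> 'b::metric_space"
  assumes f: "\<And>x y. x \<in> A \<Longrightarrow> y \<in> A \<Longrightarrow> dist (f x) (f y) = dist x y"
  shows "hausdorff_measure m (f ` A) = hausdorff_measure m A"
proof (rule antisym)
  show "hausdorff_measure m (f ` A) \<le> hausdorff_measure m A"
    by (rule hausdorff_measure_lipschitz_image) (simp add: f)
  have inj: "inj_on f A" using f by (metis dist_eq_0_iff inj_onI)
  have "hausdorff_measure m (the_inv_into A f ` f ` A) \<le> hausdorff_measure m (f ` A)"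
    by (rule hausdorff_measure_lipschitz_image) (auto simp: the_inv_into_f_f[OF inj] f)
  then show "hausdorff_measure m A \<le> hausdorff_measure m (f ` A)"
    by (simp add: image_image the_inv_into_f_f[OF inj] cong: image_cong_simp)
qed


section \<open>Area on hyperplanes\<close>

text \<open>Uniqueness of translation-invariant measures by Fubini: the function 1_A(x) 1_B(x+y) is
  integrated over \<open>M\<close> and Lebesgue measure in both orders. The product form avoids
  dividing by values that may be zero or infinite.\<close>

lemma emeasure_translation_invariant:
  fixes M :: "'a::euclidean_space measure"
  assumes sets: "sets M = sets borel" and "sigma_finite_measure M"
    and inv: "\<And>v. distr M borel ((+) v) = M"
    and A: "A \<in> sets borel" and B: "B \<in> sets borel"
  shows "emeasure M A * emeasure lborel B = emeasure M B * emeasure lborel A"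
proof -
  interpret M: sigma_finite_measure M by fact
  interpret pair_sigma_finite M "lborel :: 'a measure" ..
  have [measurable_cong]: "sets M = sets borel" by fact
  note [measurable] = A B
  have "emeasure M A * emeasure lborel B = (\<integral>\<^sup>+x. indicator A x * emeasure lborel B \<partial>M)"
    by (simp add: nn_integral_multc)
  also have "\<dots> = (\<integral>\<^sup>+x. \<integral>\<^sup>+y. indicator A x * indicator B (x + y) \<partial>lborel \<partial>M)"
  proof (rule nn_integral_cong)
    fix x :: 'a
    have "emeasure lborel B = (\<integral>\<^sup>+y. indicator B y \<partial>distr lborel borel ((+) x))"
      by (simp add: lborel_distr_plus)
    also have "\<dots> = (\<integral>\<^sup>+y. indicator B (x + y) \<partial>lborel)" by (subst nn_integral_distr) auto
    finally show "indicator A x * emeasure lborel B = (\<integral>\<^sup>+y. indicator A x * indicator B (x + y) \<partial>lborel)"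
      by (simp add: nn_integral_cmult)
  qed
  also have "\<dots> = (\<integral>\<^sup>+y. \<integral>\<^sup>+x. indicator A x * indicator B (x + y) \<partial>M \<partial>lborel)"
    by (rule Fubini'[symmetric]) simp
  also have "\<dots> = (\<integral>\<^sup>+y. \<integral>\<^sup>+x. indicator A (- y + x) * indicator B x \<partial>M \<partial>lborel)"
  proof (rule nn_integral_cong)
    fix y :: 'a
    have "(\<integral>\<^sup>+x. indicator A x * indicator B (x + y) \<partial>M)
        = (\<integral>\<^sup>+x. indicator A x * indicator B (x + y) \<partial>distr M borel ((+) (- y)))"
      by (simp add: inv)
    also have "\<dots> = (\<integral>\<^sup>+x. indicator A (- y + x) * indicator B x \<partial>M)"
      by (subst nn_integral_distr) auto
    finally show "(\<integral>\<^sup>+x. indicator A x * indicator B (x + y) \<partial>M) = \<dots>" .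
  qed
  also have "\<dots> = (\<integral>\<^sup>+x. \<integral>\<^sup>+y. indicator A (- y + x) * indicator B x \<partial>lborel \<partial>M)"
    by (rule Fubini') simp
  also have "\<dots> = (\<integral>\<^sup>+x. emeasure lborel A * indicator B x \<partial>M)"
  proof (rule nn_integral_cong)
    fix x :: 'a
    have "emeasure lborel A = (\<integral>\<^sup>+y. indicator A y \<partial>lborel)" by simp
    \<comment> \<open>Lebesgue measure is also invariant under point reflections:
      \<open>lborel_affine\<close> is applied with factor -1.\<close>
    also have "\<dots> = (\<integral>\<^sup>+y. indicator A (- y + x) \<partial>lborel)"
    proof -
      have "(\<integral>\<^sup>+y. indicator A y \<partial>lborel) =
          (\<integral>\<^sup>+y. indicator A y \<partial>density (distr lborel borel (\<lambda>z. x + (-1) *\<^sub>R z)) (\<lambda>_. ennreal (\<bar>-1\<bar> ^ DIM('a))))"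
        by (subst lborel_affine[of "-1" x]) simp_all
      also have "\<dots> = (\<integral>\<^sup>+y. indicator A (- y + x) \<partial>lborel)"
        by (subst nn_integral_density, simp, simp, subst nn_integral_distr) (auto simp: algebra_simps)
      finally show ?thesis .
    qed
    finally show "(\<integral>\<^sup>+y. indicator A (- y + x) * indicator B x \<partial>lborel) = emeasure lborel A * indicator B x"
      by (simp add: nn_integral_multc)
  qed
  also have "\<dots> = emeasure M B * emeasure lborel A"
    using A by (subst nn_integral_cmult) (auto simp: mult.commute B sets)
  finally show ?thesis .
qed

text \<open>\<open>area\<close> is the Borel measure used for integration; \<open>harea\<close>
  below is the same quantity as an outer measure on arbitrary sets.\<close>

definition area :: "'a::euclidean_space measure" where
  "area = hmeas (DIM('a) - 1)"

definition harea :: "'a::euclidean_space set \<Rightarrow> ennreal" where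
  "harea = hausdorff_measure (DIM('a) - 1)"

lemma harea_mono: "A \<subseteq> B \<Longrightarrow> harea A \<le> harea B"
  unfolding harea_def by (rule hausdorff_measure_mono)

lemma harea_isometry:
  fixes f :: "'a::euclidean_space \<Rightarrow> 'a"
  assumes "\<And>x y. x \<in> A \<Longrightarrow> y \<in> A \<Longrightarrow> dist (f x) (f y) = dist x y"
  shows "harea (f ` A) = harea A"
  unfolding harea_def using assms by (rule hausdorff_measure_isometry)

lemma harea_lipschitz_image:
  fixes f :: "'a::euclidean_space \<Rightarrow> 'a"
  assumes "\<And>x y. x \<in> A \<Longrightarrow> y \<in> A \<Longrightarrow> dist (f x) (f y) \<le> dist x y"
  shows "harea (f ` A) \<le> harea A"
  unfolding harea_def using assms by (rule hausdorff_measure_lipschitz_image)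

lemma space_area [simp]: "space area = UNIV"
  and sets_area [measurable_cong, simp]: "sets area = sets borel"
  by (simp_all add: area_def)

lemma emeasure_area: "B \<in> sets borel \<Longrightarrow> emeasure area B = harea B"
  by (simp add: area_def harea_def emeasure_hmeas)

section \<open>Hyperplanes through the origin, and the reflections that permute them\<close>

definition perp :: "'a::euclidean_space \<Rightarrow> 'a set" where
  "perp e = {x. x \<bullet> e = 0}"

lemma closed_perp: "closed (perp e)"
  unfolding perp_def using closed_hyperplane[of e 0] by (simp add: inner_commute)

lemma perp_borel [measurable]: "perp e \<in> sets borel"
  using closed_perp by (rule borel_closed)

text \<open>The reflection in the hyperplane orthogonal to \<open>e - b\<close>, which exchanges
  vectors \<open>e\<close> and \<open>b\<close> of equal length. For \<open>e = b\<close> the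
  convention for division by zero turns it into the identity. It carries statements about the
  hyperplane of a basis vector to all unit directions.\<close>

definition swap_refl :: "'a::real_inner \<Rightarrow> 'a \<Rightarrow> 'a \<Rightarrow> 'a" where
  "swap_refl e b x = x - (2 * ((x \<bullet> (e - b)) / ((e - b) \<bullet> (e - b)))) *\<^sub>R (e - b)"

lemma linear_swap_refl: "linear (swap_refl e b)"
  unfolding swap_refl_def
  by (rule linearI) (simp_all add: inner_add_left add_divide_distrib distrib_left scaleR_add_left
      scaleR_diff_right mult.left_commute)

lemma inner_swap_refl: "swap_refl e b x \<bullet> swap_refl e b y = x \<bullet> y"
proof (cases "e = b")
  case False
  define v where "v = e - b"
  define c where "c z = (z \<bullet> v) / (v \<bullet> v)" for z
  have cv: "c z * (v \<bullet> v) = z \<bullet> v" for z using False by (simp add: c_def v_def)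
  have "swap_refl e b x \<bullet> swap_refl e b y = (x - (2 * c x) *\<^sub>R v) \<bullet> (y - (2 * c y) *\<^sub>R v)"
    by (simp add: swap_refl_def c_def v_def)
  also have "\<dots> = x \<bullet> y - 2 * c y * (x \<bullet> v) - 2 * c x * (y \<bullet> v) + 4 * c x * (c y * (v \<bullet> v))"
    by (simp add: inner_diff_left inner_diff_right inner_commute algebra_simps)
  also have "\<dots> = x \<bullet> y - 2 * c y * (x \<bullet> v) + 2 * (c x * (y \<bullet> v))" unfolding cv by simp
  also have "c x * (y \<bullet> v) = c y * (x \<bullet> v)" by (simp add: c_def)
  finally show ?thesis by simp
qed (simp add: swap_refl_def)

lemma swap_refl_swap:
  assumes "e \<bullet> e = b \<bullet> b"
  shows "swap_refl e b e = b" "swap_refl e b b = e"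
proof -
  show "swap_refl e b e = b"
  proof (cases "e = b")
    case False
    then have nz: "(e - b) \<bullet> (e - b) \<noteq> 0" by simp
    have "2 * (e \<bullet> (e - b)) = (e - b) \<bullet> (e - b)"
      using assms by (simp add: inner_diff_left inner_diff_right inner_commute)
    then have "e \<bullet> (e - b) = ((e - b) \<bullet> (e - b)) / 2" by linarith
    then have h: "2 * ((e \<bullet> (e - b)) / ((e - b) \<bullet> (e - b))) = 1" using nz by (metis divide_self times_divide_eq_right
      nonzero_mult_div_cancel_left numeral_neq_zero times_divide_eq_right)
    show ?thesis unfolding swap_refl_def h by simp
  qed (simp add: swap_refl_def)
  show "swap_refl e b b = e"
  proof (cases "e = b")
    case False
    then have nz: "(e - b) \<bullet> (e - b) \<noteq> 0" by simp
    have "2 * (b \<bullet> (e - b)) = - ((e - b) \<bullet> (e - b))"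
      using assms by (simp add: inner_diff_left inner_diff_right inner_commute)
    then have h: "2 * ((b \<bullet> (e - b)) / ((e - b) \<bullet> (e - b))) = -1" using nz
      by (metis divide_minus_left divide_self times_divide_eq_right)
    show ?thesis unfolding swap_refl_def h by simp
  qed (simp add: swap_refl_def)
qed

lemma dist_swap_refl: "dist (swap_refl e b x) (swap_refl e b y) = dist x y"
proof -
  have "swap_refl e b x - swap_refl e b y = swap_refl e b (x - y)"
    using linear_diff[OF linear_swap_refl] by metis
  then show ?thesis
    by (simp add: dist_norm norm_eq_sqrt_inner inner_swap_refl)
qed

lemma swap_refl_involution: "swap_refl e b (swap_refl e b x) = x"
proof (cases "e = b")
  case False
  then have nz: "(e - b) \<bullet> (e - b) \<noteq> 0" by simp
  have "swap_refl e b x \<bullet> (e - b) = - (x \<bullet> (e - b))"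
    using nz unfolding swap_refl_def[of e b x] by (simp add: inner_diff_left[of x])
  then show ?thesis unfolding swap_refl_def[of e b "swap_refl e b x"] by (simp add: swap_refl_def)
qed (simp add: swap_refl_def)

lemma hausdorff_premeasure_finite_cover:
  assumes "finite I" "\<delta> \<ge> 0" "A \<subseteq> (\<Union>i\<in>I. U i)"
    "\<And>i. i \<in> I \<Longrightarrow> bounded (U i)" "\<And>i. i \<in> I \<Longrightarrow> diameter (U i) \<le> \<delta>"
  shows "hausdorff_premeasure m \<delta> A \<le> (\<Sum>i\<in>I. hausdorff_weight m (U i))"
proof -
  obtain h where h: "bij_betw h {0..<card I} I"
    using ex_bij_betw_nat_finite[OF assms(1)] by auto
  let ?V = "\<lambda>k. if k < card I then U (h k) else {}"
  have hI: "k < card I \<Longrightarrow> h k \<in> I" for k using h by (auto simp: bij_betw_def)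
  have "hausdorff_premeasure m \<delta> A \<le> (\<Sum>k. hausdorff_weight m (?V k))"
  proof (rule hausdorff_premeasure_le)
    show "A \<subseteq> (\<Union>k. ?V k)"
    proof
      fix x assume "x \<in> A"
      then obtain i where i: "i \<in> I" "x \<in> U i" using assms by auto
      then obtain k where "k < card I" "i = h k" using h unfolding bij_betw_def by (metis atLeastLessThan_iff imageE)
      with i show "x \<in> (\<Union>k. ?V k)" by auto
    qed
  qed (use hI assms in auto)
  also have "\<dots> = (\<Sum>k\<in>{0..<card I}. hausdorff_weight m (?V k))"
    by (rule suminf_finite) (auto simp: hausdorff_weight_def)
  also have "\<dots> = (\<Sum>k\<in>{0..<card I}. hausdorff_weight m (U (h k)))"
    by (rule sum.cong) auto
  also have "\<dots> = (\<Sum>i\<in>I. hausdorff_weight m (U i))"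
    by (rule sum.reindex_bij_betw[OF h])
  finally show ?thesis .
qed

lemma diameter_le_coords:
  fixes A :: "'a::euclidean_space set" and s :: real
  assumes "s \<ge> 0" "\<And>x y b. x \<in> A \<Longrightarrow> y \<in> A \<Longrightarrow> b \<in> Basis \<Longrightarrow> \<bar>(x - y) \<bullet> b\<bar> \<le> s"
  shows "diameter A \<le> DIM('a) * s" "bounded A"
proof -
  have *: "norm (x - y) \<le> DIM('a) * s" if "x \<in> A" "y \<in> A" for x y
  proof -
    have "norm (x - y) \<le> (\<Sum>b\<in>Basis. \<bar>(x - y) \<bullet> b\<bar>)" by (rule norm_le_l1)
    also have "\<dots> \<le> (\<Sum>b\<in>(Basis::'a set). (s::real))" by (intro sum_mono assms(2) that)
    finally show ?thesis by simp
  qed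
  show "diameter A \<le> DIM('a) * s" by (rule diameter_le) (use assms(1) * in auto)
  show "bounded A" unfolding bounded_two_points using * by (auto simp: dist_norm)
qed

text \<open>The flat cube around the ball is divided into N^(n-1) boxes of side 2r/N. Even with the
  crude diameter bound n*s the total weight is a constant that does not depend on N, and finiteness
  is all that is wanted.\<close>

lemma harea_perp_basis_bounded:
  fixes b :: "'a::euclidean_space"
  assumes b: "b \<in> Basis" and r: "r > 0"
  shows "harea (perp b \<inter> cball 0 r) < top"
proof -
  define n where "n = DIM('a)"
  define C where "C = unit_ball_vol (real (n-1)) * (n * r) ^ (n-1)"
  have pre: "hausdorff_premeasure (n-1) \<delta> (perp b \<inter> cball 0 r) \<le> ennreal C" if \<delta>: "\<delta> > 0" for \<delta>
  proof -
    obtain N :: nat where N: "N > 0" "2 * r * n / N \<le> \<delta>"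
    proof -
      obtain N :: nat where N: "2 * r * n / \<delta> < N" using reals_Archimedean2 by blast
      moreover have "2 * r * n / \<delta> \<ge> 0" using r \<delta> by simp
      ultimately have "N > 0" using not_gr_zero by fastforce
      with N \<delta> show ?thesis by (intro that[of N]) (auto simp: field_simps)
    qed
    define s where "s = 2 * r / N"
    have s: "s > 0" using r N by (simp add: s_def)
    define I where "I = (Basis - {b}) \<rightarrow>\<^sub>E {..<N}"
    define U where "U f = {x. x \<bullet> b = 0 \<and> (\<forall>j\<in>Basis-{b}. - r + s * real (f j) \<le> x \<bullet> j \<and> x \<bullet> j \<le> - r + s * (real (f j) + 1))}"
      for f :: "'a \<Rightarrow> nat"
    have coords: "\<bar>(x - y) \<bullet> j\<bar> \<le> s" if "x \<in> U f" "y \<in> U f" "j \<in> Basis" for x y j f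
    proof (cases "j = b")
      case False
      have "- r + s * real (f j) \<le> x \<bullet> j" "x \<bullet> j \<le> - r + s * (real (f j) + 1)"
        "- r + s * real (f j) \<le> y \<bullet> j" "y \<bullet> j \<le> - r + s * (real (f j) + 1)" using that False by (auto simp: U_def)
      then show ?thesis by (simp add: algebra_simps abs_le_iff)
    qed (use that s in \<open>auto simp: U_def inner_diff_left\<close>)
    have dU: "diameter (U f) \<le> n * s" and bU: "bounded (U f)" for f
      using diameter_le_coords[of s "U f"] coords s unfolding n_def by auto
    have "hausdorff_premeasure (n-1) \<delta> (perp b \<inter> cball 0 r) \<le> (\<Sum>f\<in>I. hausdorff_weight (n-1) (U f))"
    proof (rule hausdorff_premeasure_finite_cover)
      show "finite I" unfolding I_def by (intro finite_PiE) auto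
      show "perp b \<inter> cball 0 r \<subseteq> (\<Union>f\<in>I. U f)"
      proof
        fix x assume x: "x \<in> perp b \<inter> cball 0 r"
        \<comment> \<open>The cap \<open>N - 1\<close> puts a coordinate equal to \<open>r\<close>,
          whose quotient is exactly \<open>N\<close>, into the last box.\<close>
        define f where "f = restrict (\<lambda>j. min (N-1) (nat \<lfloor>(x \<bullet> j + r) / s\<rfloor>)) (Basis - {b})"
        have "f \<in> I" using N by (auto simp: f_def I_def)
        moreover have "x \<in> U f"
          unfolding U_def mem_Collect_eq
        proof (intro conjI ballI)
          show "x \<bullet> b = 0" using x by (auto simp: perp_def)
          fix j assume j: "j \<in> Basis - {b}"
          have xj: "\<bar>x \<bullet> j\<bar> \<le> r" using x Basis_le_norm[of j x] j by auto
          define q where "q = (x \<bullet> j + r) / s"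
          have "0 \<le> q" using xj s by (auto simp: q_def intro!: divide_nonneg_pos)
          moreover have "q \<le> N"
          proof -
            have "q \<le> 2 * r / s" unfolding q_def using xj s by (intro divide_right_mono) auto
            also have "\<dots> = N" using N r by (simp add: s_def)
            finally show ?thesis .
          qed
          ultimately have q: "0 \<le> q" "q \<le> N" by auto
          have fj: "f j = min (N-1) (nat \<lfloor>q\<rfloor>)" using j by (simp add: f_def q_def)
          have "real (f j) \<le> q" unfolding fj using q by (simp add: min_def, linarith)
          moreover have "q \<le> real (f j) + 1" unfolding fj using q N by (cases "N - 1 \<le> nat \<lfloor>q\<rfloor>") (simp_all add: min_def of_nat_diff, linarith?)
          ultimately have "s * real (f j) \<le> s * q" "s * q \<le> s * (real (f j) + 1)" using s by simp_all
          moreover have "s * q = x \<bullet> j + r" using s by (simp add: q_def)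
          ultimately show "- r + s * real (f j) \<le> x \<bullet> j" "x \<bullet> j \<le> - r + s * (real (f j) + 1)" by linarith+
        qed
        ultimately show "x \<in> (\<Union>f\<in>I. U f)" by auto
      qed
      show "diameter (U f) \<le> \<delta>" for f
        using dU[of f] N(2) by (simp add: s_def mult.commute)
    qed (use \<delta> bU in auto)
    also have "\<dots> \<le> (\<Sum>f\<in>I. ennreal (unit_ball_vol (real (n-1)) * (n * s / 2) ^ (n-1)))"
      by (intro sum_mono) (auto simp: hausdorff_weight_def diameter_ge_0[OF bU]
          intro!: ennreal_leI mult_left_mono power_mono divide_right_mono dU)
    also have "\<dots> = ennreal (card I * (unit_ball_vol (real (n-1)) * (n * s / 2) ^ (n-1)))"
      using s by (simp add: ennreal_mult' ennreal_of_nat_eq_real_of_nat)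
    also have "card I = N ^ (n-1)"
      using b by (simp add: I_def card_PiE n_def)
    also have "real (N ^ (n-1)) * (unit_ball_vol (real (n-1)) * (n * s / 2) ^ (n-1)) = C"
      using N by (simp add: C_def s_def power_mult_distrib power_divide)
    finally show ?thesis .
  qed
  have "harea (perp b \<inter> cball 0 r) \<le> ennreal C"
    unfolding harea_def hausdorff_measure_def n_def[symmetric] by (rule SUP_least) (use pre in auto)
  then show ?thesis using ennreal_less_top le_less_trans by blast
qed

lemma harea_perp_bounded:
  fixes e :: "'a::euclidean_space"
  assumes e: "norm e = 1"
  shows "harea (perp e \<inter> cball 0 r) < top"
proof -
  obtain b :: 'a where b: "b \<in> Basis" using nonempty_Basis by blast
  have eb: "e \<bullet> e = b \<bullet> b" using b e by (simp add: dot_square_norm)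
  let ?T = "swap_refl e b"
  \<comment> \<open>\<open>max r 1\<close> keeps the radius positive, as the basis case demands,
    while \<open>r\<close> is arbitrary here.\<close>
  have "perp e \<inter> cball 0 r \<subseteq> ?T ` (perp b \<inter> cball 0 (max r 1))"
  proof
    fix x assume x: "x \<in> perp e \<inter> cball 0 r"
    have "?T x \<bullet> b = x \<bullet> e" using inner_swap_refl[of e b x e] swap_refl_swap[OF eb] by simp
    moreover have "norm (?T x) = norm x" by (simp add: norm_eq_sqrt_inner inner_swap_refl)
    ultimately show "x \<in> ?T ` (perp b \<inter> cball 0 (max r 1))"
      using x by (intro image_eqI[of _ _ "?T x"]) (auto simp: perp_def swap_refl_involution)
  qed
  then have "harea (perp e \<inter> cball 0 r) \<le> harea (perp b \<inter> cball 0 (max r 1))"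
    by (rule order_trans[OF harea_mono]) (simp add: harea_isometry dist_swap_refl)
  also have "\<dots> < top" using b by (rule harea_perp_basis_bounded) auto
  finally show ?thesis .
qed

section \<open>Lebesgue measure disintegrated along parallel lines\<close>

definition hperp :: "'a::euclidean_space \<Rightarrow> 'a measure" where
  "hperp e = density area (indicator (perp e))"

lemma space_hperp [simp]: "space (hperp e) = UNIV"
  and sets_hperp [measurable_cong, simp]: "sets (hperp e) = sets borel"
  by (simp_all add: hperp_def)

lemma emeasure_hperp: "B \<in> sets borel \<Longrightarrow> emeasure (hperp e) B = harea (B \<inter> perp e)"
  unfolding hperp_def
  by (subst emeasure_density)
    (auto simp: emeasure_area[symmetric] indicator_inter_arith[symmetric] mult.commute Int_commute
      simp flip: emeasure_area)

lemma sigma_finite_hperp: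
  assumes "norm e = 1"
  shows "sigma_finite_measure (hperp e)"
proof
  show "\<exists>A. countable A \<and> A \<subseteq> sets (hperp e) \<and> \<Union>A = space (hperp e) \<and> (\<forall>a\<in>A. emeasure (hperp e) a \<noteq> \<infinity>)"
  proof (intro exI conjI ballI)
    show "\<Union>(range (\<lambda>k::nat. cball (0::'a) (real k))) = space (hperp e)"
      using real_arch_simple[where 'a=real] by auto
    fix a assume "a \<in> range (\<lambda>k::nat. cball (0::'a) (real k))"
    then show "emeasure (hperp e) a \<noteq> \<infinity>"
      using harea_perp_bounded[OF assms] by (auto simp: emeasure_hperp Int_commute top.not_eq_extremum)
  qed auto
qed

lemma distr_hperp_plus:
  assumes "v \<in> perp e"
  shows "distr (hperp e) borel ((+) v) = hperp e"
proof (rule measure_eqI)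
  fix B assume "B \<in> sets (distr (hperp e) borel ((+) v))"
  then have B[measurable]: "B \<in> sets borel" by simp
  have "emeasure (distr (hperp e) borel ((+) v)) B = harea (((+) v) -` B \<inter> perp e)"
    using measurable_sets_borel[of "(+) v" borel B] by (simp add: emeasure_distr emeasure_hperp)
  also have "\<dots> = harea (((+) v) ` (((+) v) -` B \<inter> perp e))"
    by (rule harea_isometry[symmetric]) simp
  also have "((+) v) ` (((+) v) -` B \<inter> perp e) = B \<inter> perp e"
  proof (intro equalityI subsetI)
    fix x assume "x \<in> B \<inter> perp e"
    then show "x \<in> ((+) v) ` (((+) v) -` B \<inter> perp e)"
      using assms by (intro image_eqI[of _ _ "x - v"]) (auto simp: perp_def inner_diff_left)
  qed (use assms in \<open>auto simp: perp_def inner_add_left\<close>)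
  finally show "emeasure (distr (hperp e) borel ((+) v)) B = emeasure (hperp e) B"
    by (simp add: emeasure_hperp)
qed simp

text \<open>Hyperplane area times length, carried to the space by following lines in direction
  \<open>e\<close>. Its translation invariance makes it a multiple of Lebesgue measure, and this is
  the source of the slicing formula.\<close>

definition line_meas :: "'a::euclidean_space \<Rightarrow> 'a measure" where
  "line_meas e = distr (hperp e \<Otimes>\<^sub>M (lborel :: real measure)) borel (\<lambda>(y, t). y + t *\<^sub>R e)"

lemma sets_line_meas [measurable_cong, simp]: "sets (line_meas e) = sets borel"
  by (simp add: line_meas_def)

lemma nn_integral_line_meas:
  assumes e: "norm e = 1" and [measurable]: "g \<in> borel_measurable borel"
  shows "(\<integral>\<^sup>+x. g x \<partial>line_meas e) = (\<integral>\<^sup>+y. \<integral>\<^sup>+t. g (y + t *\<^sub>R e) \<partial>lborel \<partial>hperp e)"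
proof -
  interpret sigma_finite_measure "hperp e" using e by (rule sigma_finite_hperp)
  interpret pair_sigma_finite "hperp e" "lborel :: real measure" ..
  show ?thesis
    unfolding line_meas_def
    by (subst nn_integral_distr)
      (auto simp: lborel.nn_integral_fst[symmetric] split_beta intro!: nn_integral_cong)
qed

lemma emeasure_line_meas:
  assumes e: "norm e = 1" and [measurable]: "B \<in> sets borel"
  shows "emeasure (line_meas e) B = (\<integral>\<^sup>+y. \<integral>\<^sup>+t. indicator B (y + t *\<^sub>R e) \<partial>lborel \<partial>hperp e)"
proof -
  have "emeasure (line_meas e) B = (\<integral>\<^sup>+x. indicator B x \<partial>line_meas e)" by simp
  also have "\<dots> = (\<integral>\<^sup>+y. \<integral>\<^sup>+t. indicator B (y + t *\<^sub>R e) \<partial>lborel \<partial>hperp e)"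
    by (rule nn_integral_line_meas[OF e]) simp
  finally show ?thesis .
qed

text \<open>The translation vector is split into a part in \<open>perp e\<close> and a multiple of
  \<open>e\<close>; the two factors of the product absorb one part each.\<close>

lemma distr_line_meas_plus:
  assumes e: "norm e = 1"
  shows "distr (line_meas e) borel ((+) v) = line_meas e"
proof (rule measure_eqI)
  fix B assume "B \<in> sets (distr (line_meas e) borel ((+) v))"
  then have B[measurable]: "B \<in> sets borel" by simp
  interpret sigma_finite_measure "hperp e" using e by (rule sigma_finite_hperp)
  interpret pair_sigma_finite "hperp e" "lborel :: real measure" ..
  have ee: "e \<bullet> e = 1" using e by (simp add: dot_square_norm)
  define s where "s = v \<bullet> e"
  define w where "w = v - s *\<^sub>R e"
  have w: "w \<in> perp e" by (simp add: w_def s_def perp_def inner_diff_left ee)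
  have "emeasure (distr (line_meas e) borel ((+) v)) B = (\<integral>\<^sup>+x. indicator B (v + x) \<partial>line_meas e)"
    by (subst nn_integral_indicator[symmetric], simp, subst nn_integral_distr) auto
  also have "\<dots> = (\<integral>\<^sup>+y. \<integral>\<^sup>+t. indicator B (v + (y + t *\<^sub>R e)) \<partial>lborel \<partial>hperp e)"
    by (rule nn_integral_line_meas[OF e]) simp
  also have "\<dots> = (\<integral>\<^sup>+y. \<integral>\<^sup>+t. indicator B ((w + y) + (s + t) *\<^sub>R e) \<partial>lborel \<partial>hperp e)"
    by (simp add: w_def algebra_simps)
  also have "\<dots> = (\<integral>\<^sup>+y. \<integral>\<^sup>+t. indicator B ((w + y) + t *\<^sub>R e) \<partial>lborel \<partial>hperp e)"
  proof (rule nn_integral_cong)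
    fix y :: 'a
    have "(\<integral>\<^sup>+t. indicator B ((w + y) + t *\<^sub>R e) \<partial>lborel)
        = (\<integral>\<^sup>+t. indicator B ((w + y) + t *\<^sub>R e) \<partial>distr lborel borel ((+) s))"
      by (simp add: lborel_distr_plus)
    also have "\<dots> = (\<integral>\<^sup>+t. indicator B ((w + y) + (s + t) *\<^sub>R e) \<partial>lborel)"
      by (subst nn_integral_distr) auto
    finally show "(\<integral>\<^sup>+t. indicator B ((w + y) + (s + t) *\<^sub>R e) \<partial>lborel) =
      (\<integral>\<^sup>+t. indicator B ((w + y) + t *\<^sub>R e) \<partial>lborel)" by simp
  qed
  also have "\<dots> = (\<integral>\<^sup>+y. \<integral>\<^sup>+t. indicator B (y + t *\<^sub>R e) \<partial>lborel \<partial>distr (hperp e) borel ((+) w))"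
    by (subst nn_integral_distr) auto
  also have "\<dots> = emeasure (line_meas e) B"
    by (simp add: distr_hperp_plus[OF w] emeasure_line_meas[OF e])
  finally show "emeasure (distr (line_meas e) borel ((+) v)) B = emeasure (line_meas e) B" .
qed simp

text \<open>By Pythagoras the ball lies in the cylinder of points \<open>y + t *\<^sub>R e\<close>
  with \<open>norm y \<le> r\<close> and \<bar>t\<bar> \<le> r, whose measure is a finite
  product.\<close>

lemma line_meas_cball_finite:
  assumes e: "norm e = 1"
  shows "emeasure (line_meas e) (cball 0 r) < top"
proof -
  interpret sigma_finite_measure "hperp e" using e by (rule sigma_finite_hperp)
  interpret pair_sigma_finite "hperp e" "lborel :: real measure" ..
  have ee: "e \<bullet> e = 1" using e by (simp add: dot_square_norm)
  have [measurable]: "cball (0::'a) r \<in> sets borel" by (simp add: borel_closed)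
  have "emeasure (line_meas e) (cball 0 r) = (\<integral>\<^sup>+y. \<integral>\<^sup>+t. indicator (cball 0 r) (y + t *\<^sub>R e) \<partial>lborel \<partial>hperp e)"
    by (rule emeasure_line_meas[OF e]) simp
  also have "\<dots> \<le> (\<integral>\<^sup>+y. \<integral>\<^sup>+t. indicator (cball 0 r) y * indicator {-r..r} t \<partial>lborel \<partial>hperp e)"
  proof (rule nn_integral_mono_AE)
    have "AE y in hperp e. y \<in> perp e"
      unfolding hperp_def by (subst AE_density) (auto simp: indicator_def)
    then show "AE y in hperp e. (\<integral>\<^sup>+t. indicator (cball 0 r) (y + t *\<^sub>R e) \<partial>lborel)
        \<le> (\<integral>\<^sup>+t. indicator (cball 0 r) y * indicator {-r..r} t \<partial>lborel)"
    proof eventually_elim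
      case (elim y)
      show ?case
      proof (rule nn_integral_mono)
        fix t :: real
        have sq: "(norm (y + t *\<^sub>R e))\<^sup>2 = (norm y)\<^sup>2 + t\<^sup>2"
          using elim by (simp only: power2_norm_eq_inner perp_def inner_add_left inner_add_right mem_Collect_eq)
            (simp add: inner_commute ee power2_eq_square)
        have "norm y \<le> norm (y + t *\<^sub>R e)" by (rule power2_le_imp_le) (auto simp: sq)
        moreover have "\<bar>t\<bar> \<le> norm (y + t *\<^sub>R e)" by (rule power2_le_imp_le) (auto simp: sq)
        ultimately show "indicator (cball 0 r) (y + t *\<^sub>R e) \<le> (indicator (cball 0 r) y * indicator {-r..r} t :: ennreal)"
          by (auto simp: indicator_def)
      qed
    qed
  qed
  also have "\<dots> = emeasure (hperp e) (cball 0 r) * emeasure lborel {-r..r}"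
    by (simp add: nn_integral_cmult, subst nn_integral_multc) auto
  also have "\<dots> < top"
    using harea_perp_bounded[OF e, of r] emeasure_lborel_cbox_finite[of "-r" r]
    by (auto simp: emeasure_hperp Int_commute ennreal_mult_less_top)
  finally show ?thesis .
qed

text \<open>The reflection exchanging \<open>e\<close> and \<open>b\<close> preserves the ball and
  carries one hyperplane measure to the other. Hence the constant of proportionality is common to
  all directions, on which the linearity of the flux density in the direction rests.\<close>

lemma line_meas_cball_eq:
  fixes e b :: "'a::euclidean_space"
  assumes e: "norm e = 1" and b: "norm b = 1"
  shows "emeasure (line_meas e) (cball 0 r) = emeasure (line_meas b) (cball 0 r)"
proof -
  have eb: "e \<bullet> e = b \<bullet> b" using b e by (simp add: dot_square_norm)
  let ?T = "swap_refl e b"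
  have [measurable]: "?T \<in> borel_measurable borel"
    by (intro borel_measurable_continuous_onI linear_continuous_on) (simp add: linear_conv_bounded_linear[symmetric] linear_swap_refl)
  interpret b: sigma_finite_measure "hperp b" using b by (rule sigma_finite_hperp)
  have nT: "norm (?T x) = norm x" for x by (simp add: norm_eq_sqrt_inner inner_swap_refl)
  have T: "hperp e = distr (hperp b) borel ?T"
  proof (rule measure_eqI)
    fix B assume "B \<in> sets (hperp e)"
    then have B[measurable]: "B \<in> sets borel" by simp
    have "emeasure (distr (hperp b) borel ?T) B = harea (?T -` B \<inter> perp b)"
      using measurable_sets_borel[of ?T borel B] by (simp add: emeasure_distr emeasure_hperp)
    also have "\<dots> = harea (?T ` (?T -` B \<inter> perp b))"
      by (rule harea_isometry[symmetric]) (rule dist_swap_refl)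
    also have "?T ` (?T -` B \<inter> perp b) = B \<inter> perp e"
    proof -
      have Te: "?T x \<bullet> e = x \<bullet> b" "?T x \<bullet> b = x \<bullet> e" for x
        using inner_swap_refl[of e b x b] inner_swap_refl[of e b x e] swap_refl_swap[OF eb] by simp_all
      show ?thesis
      proof (intro equalityI subsetI)
        fix x assume "x \<in> B \<inter> perp e"
        then show "x \<in> ?T ` (?T -` B \<inter> perp b)"
          by (intro image_eqI[of _ _ "?T x"]) (simp_all add: perp_def swap_refl_involution Te)
      qed (auto simp: perp_def Te)
    qed
    finally show "emeasure (hperp e) B = emeasure (distr (hperp b) borel ?T) B"
      by (simp add: emeasure_hperp)
  qed simp
  have C[measurable]: "cball (0::'a) r \<in> sets borel" by (simp add: borel_closed)
  have "emeasure (line_meas e) (cball 0 r) = (\<integral>\<^sup>+y. \<integral>\<^sup>+t. indicator (cball 0 r) (y + t *\<^sub>R e) \<partial>lborel \<partial>hperp e)"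
    by (rule emeasure_line_meas[OF e C])
  also have "\<dots> = (\<integral>\<^sup>+y. \<integral>\<^sup>+t. indicator (cball 0 r) (?T y + t *\<^sub>R e) \<partial>lborel \<partial>hperp b)"
    unfolding T by (subst nn_integral_distr) auto
  also have "\<dots> = (\<integral>\<^sup>+y. \<integral>\<^sup>+t. indicator (cball 0 r) (y + t *\<^sub>R b) \<partial>lborel \<partial>hperp b)"
  proof -
    have "?T y + t *\<^sub>R e = ?T (y + t *\<^sub>R b)" for y t
      by (simp add: linear_add[OF linear_swap_refl] linear_scale[OF linear_swap_refl] swap_refl_swap[OF eb])
    then show ?thesis by (simp add: indicator_def nT)
  qed
  also have "\<dots> = emeasure (line_meas b) (cball 0 r)"
    by (rule emeasure_line_meas[OF b C, symmetric])
  finally show ?thesis .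
qed

text \<open>Possibly zero: the proof never needs that Hausdorff and Lebesgue measure
  agree on hyperplanes.\<close>

definition area_const :: "'a::euclidean_space itself \<Rightarrow> real" where
  "area_const _ = enn2real (emeasure (line_meas (SOME b :: 'a. b \<in> Basis)) (cball 0 1)) / measure lborel (cball (0::'a) 1)"

lemma area_const_nonneg: "area_const TYPE('a::euclidean_space) \<ge> 0"
  by (simp add: area_const_def)

text \<open>Uniqueness of invariant measures compared on the unit ball, whose volume is positive and
  finite and can be cancelled.\<close>

lemma line_meas_eq:
  fixes e :: "'a::euclidean_space"
  assumes e: "norm e = 1"
  shows "line_meas e = density lborel (\<lambda>_. ennreal (area_const TYPE('a)))"
proof (rule measure_eqI)
  fix B assume "B \<in> sets (line_meas e)"
  then have B[measurable]: "B \<in> sets borel" by simp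
  let ?b = "SOME b :: 'a. b \<in> Basis" and ?U = "cball (0::'a) 1"
  have b: "norm ?b = 1" using SOME_Basis by simp
  have sf: "sigma_finite_measure (line_meas e)"
  proof
    show "\<exists>A. countable A \<and> A \<subseteq> sets (line_meas e) \<and> \<Union>A = space (line_meas e) \<and> (\<forall>a\<in>A. emeasure (line_meas e) a \<noteq> \<infinity>)"
    proof (intro exI conjI ballI)
      show "\<Union>(range (\<lambda>k::nat. cball (0::'a) (real k))) = space (line_meas e)"
        using real_arch_simple[where 'a=real] by (auto simp: line_meas_def)
      fix a assume "a \<in> range (\<lambda>k::nat. cball (0::'a) (real k))"
      then show "emeasure (line_meas e) a \<noteq> \<infinity>"
        using line_meas_cball_finite[OF e] by (auto simp: top.not_eq_extremum)
    qed auto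
  qed
  have L: "emeasure lborel ?U = ennreal (measure lborel ?U)" "measure lborel ?U > 0"
  proof -
    have "emeasure lborel ?U < top" using emeasure_lborel_cball_finite[of 0 1] by simp
    then show "emeasure lborel ?U = ennreal (measure lborel ?U)"
      by (simp add: emeasure_eq_ennreal_measure)
    show "measure lborel ?U > 0" using content_cball_pos[of 1 "0::'a"] by simp
  qed
  have "emeasure (line_meas e) B * emeasure lborel ?U = emeasure (line_meas e) ?U * emeasure lborel B"
    using emeasure_translation_invariant[OF _ sf distr_line_meas_plus[OF e] B, of ?U] by simp
  also have "emeasure (line_meas e) ?U = emeasure (line_meas ?b) ?U"
    by (rule line_meas_cball_eq[OF e b])
  also have "\<dots> = ennreal (area_const TYPE('a)) * emeasure lborel ?U"
  proof -
    have "emeasure (line_meas ?b) ?U = ennreal (enn2real (emeasure (line_meas ?b) ?U))"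
      using line_meas_cball_finite[OF b, of 1] by (simp add: ennreal_enn2real)
    also have "\<dots> = ennreal (area_const TYPE('a) * measure lborel ?U)"
      unfolding area_const_def using L by simp
    finally show ?thesis using L by (simp add: ennreal_mult area_const_nonneg)
  qed
  finally have "emeasure (line_meas e) B * ennreal (measure lborel ?U)
      = (ennreal (area_const TYPE('a)) * emeasure lborel B) * ennreal (measure lborel ?U)"
    using L by (simp add: ac_simps)
  then have "emeasure (line_meas e) B = ennreal (area_const TYPE('a)) * emeasure lborel B"
    using L(2) by (simp add: mult.commute[of _ "ennreal (measure lborel _)"] ennreal_mult_cancel_left)
  also have "\<dots> = emeasure (density lborel (\<lambda>_. ennreal (area_const TYPE('a)))) B"
    by (simp add: emeasure_density nn_integral_cmult)
  finally show "emeasure (line_meas e) B = emeasure (density lborel (\<lambda>_. ennreal (area_const TYPE('a)))) B" .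
qed simp

lemma integral_slices:
  fixes e :: "'a::euclidean_space" and g :: "'a \<Rightarrow> real"
  assumes e: "norm e = 1" and g: "integrable lborel g"
  shows "area_const TYPE('a) * (\<integral>x. g x \<partial>lborel) = (\<integral>y. \<integral>t. g (y + t *\<^sub>R e) \<partial>lborel \<partial>hperp e)"
proof -
  interpret sigma_finite_measure "hperp e" using e by (rule sigma_finite_hperp)
  interpret pair_sigma_finite "hperp e" "lborel :: real measure" ..
  have [measurable]: "g \<in> borel_measurable borel" using borel_measurable_integrable[OF g] by simp
  have "integrable (line_meas e) g"
    unfolding line_meas_eq[OF e] using area_const_nonneg[where 'a='a] g
    by (subst integrable_density) auto
  then have int: "integrable (hperp e \<Otimes>\<^sub>M (lborel :: real measure)) (\<lambda>(y, t). g (y + t *\<^sub>R e))"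
    unfolding line_meas_def by (subst (asm) integrable_distr_eq) (auto simp: split_beta')
  have "area_const TYPE('a) * (\<integral>x. g x \<partial>lborel) = (\<integral>x. g x \<partial>line_meas e)"
    unfolding line_meas_eq[OF e] using area_const_nonneg[where 'a='a]
    by (subst integral_density) auto
  also have "\<dots> = (\<integral>z. (\<lambda>(y, t). g (y + t *\<^sub>R e)) z \<partial>(hperp e \<Otimes>\<^sub>M (lborel :: real measure)))"
    unfolding line_meas_def by (subst integral_distr) (auto simp: split_beta')
  also have "\<dots> = (\<integral>y. \<integral>t. g (y + t *\<^sub>R e) \<partial>lborel \<partial>hperp e)"
    using integral_fst'[OF int] by simp
  finally show ?thesis .
qed


section \<open>Slicing by lines\<close>

lemma emeasure_count_space_image_le:
  "emeasure (count_space UNIV) (f ` T) \<le> emeasure (count_space UNIV) T"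
  by (cases "finite T") (auto simp: card_image_le)

lemma eventually_floor_dyadic_neq:
  fixes s t :: real
  assumes "s \<noteq> t"
  shows "\<forall>\<^sub>F k in sequentially. \<lfloor>2^k * s\<rfloor> \<noteq> \<lfloor>2^k * t\<rfloor>"
proof -
  obtain n where n: "1 / \<bar>s - t\<bar> < 2 ^ n"
    using real_arch_pow[of 2 "1 / \<bar>s - t\<bar>"] by auto
  have "\<lfloor>2^k * s\<rfloor> \<noteq> \<lfloor>2^k * t\<rfloor>" if "k \<ge> n" for k
  proof
    assume *: "\<lfloor>2^k * s\<rfloor> = \<lfloor>2^k * t\<rfloor>"
    have "1 / \<bar>s - t\<bar> < 2 ^ k" using n that by (meson less_le_trans one_le_numeral power_increasing)
    then have "1 < 2 ^ k * \<bar>s - t\<bar>" using assms by (simp add: field_simps)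
    also have "\<dots> = \<bar>2^k * s - 2^k * t\<bar>" by (simp add: abs_mult flip: right_diff_distrib)
    finally show False using * by linarith
  qed
  then show ?thesis by (auto simp: eventually_sequentially)
qed

lemma finite_inj_on_floor_dyadic:
  fixes F :: "real set"
  assumes "finite F"
  shows "\<exists>k. inj_on (\<lambda>t. \<lfloor>2^k * t\<rfloor>) F"
proof -
  have "\<forall>\<^sub>F k in sequentially. \<forall>p\<in>F\<times>F. fst p \<noteq> snd p \<longrightarrow> \<lfloor>2^k * fst p\<rfloor> \<noteq> \<lfloor>2^k * snd p\<rfloor>"
    using assms eventually_floor_dyadic_neq by (intro eventually_ball_finite) auto
  then obtain k where "\<forall>p\<in>F\<times>F. fst p \<noteq> snd p \<longrightarrow> \<lfloor>2^k * fst p\<rfloor> \<noteq> \<lfloor>2^k * snd p\<rfloor>"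
    using eventually_happens'[OF sequentially_bot] by blast
  then show ?thesis by (intro exI[of _ k]) (auto simp: inj_on_def)
qed

text \<open>A fine enough dyadic grid separates the points of any given finite subset, so the number
  of occupied intervals reaches the cardinality in the limit; for infinite \<open>T\<close> it
  passes every integer.\<close>

lemma emeasure_count_space_dyadic:
  fixes T :: "real set"
  shows "emeasure (count_space UNIV) T = (SUP k. emeasure (count_space UNIV) ((\<lambda>t. \<lfloor>2^k * t\<rfloor>) ` T))"
proof (rule antisym)
  let ?s = "\<lambda>k. emeasure (count_space UNIV) ((\<lambda>t. \<lfloor>2^k * t\<rfloor>) ` T)"
  have fin: "of_nat (card F) \<le> (SUP k. ?s k)" if F: "finite F" "F \<subseteq> T" for F
  proof -
    obtain k where k: "inj_on (\<lambda>t. \<lfloor>2^k * t\<rfloor>) F" using finite_inj_on_floor_dyadic[OF F(1)] by auto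
    have "of_nat (card F) = emeasure (count_space UNIV) ((\<lambda>t. \<lfloor>2^k * t\<rfloor>) ` F)"
      using F by (simp add: card_image[OF k])
    also have "\<dots> \<le> ?s k" by (rule emeasure_mono) (use F in auto)
    also have "\<dots> \<le> (SUP k. ?s k)" by (rule SUP_upper) auto
    finally show ?thesis .
  qed
  show "emeasure (count_space UNIV) T \<le> (SUP k. ?s k)"
  proof (cases "finite T")
    case False
    have "of_nat n \<le> (SUP k. ?s k)" for n
      using infinite_arbitrarily_large[OF False, of n] fin by auto
    then have "(SUP k. ?s k) = top" by (metis ennreal_Ex_less_of_nat leD top.not_eq_extremum)
    then show ?thesis by (simp only: top_greatest)
  qed (use fin[of T] in simp)
next
  show "(SUP k. emeasure (count_space UNIV) ((\<lambda>t. \<lfloor>2^k * t\<rfloor>) ` T)) \<le> emeasure (count_space UNIV) T"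
    by (intro SUP_least emeasure_count_space_image_le)
qed

lemma incseq_count_dyadic:
  fixes T :: "real set"
  shows "incseq (\<lambda>k. emeasure (count_space UNIV) ((\<lambda>t. \<lfloor>2^k * t\<rfloor>) ` T))"
proof (rule incseq_SucI)
  fix k
  have "\<lfloor>2^k * t\<rfloor> = \<lfloor>2^Suc k * t\<rfloor> div 2" for t :: real
    using floor_divide_real_eq_div[of 2 "2^Suc k * t"] by simp
  then have "(\<lambda>t. \<lfloor>2^k * t\<rfloor>) ` T = (\<lambda>j. j div 2) ` (\<lambda>t. \<lfloor>2^Suc k * t\<rfloor>) ` T"
    by (simp only: image_image)
  then show "emeasure (count_space UNIV) ((\<lambda>t. \<lfloor>2^k * t\<rfloor>) ` T)
      \<le> emeasure (count_space UNIV) ((\<lambda>t. \<lfloor>2^Suc k * t\<rfloor>) ` T)"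
    by (metis emeasure_count_space_image_le)
qed

text \<open>As a series of indicators the count inherits measurability from its terms and can be
  integrated term by term.\<close>

lemma emeasure_count_space_int_suminf:
  fixes J :: "int set"
  shows "emeasure (count_space UNIV) J = (\<Sum>i. indicator J (int_decode i))"
proof -
  have "emeasure (count_space UNIV) J = (\<integral>\<^sup>+j. indicator J j \<partial>count_space UNIV)" by simp
  also have "\<dots> = (\<integral>\<^sup>+i. indicator J (int_decode i) \<partial>count_space UNIV)"
    by (rule nn_integral_bij_count_space[symmetric]) (rule bij_int_decode)
  also have "\<dots> = (\<Sum>i. indicator J (int_decode i))" by (rule nn_integral_count_space_nat)
  finally show ?thesis .
qed

definition hits :: "'a::real_vector \<Rightarrow> 'a set \<Rightarrow> 'a \<Rightarrow> real set" where
  "hits e Z y = {t. y + t *\<^sub>R e \<in> Z}"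

text \<open>The dyadic slabs orthogonal to \<open>e\<close> project onto \<open>perp e\<close> without increasing distances, and the
  number of slabs in which a line meets \<open>Z\<close> increases to the number of hits.\<close>

lemma hits_compact_count:
  fixes e :: "'a::euclidean_space"
  assumes e: "norm e = 1" and Z: "compact Z"
  shows "(\<lambda>y. emeasure (count_space UNIV) (hits e Z y)) \<in> borel_measurable borel" (is ?meas)
    and "(\<integral>\<^sup>+y. emeasure (count_space UNIV) (hits e Z y) \<partial>hperp e) \<le> harea Z" (is ?le)
proof -
  have ee: "e \<bullet> e = 1" using e by (simp add: dot_square_norm)
  define P where "P k j = {y. \<exists>t. \<lfloor>2^k * t\<rfloor> = j \<and> y + t *\<^sub>R e \<in> Z}" for k :: nat and j :: int
  define slab where "slab k j = {x. \<lfloor>2^k * (x \<bullet> e)\<rfloor> = j}" for k :: nat and j :: int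
  have slab [measurable]: "slab k j \<in> sets borel" for k j
    unfolding slab_def by measurable
  have Zb [measurable]: "Z \<in> sets borel" using Z by (simp add: borel_compact)
  have P [measurable]: "P k j \<in> sets borel" for k j
  proof -
    \<comment> \<open>The half-open dyadic interval is exhausted by compact ones, shortened by
      1/(n+1) at the open end. Each yields a compact set of base points, so \<open>P k j\<close> is
      a countable union of compact sets.\<close>
    define Q where "Q n = (\<lambda>p. fst p - snd p *\<^sub>R e) ` (Z \<times> {j / 2^k .. (j + 1) / 2^k - 1 / real (Suc n)})" for n
    have "P k j = (\<Union>n. Q n)"
    proof (intro equalityI subsetI)
      fix y assume "y \<in> P k j"
      then obtain t where t: "\<lfloor>2^k * t\<rfloor> = j" "y + t *\<^sub>R e \<in> Z" by (auto simp: P_def)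
      have "j \<le> 2^k * t" "2^k * t < j + 1" using t(1) by linarith+
      then have t2: "j / 2^k \<le> t" "t < (j + 1) / 2^k" by (simp_all add: field_simps)
      then obtain n where "1 / real (Suc n) < (j + 1) / 2^k - t"
        using reals_Archimedean[of "(j + 1) / 2^k - t"] by (auto simp: inverse_eq_divide)
      then have "y \<in> Q n" unfolding Q_def using t t2
        by (intro image_eqI[of _ _ "(y + t *\<^sub>R e, t)"]) auto
      then show "y \<in> (\<Union>n. Q n)" by auto
    next
      fix y assume "y \<in> (\<Union>n. Q n)"
      then obtain n z t where t: "z \<in> Z" "j / 2^k \<le> t" "t \<le> (j + 1) / 2^k - 1 / real (Suc n)" "y = z - t *\<^sub>R e"
        by (auto simp: Q_def)
      have "t < (j + 1) / 2^k" using t(3) by (smt (verit) divide_pos_pos of_nat_0_less_iff zero_less_Suc)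
      then have "j \<le> 2^k * t" "2^k * t < j + 1" using t(2) by (simp_all add: field_simps)
      then have "\<lfloor>2^k * t\<rfloor> = j" by linarith
      then show "y \<in> P k j" using t by (auto simp: P_def)
    qed
    moreover have "compact (Q n)" for n
      unfolding Q_def by (intro compact_continuous_image compact_Times Z compact_Icc continuous_intros)
    then have "(\<Union>n. Q n) \<in> sets borel" by (intro sets.countable_UN) (auto intro: borel_compact)
    ultimately show ?thesis by simp
  qed
  have cnt: "emeasure (count_space UNIV) ((\<lambda>t. \<lfloor>2^k * t\<rfloor>) ` hits e Z y) = (\<Sum>i. indicator (P k (int_decode i)) y)" for k y
    unfolding emeasure_count_space_int_suminf
  proof (rule suminf_cong)
    fix i
    have "int_decode i \<in> (\<lambda>t. \<lfloor>2^k * t\<rfloor>) ` hits e Z y \<longleftrightarrow> y \<in> P k (int_decode i)"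
    proof
      assume "int_decode i \<in> (\<lambda>t. \<lfloor>2^k * t\<rfloor>) ` hits e Z y"
      then obtain t where "t \<in> hits e Z y" "int_decode i = \<lfloor>2^k * t\<rfloor>" by (rule imageE) (rule that)
      then show "y \<in> P k (int_decode i)" unfolding P_def hits_def mem_Collect_eq by (intro exI[of _ t]) simp
    next
      assume "y \<in> P k (int_decode i)"
      then obtain t where "\<lfloor>2^k * t\<rfloor> = int_decode i" "y + t *\<^sub>R e \<in> Z" unfolding P_def by (elim CollectE exE conjE) (rule that)
      then show "int_decode i \<in> (\<lambda>t. \<lfloor>2^k * t\<rfloor>) ` hits e Z y"
        unfolding hits_def by (intro image_eqI[of _ _ t]) simp_all
    qed
    then show "indicator ((\<lambda>t. \<lfloor>2^k * t\<rfloor>) ` hits e Z y) (int_decode i) = (indicator (P k (int_decode i)) y :: ennreal)"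
      by (simp only: indicator_def)
  qed
  have cnt2: "emeasure (count_space UNIV) (hits e Z y) = (SUP k. \<Sum>i. indicator (P k (int_decode i)) y)" for y
    unfolding cnt[symmetric] by (rule emeasure_count_space_dyadic)
  show ?meas unfolding cnt2 by measurable
  have Pperp: "harea (P k j \<inter> perp e) \<le> harea (Z \<inter> slab k j)" for k j
  proof -
    have "P k j \<inter> perp e \<subseteq> (\<lambda>x. x - (x \<bullet> e) *\<^sub>R e) ` (Z \<inter> slab k j)"
    proof
      fix y assume y: "y \<in> P k j \<inter> perp e"
      then obtain t where t: "\<lfloor>2^k * t\<rfloor> = j" "y + t *\<^sub>R e \<in> Z" by (auto simp: P_def)
      have "(y + t *\<^sub>R e) \<bullet> e = t" using y by (simp add: perp_def inner_add_left ee)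
      then show "y \<in> (\<lambda>x. x - (x \<bullet> e) *\<^sub>R e) ` (Z \<inter> slab k j)"
        using t by (intro image_eqI[of _ _ "y + t *\<^sub>R e"]) (auto simp: slab_def)
    qed
    then have "harea (P k j \<inter> perp e) \<le> harea ((\<lambda>x. x - (x \<bullet> e) *\<^sub>R e) ` (Z \<inter> slab k j))"
      by (rule harea_mono)
    also have "\<dots> \<le> harea (Z \<inter> slab k j)"
    proof (rule harea_lipschitz_image)
      fix x y :: 'a
      define z where "z = x - y"
      have "(norm (z - (z \<bullet> e) *\<^sub>R e))\<^sup>2 = (norm z)\<^sup>2 - (z \<bullet> e)\<^sup>2"
      proof -
        have "(norm (z - (z \<bullet> e) *\<^sub>R e))\<^sup>2 = z \<bullet> z - 2 * ((z \<bullet> e) * (z \<bullet> e)) + (z \<bullet> e) * (z \<bullet> e) * (e \<bullet> e)"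
          unfolding power2_norm_eq_inner inner_diff_left inner_diff_right inner_scaleR_left inner_scaleR_right
            inner_commute[of e z] by (simp only: algebra_simps)
        then show ?thesis unfolding ee power2_norm_eq_inner[of z] power2_eq_square[of "z \<bullet> e"] by linarith
      qed
      then have h1: "norm (z - (z \<bullet> e) *\<^sub>R e) \<le> norm z" by (auto intro: power2_le_imp_le[OF _ norm_ge_zero])
      have h2: "(x - (x \<bullet> e) *\<^sub>R e) - (y - (y \<bullet> e) *\<^sub>R e) = z - (z \<bullet> e) *\<^sub>R e"
        by (simp add: z_def inner_diff_left algebra_simps)
      show "dist (x - (x \<bullet> e) *\<^sub>R e) (y - (y \<bullet> e) *\<^sub>R e) \<le> dist x y"
        unfolding dist_norm h2 z_def[symmetric] by (rule h1)
    qed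
    finally show ?thesis .
  qed
  have "(\<integral>\<^sup>+y. emeasure (count_space UNIV) (hits e Z y) \<partial>hperp e)
      = (SUP k. \<integral>\<^sup>+y. (\<Sum>i. indicator (P k (int_decode i)) y) \<partial>hperp e)"
    unfolding cnt2
  proof (rule nn_integral_monotone_convergence_SUP)
    show "incseq (\<lambda>k y. \<Sum>i. indicator (P k (int_decode i)) y :: ennreal)"
      using incseq_count_dyadic by (auto simp: cnt[symmetric] incseq_def le_fun_def)
  qed simp
  also have "\<dots> \<le> harea Z"
  proof (rule SUP_least)
    fix k
    have "(\<integral>\<^sup>+y. (\<Sum>i. indicator (P k (int_decode i)) y) \<partial>hperp e) = (\<Sum>i. harea (P k (int_decode i) \<inter> perp e))"
      by (subst nn_integral_suminf) (auto simp: emeasure_hperp)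
    also have "\<dots> \<le> (\<Sum>i. harea (Z \<inter> slab k (int_decode i)))" by (intro suminf_le Pperp) auto
    also have "\<dots> = (\<Sum>i. emeasure area (Z \<inter> slab k (int_decode i)))" by (simp add: emeasure_area)
    \<comment> \<open>The slabs of one level are disjoint, so summing over them recovers at most the
      area of \<open>Z\<close>.\<close>
    also have "\<dots> = emeasure area (\<Union>i. Z \<inter> slab k (int_decode i))"
    proof (rule suminf_emeasure)
      show "disjoint_family (\<lambda>i. Z \<inter> slab k (int_decode i))"
        unfolding disjoint_family_on_def
      proof (intro ballI impI)
        fix i j :: nat assume "i \<noteq> j"
        then have "int_decode i \<noteq> int_decode j" by (metis int_decode_inverse)
        then show "(Z \<inter> slab k (int_decode i)) \<inter> (Z \<inter> slab k (int_decode j)) = {}"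
          by (auto simp: slab_def)
      qed
    qed auto
    also have "\<dots> \<le> emeasure area Z" by (rule emeasure_mono) auto
    finally show "(\<integral>\<^sup>+y. (\<Sum>i. indicator (P k (int_decode i)) y) \<partial>hperp e) \<le> harea Z"
      by (simp add: emeasure_area)
  qed
  finally show ?le .
qed

text \<open>The default 0 on lines with infinitely many hits is harmless: once \<open>X\<close> has
  finite area these lines form a null set. Values are generic because the same sum is used for
  \<open>ennreal\<close> and for signed real functions.\<close>

definition slice_sum :: "'a::real_vector \<Rightarrow> 'a set \<Rightarrow> ('a \<Rightarrow> 'b::comm_monoid_add) \<Rightarrow> 'a \<Rightarrow> 'b" where
  "slice_sum e X g y = (if finite (hits e X y) then \<Sum>t\<in>hits e X y. g (y + t *\<^sub>R e) else 0)"

lemma slice_sum_indicator: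
  "slice_sum e X (indicator B) y =
    (if finite (hits e X y) then emeasure (count_space UNIV) (hits e (X \<inter> B) y) else 0)"
proof (cases "finite (hits e X y)")
  case True
  have "(\<Sum>t\<in>hits e X y. indicator B (y + t *\<^sub>R e) :: ennreal) = (\<Sum>t\<in>hits e (X \<inter> B) y. 1)"
    using True by (intro sum.mono_neutral_cong_right) (auto simp: hits_def indicator_def)
  moreover have "finite (hits e (X \<inter> B) y)" using True by (rule finite_subset[rotated]) (auto simp: hits_def)
  ultimately show ?thesis using True by (simp add: slice_sum_def)
qed (simp add: slice_sum_def)

text \<open>For closed \<open>B\<close> the slice sum counts the hits of the compact set
  \<open>X \<inter> B\<close>. The other Borel sets follow by a Dynkin argument; complements are
  differences of finite values, because lines with infinitely many hits were set to 0.\<close>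

lemma slice_sum_measurable_indicator:
  fixes e :: "'a::euclidean_space"
  assumes e: "norm e = 1" and X: "compact X" and B: "B \<in> sets borel"
  shows "slice_sum e X (indicator B :: _ \<Rightarrow> ennreal) \<in> borel_measurable borel"
proof -
  let ?L = "\<lambda>B. slice_sum e X (indicator B :: _ \<Rightarrow> ennreal)"
  have "{y. emeasure (count_space UNIV) (hits e X y) < top} \<in> sets borel"
    using hits_compact_count(1)[OF e X] by measurable
  moreover have "{y. emeasure (count_space UNIV) (hits e X y) < top} = {y. finite (hits e X y)}"
    by (auto simp: emeasure_count_space of_nat_less_top)
  ultimately have fin [measurable]: "{y. finite (hits e X y)} \<in> sets borel" by simp
  have closed: "?L B \<in> borel_measurable borel" if "closed B" for B
  proof -
    have [measurable]: "(\<lambda>y. emeasure (count_space UNIV) (hits e (X \<inter> B) y)) \<in> borel_measurable borel"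
      using compact_Int_closed[OF X that] by (rule hits_compact_count(1)[OF e])
    show ?thesis unfolding slice_sum_indicator[abs_def]
      by (rule measurable_If) (use fin in auto)
  qed
  have "Int_stable (Collect closed :: 'a set set)" "Collect closed \<subseteq> Pow (UNIV :: 'a set)"
    "B \<in> sigma_sets UNIV (Collect closed)" using B by (auto simp: Int_stable_def borel_eq_closed sets_measure_of)
  then show ?thesis
  proof (induction B rule: sigma_sets_induct_disjoint)
    case (basic A) then show ?case using closed by auto
  next
    case empty show ?case by (rule closed) simp
  next
    case (compl A)
    have "?L (UNIV - A) = (\<lambda>y. ?L UNIV y - ?L A y)"
    proof
      fix y
      show "?L (UNIV - A) y = ?L UNIV y - ?L A y"
      proof (cases "finite (hits e X y)")
        case True
        have "?L UNIV y = ?L (UNIV - A) y + ?L A y"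
          using True unfolding slice_sum_def sum.distrib[symmetric]
          by (simp only: if_True sum.distrib[symmetric]) (rule sum.cong, auto simp: indicator_def)
        moreover have "?L A y \<noteq> top"
          using True unfolding slice_sum_indicator
          by (auto simp: hits_def emeasure_count_space of_nat_less_top finite_subset[of _ "{t. y + t *\<^sub>R e \<in> X}"])
        ultimately show ?thesis by simp
      qed (simp add: slice_sum_def)
    qed
    then show ?case using compl closed[of UNIV] by simp
  next
    case (union A)
    have "?L (\<Union>i. A i) = (\<lambda>y. \<Sum>i. ?L (A i) y)"
    proof
      fix y
      show "?L (\<Union>i. A i) y = (\<Sum>i. ?L (A i) y)"
        using union(1) by (auto simp: slice_sum_def suminf_sum[OF summableI] suminf_indicator intro!: sum.cong)
    qed
    then show ?case using union by simp
  qed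
qed

section \<open>The crossing measure of a compact set in a given direction\<close>

definition slice_meas :: "'a::euclidean_space \<Rightarrow> 'a set \<Rightarrow> 'a measure" where
  "slice_meas e X = measure_of UNIV (sets borel) (\<lambda>B. \<integral>\<^sup>+y. slice_sum e X (indicator B) y \<partial>hperp e)"

lemma space_slice_meas [simp]: "space (slice_meas e X) = UNIV"
  and sets_slice_meas [measurable_cong, simp]: "sets (slice_meas e X) = sets borel"
  unfolding slice_meas_def
   apply (simp add: space_measure_of_conv)
  using sets.sigma_sets_eq[of borel] by (simp add: sets_measure_of_conv)

lemma emeasure_slice_meas:
  fixes e :: "'a::euclidean_space"
  assumes e: "norm e = 1" and X: "compact X" and B: "B \<in> sets borel"
  shows "emeasure (slice_meas e X) B = (\<integral>\<^sup>+y. slice_sum e X (indicator B) y \<partial>hperp e)"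
  unfolding slice_meas_def
proof (rule emeasure_measure_of_sigma)
  show "sigma_algebra UNIV (sets (borel :: 'a measure))"
    using sets.sigma_algebra_axioms[of "borel :: 'a measure"] by simp
  show "positive (sets borel) (\<lambda>B. \<integral>\<^sup>+y. slice_sum e X (indicator B) y \<partial>hperp e)"
    by (auto simp: positive_def slice_sum_def cong: if_cong)
  show "countably_additive (sets borel) (\<lambda>B. \<integral>\<^sup>+y. slice_sum e X (indicator B) y \<partial>hperp e)"
  proof (rule countably_additiveI)
    fix A :: "nat \<Rightarrow> 'a set" assume A: "range A \<subseteq> sets borel" "disjoint_family A"
    have "(\<Sum>i. \<integral>\<^sup>+y. slice_sum e X (indicator (A i)) y \<partial>hperp e)
        = (\<integral>\<^sup>+y. (\<Sum>i. slice_sum e X (indicator (A i)) y) \<partial>hperp e)"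
      using slice_sum_measurable_indicator[OF e X] A(1)
      by (intro nn_integral_suminf[symmetric]) (auto simp: image_subset_iff cong: measurable_cong_sets)
    also have "\<dots> = (\<integral>\<^sup>+y. slice_sum e X (indicator (\<Union>i. A i)) y \<partial>hperp e)"
      using A(2) by (intro nn_integral_cong)
        (auto simp: slice_sum_def suminf_sum[OF summableI] suminf_indicator intro!: sum.cong)
    finally show "(\<Sum>i. \<integral>\<^sup>+y. slice_sum e X (indicator (A i)) y \<partial>hperp e)
        = (\<integral>\<^sup>+y. slice_sum e X (indicator (\<Union>i. A i)) y \<partial>hperp e)" .
  qed
qed (use B in auto)

lemma emeasure_slice_meas_closed_le:
  assumes e: "norm e = 1" and X: "compact X" and B: "closed B"
  shows "emeasure (slice_meas e X) B \<le> harea (X \<inter> B)"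
proof -
  have "emeasure (slice_meas e X) B = (\<integral>\<^sup>+y. slice_sum e X (indicator B) y \<partial>hperp e)"
    by (rule emeasure_slice_meas[OF e X]) (use B in auto)
  also have "\<dots> \<le> (\<integral>\<^sup>+y. emeasure (count_space UNIV) (hits e (X \<inter> B) y) \<partial>hperp e)"
    by (rule nn_integral_mono) (simp add: slice_sum_indicator)
  also have "\<dots> \<le> harea (X \<inter> B)"
    by (rule hits_compact_count(2)[OF e compact_Int_closed[OF X B]])
  finally show ?thesis .
qed

lemma finite_measure_slice_meas:
  assumes "norm e = 1" "compact X" "harea X < top"
  shows "finite_measure (slice_meas e X)"
  using emeasure_slice_meas_closed_le[OF assms(1,2), of UNIV] assms(3)
  by (intro finite_measureI) auto

text \<open>The projection estimate is available for compact pieces; inner regularity of the finite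
  measure on the left extends it to Borel sets.\<close>

lemma emeasure_slice_meas_le:
  fixes e :: "'a::euclidean_space"
  assumes e: "norm e = 1" and X: "compact X" and fin: "harea X < top" and B: "B \<in> sets borel"
  shows "emeasure (slice_meas e X) B \<le> harea (X \<inter> B)"
proof -
  interpret finite_measure "slice_meas e X" by (rule finite_measure_slice_meas) fact+
  have "emeasure (slice_meas e X) B = (SUP K\<in>{K. K \<subseteq> B \<and> compact K}. emeasure (slice_meas e X) K)"
    by (rule inner_regular) (use B emeasure_finite in auto)
  also have "\<dots> \<le> harea (X \<inter> B)"
    by (rule SUP_least)
      (auto intro!: order_trans[OF emeasure_slice_meas_closed_le[OF e X]] harea_mono compact_imp_closed)
  finally show ?thesis .
qed

lemma AE_finite_hits:
  assumes e: "norm e = 1" and X: "compact X" and fin: "harea X < top"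
  shows "AE y in hperp e. finite (hits e X y)"
proof -
  have "(\<integral>\<^sup>+y. emeasure (count_space UNIV) (hits e X y) \<partial>hperp e) \<noteq> \<infinity>"
    using hits_compact_count(2)[OF e X] fin by (auto simp: top_unique)
  then have "AE y in hperp e. emeasure (count_space UNIV) (hits e X y) \<noteq> \<infinity>"
    by (rule nn_integral_PInf_AE[rotated]) (use hits_compact_count(1)[OF e X] in simp)
  then show ?thesis by eventually_elim (auto simp: emeasure_count_space split: if_splits)
qed

text \<open>Measurability and the integral identity are proved in one induction, since the identity
  for sums and for increasing limits uses the measurability of the slice sums of the pieces.\<close>

lemma slice_sum_nn:
  fixes e :: "'a::euclidean_space"
  assumes e: "norm e = 1" and X: "compact X" and g: "g \<in> borel_measurable borel"
  shows "slice_sum e X g \<in> borel_measurable borel \<and>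
    (\<integral>\<^sup>+x. g x \<partial>slice_meas e X) = (\<integral>\<^sup>+y. slice_sum e X g y \<partial>hperp e)"
  using g
proof (induction g rule: borel_measurable_induct)
  case (cong f g)
  then have "f = g" by auto
  with cong show ?case by simp
next
  case (set A)
  then show ?case
    using slice_sum_measurable_indicator[OF e X, of A] emeasure_slice_meas[OF e X, of A] by simp
next
  case (mult u c)
  have "slice_sum e X (\<lambda>x. c * u x) = (\<lambda>y. c * slice_sum e X u y)"
    by (auto simp: slice_sum_def sum_distrib_left)
  moreover have [measurable]: "slice_sum e X u \<in> borel_measurable borel" using mult by auto
  ultimately show ?case using mult by (simp add: nn_integral_cmult)
next
  case (add u v)
  have "slice_sum e X (\<lambda>x. v x + u x) = (\<lambda>y. slice_sum e X v y + slice_sum e X u y)"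
    by (auto simp: slice_sum_def sum.distrib)
  moreover have [measurable]: "slice_sum e X u \<in> borel_measurable borel"
    "slice_sum e X v \<in> borel_measurable borel" using add by auto
  ultimately show ?case using add by (simp add: nn_integral_add)
next
  case (seq U)
  have eq: "slice_sum e X (SUP i. U i) = (\<lambda>y. SUP i. slice_sum e X (U i) y)"
  proof
    fix y
    show "slice_sum e X (SUP i. U i) y = (SUP i. slice_sum e X (U i) y)"
    proof (cases "finite (hits e X y)")
      case True
      have "(SUP i. \<Sum>t\<in>hits e X y. U i (y + t *\<^sub>R e)) = (\<Sum>t\<in>hits e X y. SUP i. U i (y + t *\<^sub>R e))"
        using \<open>incseq U\<close> by (intro ennreal_SUP_sum) (auto simp: incseq_def le_fun_def)
      then show ?thesis using True by (simp add: slice_sum_def image_comp)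
    qed (simp add: slice_sum_def)
  qed
  have inc: "incseq (\<lambda>i. slice_sum e X (U i))"
    using \<open>incseq U\<close> by (auto simp: incseq_def le_fun_def slice_sum_def intro!: sum_mono)
  have [measurable]: "slice_sum e X (U i) \<in> borel_measurable borel" for i using seq by simp
  have "(\<integral>\<^sup>+x. (SUP i. U i) x \<partial>slice_meas e X) = (\<integral>\<^sup>+x. (SUP i. U i x) \<partial>slice_meas e X)"
    by (simp add: image_comp)
  also have "\<dots> = (SUP i. \<integral>\<^sup>+x. U i x \<partial>slice_meas e X)"
    using seq by (intro nn_integral_monotone_convergence_SUP) auto
  also have "\<dots> = (SUP i. \<integral>\<^sup>+y. slice_sum e X (U i) y \<partial>hperp e)" using seq by simp
  also have "\<dots> = (\<integral>\<^sup>+y. (SUP i. slice_sum e X (U i) y) \<partial>hperp e)"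
    using inc by (intro nn_integral_monotone_convergence_SUP[symmetric]) auto
  finally show ?case unfolding eq by simp
qed

lemma slice_sum_integral:
  fixes e :: "'a::euclidean_space" and g :: "'a \<Rightarrow> real"
  assumes e: "norm e = 1" and X: "compact X" and fin: "harea X < top"
    and g: "g \<in> borel_measurable borel" "\<And>x. \<bar>g x\<bar> \<le> C"
  shows "integrable (hperp e) (slice_sum e X g)"
    "(\<integral>x. g x \<partial>slice_meas e X) = (\<integral>y. slice_sum e X g y \<partial>hperp e)"
proof -
  interpret finite_measure "slice_meas e X" by (rule finite_measure_slice_meas) fact+
  note [measurable] = g(1)
  have nonneg: "integrable (hperp e) (slice_sum e X h) \<and>
      (\<integral>x. h x \<partial>slice_meas e X) = (\<integral>y. slice_sum e X h y \<partial>hperp e)"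
    if h[measurable]: "h \<in> borel_measurable borel" and hC: "\<And>x. 0 \<le> h x" "\<And>x. h x \<le> C" for h :: "'a \<Rightarrow> real"
  proof -
    have conv: "ennreal (slice_sum e X h y) = slice_sum e X (\<lambda>x. ennreal (h x)) y" for y
      by (simp add: slice_sum_def sum_ennreal hC)
    have sl0: "slice_sum e X h y \<ge> 0" for y by (simp add: slice_sum_def sum_nonneg hC)
    have m: "slice_sum e X h \<in> borel_measurable borel"
    proof -
      have "slice_sum e X h = (\<lambda>y. enn2real (slice_sum e X (\<lambda>x. ennreal (h x)) y))"
        unfolding conv[symmetric] using sl0 by (auto simp: fun_eq_iff)
      moreover have [measurable]: "slice_sum e X (\<lambda>x. ennreal (h x)) \<in> borel_measurable borel"
        using slice_sum_nn[OF e X, of "\<lambda>x. ennreal (h x)"] by simp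
      ultimately show ?thesis by simp
    qed
    have hint: "integrable (slice_meas e X) h"
      by (rule integrable_const_bound[of _ C]) (use hC in auto)
    have eq: "(\<integral>\<^sup>+x. ennreal (h x) \<partial>slice_meas e X) = (\<integral>\<^sup>+y. ennreal (slice_sum e X h y) \<partial>hperp e)"
      unfolding conv using slice_sum_nn[OF e X, of "\<lambda>x. ennreal (h x)"] by simp
    have "(\<integral>\<^sup>+y. ennreal (slice_sum e X h y) \<partial>hperp e) < top"
      unfolding eq[symmetric] using hint hC by (simp add: nn_integral_eq_integral)
    then have i: "integrable (hperp e) (slice_sum e X h)"
      using m sl0 by (intro integrableI_nonneg) auto
    show ?thesis
      using eq i hint hC sl0 by (simp add: nn_integral_eq_integral integral_nonneg_AE)
  qed
  let ?p = "\<lambda>x. max 0 (g x)" and ?n = "\<lambda>x. max 0 (- g x)"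
  have p: "integrable (hperp e) (slice_sum e X ?p) \<and>
      (\<integral>x. ?p x \<partial>slice_meas e X) = (\<integral>y. slice_sum e X ?p y \<partial>hperp e)"
    and n: "integrable (hperp e) (slice_sum e X ?n) \<and>
      (\<integral>x. ?n x \<partial>slice_meas e X) = (\<integral>y. slice_sum e X ?n y \<partial>hperp e)"
  proof -
    have "0 \<le> C" using g(2)[of undefined] by linarith
    then have "?p x \<le> C" "?n x \<le> C" for x using g(2)[of x] by auto
    then show "integrable (hperp e) (slice_sum e X ?p) \<and>
        (\<integral>x. ?p x \<partial>slice_meas e X) = (\<integral>y. slice_sum e X ?p y \<partial>hperp e)"
      "integrable (hperp e) (slice_sum e X ?n) \<and>
        (\<integral>x. ?n x \<partial>slice_meas e X) = (\<integral>y. slice_sum e X ?n y \<partial>hperp e)"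
      using nonneg[of ?p] nonneg[of ?n] by simp_all
  qed
  have gd: "g = (\<lambda>x. ?p x - ?n x)" by auto
  have sd: "slice_sum e X g = (\<lambda>y. slice_sum e X ?p y - slice_sum e X ?n y)"
    by (subst gd) (auto simp: slice_sum_def sum_subtractf[symmetric])
  show "integrable (hperp e) (slice_sum e X g)"
    unfolding sd using p n by auto
  have "integrable (slice_meas e X) ?p" "integrable (slice_meas e X) ?n"
    by (auto intro!: integrable_const_bound[of _ C] simp: abs_le_iff g(2)[unfolded abs_le_iff]
        order_trans[OF abs_ge_zero g(2)])
  then show "(\<integral>x. g x \<partial>slice_meas e X) = (\<integral>y. slice_sum e X g y \<partial>hperp e)"
    unfolding sd using p n by (subst gd) simp
qed


section \<open>Crossings of a line with a region\<close>

text \<open>The one-sided trace of \<open>V\<close> at \<open>x\<close> in direction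
  \<open>e\<close>: the line runs inside \<open>V\<close> immediately after \<open>x\<close>. With
  \<open>- e\<close> it describes the other side.\<close>

definition on_side :: "'a::real_vector \<Rightarrow> 'a set \<Rightarrow> 'a \<Rightarrow> bool" where
  "on_side e V x \<longleftrightarrow> (\<exists>\<epsilon>>0. \<forall>s. 0 < s \<and> s < \<epsilon> \<longrightarrow> x + s *\<^sub>R e \<in> V)"

lemma on_side_line:
  fixes e :: "'a::real_vector"
  shows "on_side e V (y + t *\<^sub>R e) \<longleftrightarrow> on_side 1 {t. y + t *\<^sub>R e \<in> V} (t::real)"
    "on_side (- e) V (y + t *\<^sub>R e) \<longleftrightarrow> on_side (- 1) {t. y + t *\<^sub>R e \<in> V} (t::real)"
  by (simp_all add: on_side_def algebra_simps)

lemma on_side_unique: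
  assumes "on_side e V x" "on_side e V' x"
  shows "V \<inter> V' \<noteq> {}"
proof -
  obtain a b where "a > 0" "\<And>s. 0 < s \<Longrightarrow> s < a \<Longrightarrow> x + s *\<^sub>R e \<in> V"
    "b > 0" "\<And>s. 0 < s \<Longrightarrow> s < b \<Longrightarrow> x + s *\<^sub>R e \<in> V'"
    using assms by (auto simp: on_side_def)
  then have "x + (min a b / 2) *\<^sub>R e \<in> V \<inter> V'" by auto
  then show ?thesis by auto
qed

lemma on_side_in_closure:
  fixes e :: "'a::real_normed_vector"
  assumes "on_side e V x"
  shows "x \<in> closure V"
proof -
  obtain a where a: "a > 0" "\<And>s. 0 < s \<Longrightarrow> s < a \<Longrightarrow> x + s *\<^sub>R e \<in> V"
    using assms by (auto simp: on_side_def)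
  have "((\<lambda>s. x + s *\<^sub>R e) \<longlongrightarrow> x + 0 *\<^sub>R e) (at_right 0)"
    by (intro tendsto_intros)
  moreover have "\<forall>\<^sub>F s in at_right 0. x + s *\<^sub>R e \<in> V"
    using a by (auto simp: eventually_at_right_field)
  ultimately have "x + 0 *\<^sub>R e \<in> closure V"
    by (intro Lim_in_closed_set[of "closure V" _ "at_right 0"])
      (auto elim!: eventually_mono intro: closure_subset[THEN subsetD])
  then show ?thesis by simp
qed

text \<open>Failure means that the line leaves \<open>V\<close> at arbitrarily small positive
  parameters. Exhausting the parameter range by compact intervals writes this with sets of the form
  closed minus compact, which are closed.\<close>

lemma on_side_borel [measurable]:
  fixes e :: "'a::euclidean_space"
  assumes "open V"
  shows "{x. on_side e V x} \<in> sets borel"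
proof -
  define Q where "Q m k = {x. \<exists>s\<in>{1 / real (Suc k) .. 1 / real (Suc m) - 1 / real (Suc k)}. x + s *\<^sub>R e \<in> - V}" for m k
  have Q [measurable]: "Q m k \<in> sets borel" for m k
  proof -
    let ?K = "(\<lambda>s. s *\<^sub>R e) ` {1 / real (Suc k) .. 1 / real (Suc m) - 1 / real (Suc k)}"
    have "compact ?K" by (intro compact_continuous_image continuous_intros compact_Icc)
    then have "closed (\<Union>x\<in>-V. \<Union>y\<in>?K. {x - y})" using assms by (intro closed_compact_differences) auto
    also have "(\<Union>x\<in>-V. \<Union>y\<in>?K. {x - y}) = Q m k"
    proof (intro equalityI subsetI)
      fix x assume "x \<in> Q m k"
      then obtain s where s: "s \<in> {1 / real (Suc k) .. 1 / real (Suc m) - 1 / real (Suc k)}" "x + s *\<^sub>R e \<in> - V"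
        unfolding Q_def by blast
      have "x \<in> {(x + s *\<^sub>R e) - s *\<^sub>R e}" by simp
      then show "x \<in> (\<Union>x\<in>-V. \<Union>y\<in>?K. {x - y})" using s by blast
    next
      fix x assume "x \<in> (\<Union>x\<in>-V. \<Union>y\<in>?K. {x - y})"
      then obtain z s where "z \<in> - V" "s \<in> {1 / real (Suc k) .. 1 / real (Suc m) - 1 / real (Suc k)}" "x = z - s *\<^sub>R e"
        by blast
      then show "x \<in> Q m k" unfolding Q_def by (intro CollectI bexI[of _ s]) simp_all
    qed
    finally show ?thesis by (rule borel_closed)
  qed
  have Qiff: "(\<exists>k. x \<in> Q m k) \<longleftrightarrow> (\<exists>s. 0 < s \<and> s < 1 / real (Suc m) \<and> x + s *\<^sub>R e \<notin> V)" for m x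
  proof
    assume "\<exists>k. x \<in> Q m k"
    then obtain k s where s: "s \<in> {1 / real (Suc k) .. 1 / real (Suc m) - 1 / real (Suc k)}" "x + s *\<^sub>R e \<in> - V"
      unfolding Q_def by blast
    have "0 < 1 / real (Suc k)" by simp
    then have "0 < s" "s < 1 / real (Suc m)" using s(1) unfolding atLeastAtMost_iff by linarith+
    then show "\<exists>s. 0 < s \<and> s < 1 / real (Suc m) \<and> x + s *\<^sub>R e \<notin> V"
      using s by blast
  next
    assume "\<exists>s. 0 < s \<and> s < 1 / real (Suc m) \<and> x + s *\<^sub>R e \<notin> V"
    then obtain s where s: "0 < s" "s < 1 / real (Suc m)" "x + s *\<^sub>R e \<notin> V" by blast
    obtain k where "1 / real (Suc k) < min s (1 / real (Suc m) - s)"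
      using reals_Archimedean[of "min s (1 / real (Suc m) - s)"] s by (auto simp: inverse_eq_divide)
    then have "x \<in> Q m k" using s unfolding Q_def by (auto intro!: bexI[of _ s])
    then show "\<exists>k. x \<in> Q m k" by blast
  qed
  have "on_side e V x \<longleftrightarrow> (\<exists>m. \<not> (\<exists>k. x \<in> Q m k))" for x
    unfolding Qiff
  proof
    assume "on_side e V x"
    then obtain a where a: "a > 0" "\<And>s. 0 < s \<Longrightarrow> s < a \<Longrightarrow> x + s *\<^sub>R e \<in> V" by (auto simp: on_side_def)
    then obtain m where "1 / real (Suc m) < a"
      using reals_Archimedean[of a] by (auto simp: inverse_eq_divide)
    then show "\<exists>m. \<not> (\<exists>s. 0 < s \<and> s < 1 / real (Suc m) \<and> x + s *\<^sub>R e \<notin> V)"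
      using a by (intro exI[of _ m]) (auto simp del: of_nat_Suc)
  next
    assume "\<exists>m. \<not> (\<exists>s. 0 < s \<and> s < 1 / real (Suc m) \<and> x + s *\<^sub>R e \<notin> V)"
    then obtain m where "\<not> (\<exists>s. 0 < s \<and> s < 1 / real (Suc m) \<and> x + s *\<^sub>R e \<notin> V)" by blast
    then show "on_side e V x"
      unfolding on_side_def by (intro exI[of _ "1 / real (Suc m)"]) auto
  qed
  then have "{x. on_side e V x} = (\<Union>m. - (\<Union>k. Q m k))" by (simp add: set_eq_iff)
  then show ?thesis by simp
qed

text \<open>An interval free of frontier points is connected, hence entirely inside or entirely
  outside \<open>U\<close>; one point near an endpoint decides which.\<close>

lemma on_side_real_interval:
  fixes U :: "real set"
  assumes "c < d" "{c<..<d} \<inter> frontier U = {}"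
  shows "on_side 1 U c \<longleftrightarrow> {c<..<d} \<subseteq> U" "on_side (-1) U d \<longleftrightarrow> {c<..<d} \<subseteq> U"
    "{c<..<d} \<subseteq> U \<or> {c<..<d} \<inter> U = {}"
proof -
  show *: "{c<..<d} \<subseteq> U \<or> {c<..<d} \<inter> U = {}"
    using connected_Int_frontier[of "{c<..<d}" U] assms(2) by auto
  have "{c<..<d} \<subseteq> U \<Longrightarrow> on_side 1 U c" "{c<..<d} \<subseteq> U \<Longrightarrow> on_side (-1) U d"
    unfolding on_side_def using assms(1) by (auto intro!: exI[of _ "d - c"])
  moreover have "{c<..<d} \<inter> U \<noteq> {}" if os: "on_side 1 U c"
  proof -
    obtain a where a: "a > 0" "\<And>s. 0 < s \<Longrightarrow> s < a \<Longrightarrow> c + s \<in> U" using os by (auto simp: on_side_def)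
    define s where "s = min a (d - c) / 2"
    have "0 < s" "s < a" "s < d - c" using a(1) assms(1) by (auto simp: s_def min_def)
    then have "c + s \<in> {c<..<d} \<inter> U" using a(2) by auto
    then show ?thesis by blast
  qed
  moreover have "{c<..<d} \<inter> U \<noteq> {}" if os: "on_side (-1) U d"
  proof -
    obtain a where a: "a > 0" "\<And>s. 0 < s \<Longrightarrow> s < a \<Longrightarrow> d - s \<in> U" using os by (auto simp: on_side_def)
    define s where "s = min a (d - c) / 2"
    have "0 < s" "s < a" "s < d - c" using a(1) assms(1) by (auto simp: s_def min_def)
    then have "d - s \<in> {c<..<d} \<inter> U" using a(2) by auto
    then show ?thesis by blast
  qed
  ultimately show "on_side 1 U c \<longleftrightarrow> {c<..<d} \<subseteq> U" "on_side (-1) U d \<longleftrightarrow> {c<..<d} \<subseteq> U"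
    using * by blast+
qed

lemma finite_gap_right:
  fixes T :: "real set"
  assumes "finite T"
  shows "\<exists>d>t. {t<..<d} \<inter> T = {}"
proof (cases "T \<inter> {t<..} = {}")
  case True
  then show ?thesis by (intro exI[of _ "t + 1"]) auto
next
  case False
  with assms have "Min (T \<inter> {t<..}) \<in> T \<inter> {t<..}" by (intro Min_in) auto
  moreover have "{t<..<Min (T \<inter> {t<..})} \<inter> T = {}"
  proof (rule equals0I)
    fix x assume x: "x \<in> {t<..<Min (T \<inter> {t<..})} \<inter> T"
    then have "Min (T \<inter> {t<..}) \<le> x" using assms by (intro Min_le) auto
    with x show False by auto
  qed
  ultimately show ?thesis by (intro exI[of _ "Min (T \<inter> {t<..})"]) auto
qed

text \<open>The fundamental theorem of calculus on each gap between points of \<open>T\<close>.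
  Splitting at one point of \<open>T\<close> turns the two new endpoint terms into its jump term.
  The set \<open>T\<close> may contain points off the frontier: there both sides agree and the jump
  is zero.\<close>

lemma integral_jumps:
  fixes g g' :: "real \<Rightarrow> real" and U :: "real set"
  assumes ab: "a < b" and T: "finite T" and U: "open U" "frontier U \<inter> {a<..<b} \<subseteq> T"
    and g: "\<And>t. (g has_real_derivative g' t) (at t)" "continuous_on UNIV g'"
  shows "(\<integral>t. indicator (U \<inter> {a<..<b}) t * g' t \<partial>lborel)
    = g b * of_bool (on_side (-1) U b) - g a * of_bool (on_side 1 U a)
      + (\<Sum>t\<in>T \<inter> {a<..<b}. g t * (of_bool (on_side (-1) U t) - of_bool (on_side 1 U t)))"
  using ab U(2)
proof (induction "card (T \<inter> {a<..<b})" arbitrary: a b rule: less_induct)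
  case less
  have intg: "integrable lborel (\<lambda>t. indicator (U \<inter> {c<..<d}) t * g' t)" for c d
  proof -
    have "set_integrable lborel {c..d} g'"
      by (rule borel_integrable_atLeastAtMost') (use g(2) continuous_on_subset in blast)
    then have "set_integrable lborel (U \<inter> {c<..<d}) g'"
      by (rule set_integrable_subset) (use U(1) in auto)
    then show ?thesis by (simp add: set_integrable_def)
  qed
  show ?case
  proof (cases "T \<inter> {a<..<b} = {}")
    case True
    then have dis: "{a<..<b} \<inter> frontier U = {}" using less.prems by auto
    note side = on_side_real_interval[OF less.prems(1) dis]
    from side(3) show ?thesis
    proof
      assume sub: "{a<..<b} \<subseteq> U"
      have "(\<integral>t. indicator (U \<inter> {a<..<b}) t * g' t \<partial>lborel) = (\<integral>t. g' t * indicator {a..b} t \<partial>lborel)"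
      proof (rule integral_cong_AE)
        show "AE t in lborel. indicator (U \<inter> {a<..<b}) t * g' t = g' t * indicator {a..b} t"
          using AE_lborel_singleton[of a] AE_lborel_singleton[of b]
        proof eventually_elim
          case (elim t)
          then show ?case using subsetD[OF sub, of t] by (auto simp: indicator_def)
        qed
        show "(\<lambda>t. indicator (U \<inter> {a<..<b}) t * g' t) \<in> borel_measurable lborel"
          using borel_measurable_integrable[OF intg[of a b]] .
        show "(\<lambda>t. g' t * indicator {a..b} t) \<in> borel_measurable lborel"
          using borel_measurable_continuous_onI[OF g(2)] by simp
      qed
      also have "\<dots> = g b - g a"
        by (rule integral_FTC_Icc_real)
          (use less.prems g in \<open>auto simp: continuous_on_eq_continuous_at\<close>)
      finally show ?thesis using side sub True by simp
    next
      assume dj: "{a<..<b} \<inter> U = {}"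
      then have "U \<inter> {a<..<b} = {}" by auto
      moreover have "\<not> {a<..<b} \<subseteq> U"
      proof
        obtain z where "z \<in> {a<..<b}" using less.prems(1) dense[of a b] by auto
        moreover assume "{a<..<b} \<subseteq> U"
        ultimately show False using dj by blast
      qed
      ultimately show ?thesis using side True by simp
    qed
  next
    case False
    then obtain t where "t \<in> T \<inter> {a<..<b}" by blast
    then have t: "t \<in> T" "a < t" "t < b" by auto
    have 1: "card (T \<inter> {a<..<t}) < card (T \<inter> {a<..<b})"
      by (rule psubset_card_mono) (use T t in auto)
    have 2: "card (T \<inter> {t<..<b}) < card (T \<inter> {a<..<b})"
      by (rule psubset_card_mono) (use T t in auto)
    have f: "frontier U \<inter> {a<..<t} \<subseteq> T" "frontier U \<inter> {t<..<b} \<subseteq> T" using less.prems t by auto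
    have "(\<integral>s. indicator (U \<inter> {a<..<b}) s * g' s \<partial>lborel)
        = (\<integral>s. indicator (U \<inter> {a<..<t}) s * g' s + indicator (U \<inter> {t<..<b}) s * g' s \<partial>lborel)"
    proof (rule integral_cong_AE)
      show "AE s in lborel. indicator (U \<inter> {a<..<b}) s * g' s
          = indicator (U \<inter> {a<..<t}) s * g' s + indicator (U \<inter> {t<..<b}) s * g' s"
        using AE_lborel_singleton[of t]
        by eventually_elim (use t in \<open>auto simp: indicator_def\<close>)
    qed (use borel_measurable_integrable[OF intg] in auto)
    also have "\<dots> = (\<integral>s. indicator (U \<inter> {a<..<t}) s * g' s \<partial>lborel) + (\<integral>s. indicator (U \<inter> {t<..<b}) s * g' s \<partial>lborel)"
      by (rule Bochner_Integration.integral_add[OF intg intg])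
    also have "(\<integral>s. indicator (U \<inter> {a<..<t}) s * g' s \<partial>lborel)
      = g t * of_bool (on_side (-1) U t) - g a * of_bool (on_side 1 U a)
      + (\<Sum>t\<in>T \<inter> {a<..<t}. g t * (of_bool (on_side (-1) U t) - of_bool (on_side 1 U t)))"
      by (rule less.hyps[OF 1 t(2) f(1)])
    also have "(\<integral>s. indicator (U \<inter> {t<..<b}) s * g' s \<partial>lborel)
      = g b * of_bool (on_side (-1) U b) - g t * of_bool (on_side 1 U t)
      + (\<Sum>t\<in>T \<inter> {t<..<b}. g t * (of_bool (on_side (-1) U t) - of_bool (on_side 1 U t)))"
      by (rule less.hyps[OF 2 t(3) f(2)])
    finally have eq: "(\<integral>s. indicator (U \<inter> {a<..<b}) s * g' s \<partial>lborel)
      = g t * of_bool (on_side (-1) U t) - g a * of_bool (on_side 1 U a)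
      + (\<Sum>t\<in>T \<inter> {a<..<t}. g t * (of_bool (on_side (-1) U t) - of_bool (on_side 1 U t)))
      + (g b * of_bool (on_side (-1) U b) - g t * of_bool (on_side 1 U t)
      + (\<Sum>t\<in>T \<inter> {t<..<b}. g t * (of_bool (on_side (-1) U t) - of_bool (on_side 1 U t))))" .
    have "T \<inter> {a<..<b} = insert t ((T \<inter> {a<..<t}) \<union> (T \<inter> {t<..<b}))" using t by auto
    then have "(\<Sum>t\<in>T \<inter> {a<..<b}. g t * (of_bool (on_side (-1) U t) - of_bool (on_side 1 U t)))
      = g t * (of_bool (on_side (-1) U t) - of_bool (on_side 1 U t))
      + ((\<Sum>t\<in>T \<inter> {a<..<t}. g t * (of_bool (on_side (-1) U t) - of_bool (on_side 1 U t)))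
      + (\<Sum>t\<in>T \<inter> {t<..<b}. g t * (of_bool (on_side (-1) U t) - of_bool (on_side 1 U t))))"
      using T by (simp only:) (subst sum.insert; (subst sum.union_disjoint)?; auto)
    with eq show ?thesis by (simp add: algebra_simps)
  qed
qed

section \<open>Continuously differentiable functions along lines, and the crossing formula\<close>

definition C1_grad :: "('a::euclidean_space \<Rightarrow> real) \<Rightarrow> ('a \<Rightarrow> 'a) \<Rightarrow> bool" where
  "C1_grad \<psi> G \<longleftrightarrow> continuous_on UNIV G \<and> (\<forall>x. (\<psi> has_derivative (\<lambda>h. G x \<bullet> h)) (at x))"

lemma C1_grad_line:
  assumes "C1_grad \<psi> G"
  shows "((\<lambda>t. \<psi> (y + t *\<^sub>R e)) has_real_derivative G (y + t *\<^sub>R e) \<bullet> e) (at t)"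
    "continuous_on UNIV (\<lambda>t. G (y + t *\<^sub>R e) \<bullet> e)"
proof -
  have "((\<lambda>t. y + t *\<^sub>R e) has_derivative (\<lambda>h. h *\<^sub>R e)) (at t)"
    by (auto intro!: derivative_eq_intros)
  moreover have "(\<psi> has_derivative (\<lambda>h. G (y + t *\<^sub>R e) \<bullet> h)) (at (y + t *\<^sub>R e))"
    using assms by (auto simp: C1_grad_def)
  ultimately have "((\<lambda>t. \<psi> (y + t *\<^sub>R e)) has_derivative (\<lambda>h. G (y + t *\<^sub>R e) \<bullet> (h *\<^sub>R e))) (at t)"
    by (rule has_derivative_compose)
  then show "((\<lambda>t. \<psi> (y + t *\<^sub>R e)) has_real_derivative G (y + t *\<^sub>R e) \<bullet> e) (at t)"
    by (rule has_derivative_imp_has_field_derivative) (simp add: mult.commute)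
  have "continuous_on UNIV G" using assms by (simp add: C1_grad_def)
  then show "continuous_on UNIV (\<lambda>t. G (y + t *\<^sub>R e) \<bullet> e)"
  proof (intro continuous_on_inner continuous_on_const)
    show "continuous_on UNIV (\<lambda>t. G (y + t *\<^sub>R e))"
      by (rule continuous_on_compose2[OF \<open>continuous_on UNIV G\<close>]) (auto intro!: continuous_intros)
  qed
qed

lemma C1_grad_continuous: "C1_grad \<psi> G \<Longrightarrow> continuous_on UNIV \<psi>"
  by (auto simp: C1_grad_def continuous_on_eq_continuous_at intro!: has_derivative_continuous)

lemma frontier_line_subset:
  fixes e :: "'a::real_normed_vector"
  shows "t \<in> frontier {t. y + t *\<^sub>R e \<in> V} \<Longrightarrow> y + t *\<^sub>R e \<in> frontier V"
proof -
  assume t: "t \<in> frontier {t. y + t *\<^sub>R e \<in> V}"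
  let ?f = "\<lambda>t. y + t *\<^sub>R e"
  have c: "continuous_on UNIV ?f" by (intro continuous_intros)
  have "t \<in> closure (?f -` V)" "t \<in> closure (?f -` (- V))"
    using t by (simp_all add: frontier_closures vimage_def Collect_neg_eq)
  moreover have "?f ` closure (?f -` A) \<subseteq> closure A" for A
    by (rule image_closure_subset) (use c closure_subset in \<open>auto intro: continuous_on_subset\<close>)
  ultimately have "?f t \<in> closure V" "?f t \<in> closure (- V)" by blast+
  then show ?thesis by (simp add: frontier_closures)
qed

lemma norm_line_squared:
  fixes e y :: "'a::real_inner"
  assumes e: "norm e = 1" and y: "y \<bullet> e = 0"
  shows "(norm (y + t *\<^sub>R e))\<^sup>2 = (norm y)\<^sup>2 + t\<^sup>2"
proof -
  have ee: "e \<bullet> e = 1" using e by (simp add: dot_square_norm)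
  have "(norm (y + t *\<^sub>R e))\<^sup>2 = y \<bullet> y + 2 * t * (y \<bullet> e) + t * t * (e \<bullet> e)"
    unfolding power2_norm_eq_inner inner_add_left inner_add_right inner_scaleR_left inner_scaleR_right
      inner_commute[of e y] by (simp only: algebra_simps)
  then show ?thesis unfolding y ee power2_norm_eq_inner[of y] power2_eq_square[of t] by simp
qed

lemma line_in_ball:
  fixes e y :: "'a::real_inner"
  assumes e: "norm e = 1" and y: "y \<bullet> e = 0" and yr: "norm y < r"
  shows "y + t *\<^sub>R e \<in> ball 0 r \<longleftrightarrow> t \<in> {- sqrt (r\<^sup>2 - (norm y)\<^sup>2) <..< sqrt (r\<^sup>2 - (norm y)\<^sup>2)}"
proof -
  have r: "r > 0" using yr norm_ge_zero[of y] by linarith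
  note sq = norm_line_squared[OF e y]
  have "norm z < r \<longleftrightarrow> (norm z)\<^sup>2 < r\<^sup>2" for z :: 'a
    using r power2_less_imp_less[of "norm z" r] power_strict_mono[of "norm z" r 2] by auto
  then have "y + t *\<^sub>R e \<in> ball 0 r \<longleftrightarrow> (norm (y + t *\<^sub>R e))\<^sup>2 < r\<^sup>2"
    by simp
  also have "\<dots> \<longleftrightarrow> t\<^sup>2 < r\<^sup>2 - (norm y)\<^sup>2" unfolding sq by linarith
  also have "\<dots> \<longleftrightarrow> \<bar>t\<bar> < sqrt (r\<^sup>2 - (norm y)\<^sup>2)"
    using real_less_rsqrt real_sqrt_less_iff by (metis real_sqrt_abs)
  finally show ?thesis by (auto simp: abs_less_iff)
qed

text \<open>A line meets the ball in a chord whose endpoints lie on the sphere, where \<psi>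
  vanishes; so the endpoint terms of the jump formula drop out. A line that misses the ball gives
  zero on both sides.\<close>

lemma line_crossings:
  fixes e y :: "'a::euclidean_space"
  assumes e: "norm e = 1" and y: "y \<in> perp e" and fin: "finite (hits e X y)"
    and V: "open V" "frontier V \<inter> ball 0 r \<subseteq> X"
    and \<psi>: "C1_grad \<psi> G" "\<And>x. x \<notin> ball 0 r \<Longrightarrow> \<psi> x = 0"
  shows "(\<integral>t. indicator (V \<inter> ball 0 r) (y + t *\<^sub>R e) * (G (y + t *\<^sub>R e) \<bullet> e) \<partial>lborel)
    = slice_sum e X (\<lambda>x. \<psi> x * (of_bool (on_side (- e) V x) - of_bool (on_side e V x))) y"
proof (cases "norm y < r")
  case True
  define \<rho> where "\<rho> = sqrt (r\<^sup>2 - (norm y)\<^sup>2)"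
  have "(norm y)\<^sup>2 < r\<^sup>2" using True by (intro power_strict_mono) auto
  then have \<rho>: "\<rho> > 0" by (simp add: \<rho>_def)
  have inball: "y + t *\<^sub>R e \<in> ball 0 r \<longleftrightarrow> t \<in> {-\<rho><..<\<rho>}" for t
    unfolding \<rho>_def by (rule line_in_ball[OF e _ True]) (use y in \<open>simp add: perp_def\<close>)
  define U where "U = {t. y + t *\<^sub>R e \<in> V}"
  have U: "open U"
    unfolding U_def using V(1) by (rule open_vimage[of V "\<lambda>t. y + t *\<^sub>R e", unfolded vimage_def]) (auto intro!: continuous_intros)
  have fr: "frontier U \<inter> {-\<rho><..<\<rho>} \<subseteq> hits e X y"
    using frontier_line_subset[of _ y e V] V(2) inball by (auto simp: U_def hits_def)
  have "(\<integral>t. indicator (V \<inter> ball 0 r) (y + t *\<^sub>R e) * (G (y + t *\<^sub>R e) \<bullet> e) \<partial>lborel)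
     = (\<integral>t. indicator (U \<inter> {-\<rho><..<\<rho>}) t * (G (y + t *\<^sub>R e) \<bullet> e) \<partial>lborel)"
    by (intro Bochner_Integration.integral_cong refl) (use inball in \<open>auto simp: indicator_def U_def\<close>)
  also have "\<dots> = \<psi> (y + \<rho> *\<^sub>R e) * of_bool (on_side (-1) U \<rho>) - \<psi> (y + (-\<rho>) *\<^sub>R e) * of_bool (on_side 1 U (-\<rho>))
      + (\<Sum>t\<in>hits e X y \<inter> {-\<rho><..<\<rho>}. \<psi> (y + t *\<^sub>R e) * (of_bool (on_side (-1) U t) - of_bool (on_side 1 U t)))"
    by (rule integral_jumps) (use \<rho> fin U fr C1_grad_line[OF \<psi>(1)] in auto)
  also have "\<psi> (y + \<rho> *\<^sub>R e) = 0" using \<psi>(2) inball[of \<rho>] by auto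
  also have "\<psi> (y + (-\<rho>) *\<^sub>R e) = 0" using \<psi>(2) inball[of "-\<rho>"] by auto
  also have "(\<Sum>t\<in>hits e X y \<inter> {-\<rho><..<\<rho>}. \<psi> (y + t *\<^sub>R e) * (of_bool (on_side (-1) U t) - of_bool (on_side 1 U t)))
     = (\<Sum>t\<in>hits e X y. \<psi> (y + t *\<^sub>R e) * (of_bool (on_side (-1) U t) - of_bool (on_side 1 U t)))"
    by (rule sum.mono_neutral_left) (use fin \<psi>(2) inball in auto)
  finally show ?thesis
    using fin by (simp add: slice_sum_def on_side_line U_def)
next
  case False
  have "y + t *\<^sub>R e \<notin> ball 0 r" for t
  proof -
    have "(norm (y + t *\<^sub>R e))\<^sup>2 = (norm y)\<^sup>2 + t\<^sup>2"
      using y by (intro norm_line_squared[OF e]) (simp add: perp_def)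
    then have "norm y \<le> norm (y + t *\<^sub>R e)" by (auto intro: power2_le_imp_le[OF _ norm_ge_zero])
    with False show ?thesis by simp
  qed
  then show ?thesis using \<psi>(2) by (simp add: slice_sum_def)
qed

text \<open>The divergence theorem for a field of constant direction \<open>e\<close>: the formula
  on single lines is integrated over all lines parallel to \<open>e\<close>. The volume side becomes
  Lebesgue measure by slicing, the crossing side becomes \<open>slice_meas\<close>.\<close>

lemma integral_crossings:
  fixes e :: "'a::euclidean_space"
  assumes e: "norm e = 1" and X: "compact X" "harea X < top"
    and V: "open V" "frontier V \<inter> ball 0 r \<subseteq> X"
    and \<psi>: "C1_grad \<psi> G" "\<And>x. x \<notin> ball 0 r \<Longrightarrow> \<psi> x = 0"
  shows "area_const TYPE('a) * (\<integral>x. indicator (V \<inter> ball 0 r) x * (G x \<bullet> e) \<partial>lborel)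
    = (\<integral>x. \<psi> x * (of_bool (on_side (- e) V x) - of_bool (on_side e V x)) \<partial>slice_meas e X)"
proof -
  have [measurable]: "V \<in> sets borel" "ball (0::'a) r \<in> sets borel" using V(1) by auto
  have contG: "continuous_on UNIV G" using \<psi>(1) by (simp add: C1_grad_def)
  have [measurable]: "G \<in> borel_measurable borel" using contG by (rule borel_measurable_continuous_onI)
  have [measurable]: "\<psi> \<in> borel_measurable borel"
    using C1_grad_continuous[OF \<psi>(1)] by (rule borel_measurable_continuous_onI)
  have m: "(\<lambda>x. of_bool (on_side e' V x) :: real) \<in> borel_measurable borel" for e'
  proof -
    have "(\<lambda>x. of_bool (on_side e' V x) :: real) = indicator {x. on_side e' V x}"
      by (auto simp: indicator_def)
    then show ?thesis using on_side_borel[OF V(1), of e'] by simp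
  qed
  obtain C where C: "\<And>x. \<bar>\<psi> x\<bar> \<le> C"
  proof -
    have "bounded (\<psi> ` cball 0 r)"
      using C1_grad_continuous[OF \<psi>(1)]
      by (intro compact_imp_bounded compact_continuous_image) (auto intro: continuous_on_subset)
    then obtain C where C: "\<forall>x\<in>cball 0 r. \<bar>\<psi> x\<bar> \<le> C" unfolding bounded_iff by auto
    have "\<bar>\<psi> x\<bar> \<le> max C 0" for x using C \<psi>(2)[of x] by (cases "x \<in> ball 0 r") (auto intro: le_max_iff_disj[THEN iffD2])
    then show ?thesis by (rule that)
  qed
  have "integrable lborel (\<lambda>x. indicator (V \<inter> ball 0 r) x * (G x \<bullet> e))"
  proof -
    have "set_integrable lborel (cball 0 r) (\<lambda>x. G x \<bullet> e)"
      unfolding set_integrable_def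
      by (rule borel_integrable_compact) (auto intro!: continuous_intros continuous_on_subset[OF contG])
    then have "set_integrable lborel (V \<inter> ball 0 r) (\<lambda>x. G x \<bullet> e)"
      by (rule set_integrable_subset) auto
    then show ?thesis by (simp add: set_integrable_def)
  qed
  from integral_slices[OF e this]
  have "area_const TYPE('a) * (\<integral>x. indicator (V \<inter> ball 0 r) x * (G x \<bullet> e) \<partial>lborel)
    = (\<integral>y. \<integral>t. indicator (V \<inter> ball 0 r) (y + t *\<^sub>R e) * (G (y + t *\<^sub>R e) \<bullet> e) \<partial>lborel \<partial>hperp e)" .
  also have "\<dots> = (\<integral>y. slice_sum e X (\<lambda>x. \<psi> x * (of_bool (on_side (- e) V x) - of_bool (on_side e V x))) y \<partial>hperp e)"
  proof (rule integral_cong_AE)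
    have "AE y in hperp e. y \<in> perp e"
      unfolding hperp_def by (subst AE_density) (auto simp: indicator_def)
    with AE_finite_hits[OF e X]
    show "AE y in hperp e. (\<integral>t. indicator (V \<inter> ball 0 r) (y + t *\<^sub>R e) * (G (y + t *\<^sub>R e) \<bullet> e) \<partial>lborel)
      = slice_sum e X (\<lambda>x. \<psi> x * (of_bool (on_side (- e) V x) - of_bool (on_side e V x))) y"
      by eventually_elim (rule line_crossings[OF e _ _ V \<psi>])
    show "(\<lambda>y. \<integral>t. indicator (V \<inter> ball 0 r) (y + t *\<^sub>R e) * (G (y + t *\<^sub>R e) \<bullet> e) \<partial>lborel) \<in> borel_measurable (hperp e)"
      by measurable
    show "slice_sum e X (\<lambda>x. \<psi> x * (of_bool (on_side (- e) V x) - of_bool (on_side e V x))) \<in> borel_measurable (hperp e)"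
      by (rule borel_measurable_integrable, rule slice_sum_integral(1)[OF e X, of _ C])
        (use m C in \<open>auto simp: abs_mult of_bool_def intro: order_trans[OF abs_ge_zero C]\<close>)
  qed
  also have "\<dots> = (\<integral>x. \<psi> x * (of_bool (on_side (- e) V x) - of_bool (on_side e V x)) \<partial>slice_meas e X)"
    by (rule slice_sum_integral(2)[OF e X, of _ C, symmetric])
        (use m C in \<open>auto simp: abs_mult of_bool_def intro: order_trans[OF abs_ge_zero C]\<close>)
  finally show ?thesis .
qed


section \<open>Test functions\<close>

definition C1_fun :: "('a::euclidean_space \<Rightarrow> real) \<Rightarrow> bool" where
  "C1_fun \<psi> \<longleftrightarrow> (\<exists>G. C1_grad \<psi> G)"

lemma C1_fun_continuous: "C1_fun f \<Longrightarrow> continuous_on UNIV f"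
  by (auto simp: C1_fun_def C1_grad_continuous)

lemma C1_fun_measurable: "C1_fun f \<Longrightarrow> f \<in> borel_measurable borel"
  by (simp add: C1_fun_continuous borel_measurable_continuous_onI)

lemma C1_fun_const: "C1_fun (\<lambda>x. c)"
proof -
  have "((\<bullet>) (0::'a)) = (\<lambda>_. 0)" by auto
  then show ?thesis unfolding C1_fun_def C1_grad_def by (intro exI[of _ "\<lambda>_. 0"]) auto
qed

lemma C1_fun_inner: "C1_fun (\<lambda>x. x \<bullet> b)"
  unfolding C1_fun_def C1_grad_def
  by (intro exI[of _ "\<lambda>_. b"]) (auto intro!: derivative_eq_intros simp: inner_commute)

lemma C1_fun_inner_self: "C1_fun (\<lambda>x. x \<bullet> x)"
  unfolding C1_fun_def C1_grad_def
  by (intro exI[of _ "\<lambda>x. 2 *\<^sub>R x"]) (auto intro!: derivative_eq_intros continuous_intros simp: inner_commute)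

lemma C1_fun_add: "C1_fun f \<Longrightarrow> C1_fun g \<Longrightarrow> C1_fun (\<lambda>x. f x + g x)"
proof -
  assume "C1_fun f" "C1_fun g"
  then obtain F G where "C1_grad f F" "C1_grad g G" by (auto simp: C1_fun_def)
  then have "C1_grad (\<lambda>x. f x + g x) (\<lambda>x. F x + G x)"
    unfolding C1_grad_def by (auto intro!: derivative_eq_intros continuous_intros simp: inner_add_left)
  then show ?thesis by (auto simp: C1_fun_def)
qed

lemma C1_fun_mult: "C1_fun f \<Longrightarrow> C1_fun g \<Longrightarrow> C1_fun (\<lambda>x. f x * g x)"
proof -
  assume fg: "C1_fun f" "C1_fun g"
  then obtain F G where FG: "C1_grad f F" "C1_grad g G" by (auto simp: C1_fun_def)
  have "C1_grad (\<lambda>x. f x * g x) (\<lambda>x. f x *\<^sub>R G x + g x *\<^sub>R F x)"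
    unfolding C1_grad_def
  proof (intro conjI allI)
    show "continuous_on UNIV (\<lambda>x. f x *\<^sub>R G x + g x *\<^sub>R F x)"
      using FG C1_fun_continuous[OF fg(1)] C1_fun_continuous[OF fg(2)]
      by (auto simp: C1_grad_def intro!: continuous_intros)
    fix x
    have "(f has_derivative (\<lambda>h. F x \<bullet> h)) (at x)" "(g has_derivative (\<lambda>h. G x \<bullet> h)) (at x)"
      using FG by (auto simp: C1_grad_def)
    from has_derivative_mult[OF this]
    show "((\<lambda>x. f x * g x) has_derivative (\<lambda>h. (f x *\<^sub>R G x + g x *\<^sub>R F x) \<bullet> h)) (at x)"
      by (simp add: inner_add_left mult.commute)
  qed
  then show ?thesis by (auto simp: C1_fun_def)
qed

lemma C1_fun_compose:
  assumes "C1_fun f" and \<beta>: "\<And>t. (\<beta> has_real_derivative \<beta>' t) (at t)" "continuous_on UNIV \<beta>'"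
  shows "C1_fun (\<lambda>x. \<beta> (f x))"
proof -
  obtain F where F: "C1_grad f F" using assms(1) by (auto simp: C1_fun_def)
  have "C1_grad (\<lambda>x. \<beta> (f x)) (\<lambda>x. \<beta>' (f x) *\<^sub>R F x)"
    unfolding C1_grad_def
  proof (intro conjI allI)
    have "continuous_on UNIV (\<lambda>x. \<beta>' (f x))"
      by (rule continuous_on_compose2[OF \<beta>(2) C1_fun_continuous[OF assms(1)]]) auto
    then show "continuous_on UNIV (\<lambda>x. \<beta>' (f x) *\<^sub>R F x)"
      using F by (auto simp: C1_grad_def intro!: continuous_intros)
    fix x
    have "(f has_derivative (\<lambda>h. F x \<bullet> h)) (at x)" using F by (auto simp: C1_grad_def)
    moreover have "(\<beta> has_derivative (\<lambda>h. \<beta>' (f x) * h)) (at (f x))"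
      using \<beta>(1)[of "f x"] by (simp add: has_field_derivative_def)
    ultimately have "((\<lambda>x. \<beta> (f x)) has_derivative (\<lambda>h. \<beta>' (f x) * (F x \<bullet> h))) (at x)"
      by (rule has_derivative_compose)
    then show "((\<lambda>x. \<beta> (f x)) has_derivative (\<lambda>h. (\<beta>' (f x) *\<^sub>R F x) \<bullet> h)) (at x)"
      by simp
  qed
  then show ?thesis by (auto simp: C1_fun_def)
qed

lemma C1_fun_divide:
  assumes f: "C1_fun f" and g: "C1_fun g" and pos: "\<And>x. g x > 0"
  shows "C1_fun (\<lambda>x. f x / g x)"
proof -
  obtain F G where FG: "C1_grad f F" "C1_grad g G" using f g by (auto simp: C1_fun_def)
  have "C1_grad (\<lambda>x. f x / g x) (\<lambda>x. (1 / g x) *\<^sub>R F x - (f x / (g x * g x)) *\<^sub>R G x)"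
    unfolding C1_grad_def
  proof (intro conjI allI)
    have nz: "g x \<noteq> 0" for x using pos[of x] by simp
    show "continuous_on UNIV (\<lambda>x. (1 / g x) *\<^sub>R F x - (f x / (g x * g x)) *\<^sub>R G x)"
      using FG C1_fun_continuous[OF f] C1_fun_continuous[OF g] nz
      by (auto simp: C1_grad_def intro!: continuous_intros)
    fix x
    have "(f has_derivative (\<lambda>h. F x \<bullet> h)) (at x)" "(g has_derivative (\<lambda>h. G x \<bullet> h)) (at x)"
      using FG by (auto simp: C1_grad_def)
    from has_derivative_divide'[OF this nz]
    show "((\<lambda>x. f x / g x) has_derivative (\<lambda>h. ((1 / g x) *\<^sub>R F x - (f x / (g x * g x)) *\<^sub>R G x) \<bullet> h)) (at x)"
      by (rule has_derivative_eq_rhs) (use nz[of x] in \<open>auto simp: fun_eq_iff inner_diff_left field_simps\<close>)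
  qed
  then show ?thesis by (auto simp: C1_fun_def)
qed

lemma C1_fun_prod:
  assumes "finite A" "\<And>i. i \<in> A \<Longrightarrow> C1_fun (f i)"
  shows "C1_fun (\<lambda>x. \<Prod>i\<in>A. f i x)"
  using assms by (induction A rule: finite_induct) (auto intro: C1_fun_const C1_fun_mult)

section \<open>Cutoffs built from the squared positive part, which is continuously
  differentiable\<close>

definition pos_sq :: "real \<Rightarrow> real" where
  "pos_sq s = (max 0 s)\<^sup>2"

lemma pos_sq_nonneg: "pos_sq s \<ge> 0"
  and pos_sq_pos_iff: "pos_sq s > 0 \<longleftrightarrow> s > 0"
  and pos_sq_zero: "s \<le> 0 \<Longrightarrow> pos_sq s = 0"
  by (auto simp: pos_sq_def max_def)

lemma pos_sq_deriv: "(pos_sq has_real_derivative 2 * max 0 t) (at t)"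
proof -
  consider "t > 0" | "t < 0" | "t = 0" by linarith
  then show ?thesis
  proof cases
    case 1
    have "((\<lambda>s. s\<^sup>2) has_real_derivative 2 * t) (at t)" by (auto intro!: derivative_eq_intros)
    then have "(pos_sq has_real_derivative 2 * t) (at t)"
      by (rule has_field_derivative_transform_within_open[of _ _ _ "{0<..}"]) (use 1 in \<open>auto simp: pos_sq_def\<close>)
    then show ?thesis using 1 by simp
  next
    case 2
    have "((\<lambda>s. 0) has_real_derivative 0) (at t)" by simp
    then have "(pos_sq has_real_derivative 0) (at t)"
      by (rule has_field_derivative_transform_within_open[of _ _ _ "{..<0}"]) (use 2 in \<open>auto simp: pos_sq_def\<close>)
    then show ?thesis using 2 by simp
  next
    case 3
    have "((\<lambda>h. (pos_sq (0 + h) - pos_sq 0) / h) \<longlongrightarrow> 0) (at 0)"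
    proof (rule Lim_null_comparison)
      show "\<forall>\<^sub>F h in at 0. norm ((pos_sq (0 + h) - pos_sq 0) / h) \<le> \<bar>h\<bar>"
        by (auto simp: pos_sq_def max_def power2_eq_square intro!: always_eventually)
      show "((\<lambda>h::real. \<bar>h\<bar>) \<longlongrightarrow> 0) (at 0)" by (auto intro!: tendsto_eq_intros)
    qed
    then show ?thesis using 3 by (simp add: DERIV_def)
  qed
qed

lemma C1_fun_pos_sq: "C1_fun f \<Longrightarrow> C1_fun (\<lambda>x. pos_sq (f x))"
  by (rule C1_fun_compose[OF _ pos_sq_deriv]) (auto intro!: continuous_intros)

text \<open>Written with a sum and a factor -1 so that the closure rules for sums and products of C1
  functions apply literally.\<close>

definition bump :: "real \<Rightarrow> 'a::euclidean_space \<Rightarrow> real" where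
  "bump r x = pos_sq (r\<^sup>2 + (-1) * (x \<bullet> x))"

lemma C1_fun_bump: "C1_fun (bump r)"
  unfolding bump_def[abs_def]
  by (intro C1_fun_pos_sq C1_fun_add C1_fun_mult C1_fun_const C1_fun_inner_self)

lemma bump_pos_iff:
  assumes "r > 0"
  shows "bump r x > 0 \<longleftrightarrow> x \<in> ball 0 r"
proof -
  have "x \<bullet> x < r\<^sup>2 \<longleftrightarrow> norm x < r"
    using assms power2_less_imp_less[of "norm x" r] power_strict_mono[of "norm x" r 2]
    by (auto simp: power2_norm_eq_inner)
  then show ?thesis by (auto simp: bump_def pos_sq_pos_iff)
qed

lemma bump_nonneg: "bump r x \<ge> 0"
  by (simp add: bump_def pos_sq_nonneg)

lemma bump_bounded: "bump r x \<le> (r\<^sup>2)\<^sup>2"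
  unfolding bump_def pos_sq_def by (intro power_mono) auto

text \<open>The denominator never vanishes: since R < r, every point lies inside the larger ball,
  where the first summand is positive, or outside the smaller one, where the second is.\<close>

definition plateau :: "real \<Rightarrow> real \<Rightarrow> 'a::euclidean_space \<Rightarrow> real" where
  "plateau R r x = bump r x / (bump r x + pos_sq (x \<bullet> x + (- R\<^sup>2)))"

lemma plateau:
  fixes x :: "'a::euclidean_space"
  assumes R: "0 < R" "R < r"
  shows "C1_fun (plateau R r :: 'a \<Rightarrow> real)" "0 \<le> plateau R r x" "plateau R r x \<le> 1"
    "norm x \<le> R \<Longrightarrow> plateau R r x = 1" "x \<notin> ball 0 r \<Longrightarrow> plateau R r x = 0"
proof -
  have pos: "bump r x + pos_sq (x \<bullet> x + (- R\<^sup>2)) > 0" for x :: 'a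
  proof (cases "norm x < r")
    case True
    then have "bump r x > 0" using R by (simp add: bump_pos_iff)
    then show ?thesis using pos_sq_nonneg add_pos_nonneg by blast
  next
    case False
    then have "R\<^sup>2 < (norm x)\<^sup>2" using R by (intro power_strict_mono) auto
    then have "pos_sq (x \<bullet> x + (- R\<^sup>2)) > 0" by (simp add: pos_sq_pos_iff power2_norm_eq_inner)
    then show ?thesis using bump_nonneg add_nonneg_pos by blast
  qed
  show "C1_fun (plateau R r :: 'a \<Rightarrow> real)"
    unfolding plateau_def[abs_def]
    by (intro C1_fun_divide C1_fun_bump C1_fun_add C1_fun_pos_sq C1_fun_inner_self C1_fun_const pos)
  show "0 \<le> plateau R r x" unfolding plateau_def using pos[of x] bump_nonneg[of r x] by simp
  show "plateau R r x \<le> 1" unfolding plateau_def using pos[of x] pos_sq_nonneg by simp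
  show "plateau R r x = 1" if "norm x \<le> R"
  proof -
    have "(norm x)\<^sup>2 \<le> R\<^sup>2" using that by (intro power_mono) auto
    then have "pos_sq (x \<bullet> x + (- R\<^sup>2)) = 0" by (intro pos_sq_zero) (simp add: power2_norm_eq_inner)
    then show ?thesis using pos[of x] by (simp add: plateau_def)
  qed
  show "plateau R r x = 0" if "x \<notin> ball 0 r"
    using that bump_pos_iff[of r x] bump_nonneg[of r x] R by (simp add: plateau_def)
qed

text \<open>A differentiable substitute for the indicator of the positive half-line, to which it
  converges pointwise as \<open>k\<close> grows.\<close>

definition soft_step :: "real \<Rightarrow> real \<Rightarrow> real" where
  "soft_step k s = k * pos_sq s / (1 + k * pos_sq s)"

lemma soft_step_bounds: "k \<ge> 0 \<Longrightarrow> 0 \<le> soft_step k s" "k \<ge> 0 \<Longrightarrow> soft_step k s \<le> 1"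
proof -
  assume "k \<ge> 0"
  then have "k * pos_sq s \<ge> 0" using pos_sq_nonneg by simp
  then show "0 \<le> soft_step k s" "soft_step k s \<le> 1" by (simp_all add: soft_step_def)
qed

lemma soft_step_limit: "(\<lambda>n. soft_step (real n) s) \<longlonglongrightarrow> of_bool (s > 0)"
proof (cases "s > 0")
  case True
  define c where "c = pos_sq s"
  have c: "c > 0" using True by (simp add: c_def pos_sq_pos_iff)
  have "(\<lambda>n. 1 - 1 / (1 + real n * c)) \<longlonglongrightarrow> 1 - 0"
  proof (intro tendsto_diff tendsto_const)
    have "filterlim (\<lambda>n. real n * c) at_top sequentially"
      using c by (intro filterlim_at_top_mult_tendsto_pos[OF tendsto_const _ filterlim_real_sequentially]
          | (subst mult.commute, rule filterlim_tendsto_pos_mult_at_top[OF tendsto_const _ filterlim_real_sequentially]))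
    then have "filterlim (\<lambda>n. 1 + real n * c) at_top sequentially"
      by (rule filterlim_tendsto_add_at_top[OF tendsto_const])
    then show "(\<lambda>n. 1 / (1 + real n * c)) \<longlonglongrightarrow> 0"
      by (intro tendsto_divide_0[OF tendsto_const] filterlim_at_top_imp_at_infinity)
  qed
  moreover have "soft_step (real n) s = 1 - 1 / (1 + real n * c)" for n
  proof -
    have "1 + real n * c > 0" using c by (simp add: add_pos_nonneg)
    then show ?thesis by (simp add: soft_step_def c_def field_simps)
  qed
  ultimately show ?thesis using True by simp
qed (simp add: soft_step_def pos_sq_zero)

lemma C1_fun_soft_step: "k \<ge> 0 \<Longrightarrow> C1_fun f \<Longrightarrow> C1_fun (\<lambda>x. soft_step k (f x))"
  unfolding soft_step_def
  by (intro C1_fun_divide C1_fun_mult C1_fun_add C1_fun_const C1_fun_pos_sq)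
    (auto intro!: add_pos_nonneg mult_nonneg_nonneg pos_sq_nonneg)

text \<open>Products of soft steps approximate indicators of boxes, and boxes generate the Borel
  sets. Test functions are confined to the ball because the frontiers of the regions are controlled
  only there.\<close>

lemma C1_test_functions_separate:
  fixes q :: "'a::euclidean_space \<Rightarrow> real"
  assumes "finite_measure \<nu>" and sets[measurable_cong]: "sets \<nu> = sets borel" and r: "r > 0"
    and q[measurable]: "q \<in> borel_measurable borel" "\<And>x. \<bar>q x\<bar> \<le> C"
    and zero: "\<And>\<psi>. C1_fun \<psi> \<Longrightarrow> (\<And>x. x \<notin> ball 0 r \<Longrightarrow> \<psi> x = 0) \<Longrightarrow> (\<integral>x. \<psi> x * q x \<partial>\<nu>) = 0"
  shows "AE x in \<nu>. x \<in> ball 0 r \<longrightarrow> q x = 0"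
proof -
  interpret finite_measure \<nu> by fact
  have bump[measurable]: "bump r \<in> borel_measurable borel" by (rule C1_fun_measurable[OF C1_fun_bump])
  have bumpz: "x \<notin> ball 0 r \<Longrightarrow> bump r x = 0" for x :: 'a
    using bump_pos_iff[OF r, of x] bump_nonneg[of r x] by auto
  \<comment> \<open>The bump factor makes every C1 function an admissible test function against
    \<open>p\<close>, and being positive on the ball it hides no value of \<open>q\<close>
    there.\<close>
  define p where "p x = bump r x * q x" for x
  have [measurable]: "p \<in> borel_measurable borel" unfolding p_def[abs_def] by simp
  have C: "C \<ge> 0" using q(2)[of undefined] by linarith
  have pb: "\<bar>p x\<bar> \<le> (r\<^sup>2)\<^sup>2 * C" for x
    unfolding p_def abs_mult using q(2)[of x] bump_bounded[of r x] bump_nonneg[of r x]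
    by (intro mult_mono) auto
  have pint: "integrable \<nu> p"
    by (rule integrable_const_bound[of _ "(r\<^sup>2)\<^sup>2 * C"]) (use pb in auto)
  have all: "(\<integral>x. p x \<partial>\<nu>) = 0"
    unfolding p_def by (rule zero[OF C1_fun_bump bumpz])
  have box: "(\<integral>x\<in>box a b. p x \<partial>\<nu>) = 0" for a b
  proof -
    \<comment> \<open>One rising and one falling soft step per coordinate; their product tends to
      the indicator of the open box and stays between 0 and 1, so dominated convergence
      applies.\<close>
    define s where "s n x = (\<Prod>i\<in>Basis. soft_step (real n) (x \<bullet> i + (- (a \<bullet> i))) * soft_step (real n) (b \<bullet> i + (-1) * (x \<bullet> i)))" for n and x :: 'a
    have C1s: "C1_fun (s n)" for n
      unfolding s_def[abs_def]
      by (intro C1_fun_prod C1_fun_mult C1_fun_soft_step C1_fun_add C1_fun_inner C1_fun_const) auto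
    have s01: "0 \<le> s n x" "s n x \<le> 1" for n x
      unfolding s_def by (auto intro!: prod_nonneg prod_le_1 mult_nonneg_nonneg mult_le_one simp: soft_step_bounds)
    have lim: "(\<lambda>n. s n x) \<longlonglongrightarrow> indicator (box a b) x" for x
    proof -
      have "(\<lambda>n. s n x) \<longlonglongrightarrow> (\<Prod>i\<in>Basis. of_bool (x \<bullet> i + (- (a \<bullet> i)) > 0) * of_bool (b \<bullet> i + (-1) * (x \<bullet> i) > 0))"
        unfolding s_def by (intro tendsto_prod tendsto_mult soft_step_limit)
      also have "(\<Prod>i\<in>Basis. of_bool (x \<bullet> i + (- (a \<bullet> i)) > 0) * of_bool (b \<bullet> i + (-1) * (x \<bullet> i) > 0)) = (indicator (box a b) x :: real)"
      proof (cases "x \<in> box a b")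
        case False
        then obtain i where "i \<in> Basis" "\<not> (a \<bullet> i < x \<bullet> i \<and> x \<bullet> i < b \<bullet> i)" by (auto simp: mem_box)
        then have "(\<Prod>i\<in>Basis. of_bool (x \<bullet> i + (- (a \<bullet> i)) > 0) * of_bool (b \<bullet> i + (-1) * (x \<bullet> i) > 0)) = (0::real)"
          by (intro prod_zero) (auto intro!: bexI[of _ i])
        with False show ?thesis by simp
      qed (auto simp: mem_box intro!: prod.neutral)
      finally show ?thesis .
    qed
    have "(\<lambda>n. \<integral>x. s n x * p x \<partial>\<nu>) \<longlonglongrightarrow> (\<integral>x. indicator (box a b) x * p x \<partial>\<nu>)"
    proof (rule integral_dominated_convergence[where w = "\<lambda>x. \<bar>p x\<bar>"])
      show "integrable \<nu> (\<lambda>x. \<bar>p x\<bar>)" using pint by simp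
      show "AE x in \<nu>. (\<lambda>n. s n x * p x) \<longlonglongrightarrow> indicator (box a b) x * p x"
        by (intro always_eventually allI tendsto_mult lim tendsto_const)
      show "AE x in \<nu>. norm (s n x * p x) \<le> \<bar>p x\<bar>" for n
        using s01 by (intro always_eventually allI) (auto simp: abs_mult intro: mult_left_le_one_le)
      have [measurable]: "s n \<in> borel_measurable borel" for n by (rule C1_fun_measurable[OF C1s])
      show "(\<lambda>x. s n x * p x) \<in> borel_measurable \<nu>" for n by measurable
    qed measurable
    moreover have "(\<integral>x. s n x * p x \<partial>\<nu>) = 0" for n
    proof -
      have "(\<integral>x. (s n x * bump r x) * q x \<partial>\<nu>) = 0"
        by (rule zero) (auto intro: C1_fun_mult C1s C1_fun_bump simp: bumpz[unfolded mem_ball_0])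
      then show ?thesis by (simp add: p_def mult.assoc)
    qed
    ultimately have "(\<integral>x. indicator (box a b) x * p x \<partial>\<nu>) = 0"
      by (simp add: LIMSEQ_const_iff)
    then show ?thesis by (simp add: set_lebesgue_integral_def)
  qed
  have sint: "set_integrable \<nu> A p" if "A \<in> sets borel" for A
    using integrable_mult_indicator[OF _ pint, of A] that by (simp add: set_integrable_def sets)
  have borel: "(\<integral>x\<in>A. p x \<partial>\<nu>) = 0" if "A \<in> sets borel" for A
  proof -
    let ?G = "range (\<lambda>(a, b). box a b :: 'a set)"
    have "Int_stable ?G"
      by (auto simp: Int_stable_def box_Int_box)
    moreover have "?G \<subseteq> Pow UNIV" by auto
    moreover have "A \<in> sigma_sets UNIV ?G" using that by (simp add: borel_eq_box sets_measure_of)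
    moreover have sig: "sigma_sets UNIV ?G = sets (borel :: 'a measure)"
      by (simp add: borel_eq_box sets_measure_of)
    ultimately show ?thesis unfolding sig[symmetric]
    proof (induction A rule: sigma_sets_induct_disjoint)
      case (basic A)
      then show ?case using box by auto
    next
      case (compl A)
      then have A: "A \<in> sets borel" using sig by simp
      have "(\<integral>x\<in>UNIV - A. p x \<partial>\<nu>) = (\<integral>x. p x - indicator A x * p x \<partial>\<nu>)"
        unfolding set_lebesgue_integral_def by (intro Bochner_Integration.integral_cong) (auto simp: indicator_def)
      also have "\<dots> = (\<integral>x. p x \<partial>\<nu>) - (\<integral>x\<in>A. p x \<partial>\<nu>)"
        using sint[OF A] pint unfolding set_integrable_def set_lebesgue_integral_def by simp
      finally show ?case using compl all by simp
    next
      case (union A)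
      have A: "A i \<in> sets borel" for i using union sig by auto
      have "(\<integral>x\<in>(\<Union>i. A i). p x \<partial>\<nu>) = (\<Sum>i. \<integral>x\<in>A i. p x \<partial>\<nu>)"
        by (rule lebesgue_integral_countable_add)
          (use A sint union(1) in \<open>auto simp: sets disjoint_family_on_def\<close>)
      then show ?case using union by simp
    qed (simp add: set_lebesgue_integral_def)
  qed
  have "AE x in \<nu>. p x = 0"
    by (rule density_unique_real[OF pint]) (use borel in \<open>auto simp: sets set_lebesgue_integral_def\<close>)
  then show ?thesis
    by eventually_elim (use bump_pos_iff[OF r] in \<open>force simp: p_def\<close>)
qed


section \<open>Flux densities\<close>

text \<open>A Radon-Nikodym derivative of a dominated measure exceeds 1 only on a null set.
  Truncating it there makes the bounds hold at every point, so that later estimates do not carry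
  another exceptional set.\<close>

lemma bounded_density:
  assumes "finite_measure \<nu>" and sets: "sets \<mu> = sets \<nu>"
    and le: "\<And>B. B \<in> sets \<nu> \<Longrightarrow> emeasure \<mu> B \<le> emeasure \<nu> B"
  shows "\<exists>\<theta>::'a \<Rightarrow> real. \<theta> \<in> borel_measurable \<nu> \<and> (\<forall>x. 0 \<le> \<theta> x \<and> \<theta> x \<le> 1) \<and> \<mu> = density \<nu> (\<lambda>x. ennreal (\<theta> x))"
proof -
  interpret finite_measure \<nu> by fact
  have "absolutely_continuous \<nu> \<mu>"
    unfolding absolutely_continuous_def null_sets_def using sets le by (auto, metis le_zero_eq)
  then obtain f where f[measurable]: "f \<in> borel_measurable \<nu>" and df: "density \<nu> f = \<mu>"
    using Radon_Nikodym sets by metis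
  \<comment> \<open>Integrating \<open>f - 1\<close> over \<open>A\<close> gives the \<mu>-measure
    of \<open>A\<close> minus its \<nu>-measure, which is 0 in \<open>ennreal\<close> by domination;
    hence \<open>A\<close> is null.\<close>
  define A where "A = {x \<in> space \<nu>. f x > 1}"
  have A[measurable]: "A \<in> sets \<nu>" unfolding A_def by simp
  have "(\<integral>\<^sup>+x. (f x - 1) * indicator A x \<partial>\<nu>) = (\<integral>\<^sup>+x. f x * indicator A x - indicator A x \<partial>\<nu>)"
    by (rule nn_integral_cong) (auto simp: indicator_def)
  also have "\<dots> = (\<integral>\<^sup>+x. f x * indicator A x \<partial>\<nu>) - (\<integral>\<^sup>+x. indicator A x \<partial>\<nu>)"
  proof (rule nn_integral_diff)
    show "(\<integral>\<^sup>+x. indicator A x \<partial>\<nu>) \<noteq> \<infinity>"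
      unfolding nn_integral_indicator[OF A] using emeasure_finite[of A] by simp
  qed (auto simp: A_def indicator_def less_imp_le)
  also have "(\<integral>\<^sup>+x. f x * indicator A x \<partial>\<nu>) = emeasure \<mu> A"
    by (simp add: df[symmetric] emeasure_density)
  also have "emeasure \<mu> A - (\<integral>\<^sup>+x. indicator A x \<partial>\<nu>) = 0"
    using le[OF A] emeasure_finite[of A] by (auto simp: diff_eq_0_iff_ennreal less_top[symmetric] top_unique)
  finally have "AE x in \<nu>. (f x - 1) * indicator A x = 0"
    by (subst (asm) nn_integral_0_iff_AE) auto
  then have AEf: "AE x in \<nu>. f x \<le> 1"
  proof (rule AE_mp, intro AE_I2 impI)
    fix x assume x: "x \<in> space \<nu>" "(f x - 1) * indicator A x = 0"
    show "f x \<le> 1"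
    proof (rule ccontr)
      assume "\<not> f x \<le> 1"
      then have "x \<in> A" "1 < f x" using x by (auto simp: A_def not_le)
      with x(2) show False by (auto simp: diff_eq_0_iff_ennreal)
    qed
  qed
  define \<theta> where "\<theta> x = enn2real (min 1 (f x))" for x
  have fin: "min 1 (f x) < top" for x by (auto simp: min_less_iff_disj)
  have \<theta>: "ennreal (\<theta> x) = min 1 (f x)" for x
    unfolding \<theta>_def using fin by (simp add: ennreal_enn2real)
  have "\<theta> x \<le> 1" for x
  proof -
    have "ennreal (\<theta> x) \<le> ennreal 1" unfolding \<theta> by simp
    then show ?thesis by (simp add: ennreal_le_iff)
  qed
  moreover have "\<theta> x \<ge> 0" for x by (simp add: \<theta>_def)
  moreover have [measurable]: "\<theta> \<in> borel_measurable \<nu>" unfolding \<theta>_def[abs_def] by measurable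
  moreover have "\<mu> = density \<nu> (\<lambda>x. ennreal (\<theta> x))"
    unfolding df[symmetric]
    by (rule density_cong) (use AEf in \<open>auto simp: \<theta> min_def elim!: eventually_mono\<close>)
  ultimately show ?thesis by blast
qed

text \<open>Countably many directions share one exceptional null set, while density up to positive
  multiples still detects every open condition on a direction.\<close>

lemma exists_dense_directions:
  "\<exists>D :: 'a::euclidean_space set. countable D \<and> (\<forall>e\<in>D. norm e = 1) \<and>
    (\<forall>U. open U \<and> U \<noteq> {} \<and> 0 \<notin> U \<longrightarrow> (\<exists>e\<in>D. \<exists>c>0. c *\<^sub>R e \<in> U))"
proof -
  obtain D0 :: "'a set" where D0: "countable D0" "\<And>U. open U \<Longrightarrow> U \<noteq> {} \<Longrightarrow> \<exists>d\<in>D0. d \<in> U"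
    using countable_dense_setE by blast
  define D where "D = (\<lambda>d. d /\<^sub>R norm d) ` (D0 - {0})"
  have "\<exists>e\<in>D. \<exists>c>0. c *\<^sub>R e \<in> U" if U: "open U" "U \<noteq> {}" "0 \<notin> U" for U
  proof -
    obtain d where d: "d \<in> D0" "d \<in> U" using D0(2)[OF U(1,2)] by blast
    with U have "d \<noteq> 0" by auto
    then show ?thesis
      using d by (intro bexI[of _ "d /\<^sub>R norm d"] exI[of _ "norm d"]) (auto simp: D_def)
  qed
  moreover have "countable D" "\<forall>e\<in>D. norm e = 1" unfolding D_def using D0(1) by auto
  ultimately show ?thesis by blast
qed

text \<open>A direction in \<open>D\<close> avoiding the hyperplanes orthogonal to the nonzero \<open>F k\<close> sees all of them at
  once, so there are at most two.\<close>

lemma two_jumps: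
  fixes F :: "'i \<Rightarrow> 'a::euclidean_space"
  assumes I: "finite I" "I \<noteq> {}"
    and D: "\<And>e. e \<in> D \<Longrightarrow> norm e = 1"
      "\<And>U. open U \<Longrightarrow> U \<noteq> {} \<Longrightarrow> 0 \<notin> U \<Longrightarrow> \<exists>e\<in>D. \<exists>c>0. c *\<^sub>R e \<in> U"
    and F: "\<And>e. e \<in> D \<Longrightarrow> \<exists>i\<in>I. \<exists>j\<in>I. \<exists>\<theta>. 0 \<le> \<theta> \<and> \<theta> \<le> (1::real) \<and>
        (\<forall>k\<in>I. F k \<bullet> e = \<theta> * (of_bool (k = i) - of_bool (k = j)))"
  shows "\<exists>i\<in>I. \<exists>j\<in>I. F i = - F j \<and> norm (F i) \<le> 1 \<and> (\<forall>k\<in>I - {i, j}. F k = 0)"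
proof (cases "\<forall>k\<in>I. F k = 0")
  case True
  then show ?thesis using I(2) by fastforce
next
  case False
  define N where "N = {k\<in>I. F k \<noteq> 0}"
  have N: "finite N" "N \<noteq> {}" "N \<subseteq> I" using False I by (auto simp: N_def)
  \<comment> \<open>The complement of finitely many hyperplanes, nonempty because hyperplanes are
    negligible.\<close>
  define U where "U = (\<Inter>k\<in>N. {x. F k \<bullet> x \<noteq> 0})"
  have U: "open U" unfolding U_def
    using N by (intro open_INT) (auto intro!: open_Collect_neq continuous_intros)
  have "U \<noteq> {}"
  proof
    assume "U = {}"
    then have "(\<Union>k\<in>N. {x. F k \<bullet> x = 0}) = UNIV" unfolding U_def by auto
    moreover have "negligible (\<Union>k\<in>N. {x. F k \<bullet> x = 0})"
      using N by (intro negligible_Union finite_imageI) (auto simp: N_def intro!: negligible_hyperplane)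
    ultimately show False by (simp add: non_negligible_UNIV)
  qed
  moreover have "0 \<notin> U" using N by (auto simp: U_def)
  ultimately obtain e c where e: "e \<in> D" "c > 0" "c *\<^sub>R e \<in> U" using D(2)[OF U] by blast
  have ek: "F k \<bullet> e \<noteq> 0" if "k \<in> N" for k using e that by (auto simp: U_def)
  obtain i j \<theta> where ij: "i \<in> I" "j \<in> I" "\<And>k. k \<in> I \<Longrightarrow> F k \<bullet> e = \<theta> * (of_bool (k = i) - of_bool (k = j))"
    using F[OF e(1)] by blast
  have Nij: "k = i \<or> k = j" if "k \<in> N" for k
    using ek[OF that] ij(3)[of k] that N by auto
  have "i \<noteq> j"
  proof
    assume "i = j"
    obtain k where "k \<in> N" using N by auto
    then show False using ek[of k] ij(3)[of k] \<open>i = j\<close> N by auto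
  qed
  have zero: "F k = 0" if "k \<in> I - {i, j}" for k
    using that Nij by (auto simp: N_def)
  \<comment> \<open>Summed over all \<open>k\<close> the two truth values cancel for every
    direction, and only \<open>i\<close> and \<open>j\<close> contribute. So
    \<open>F i + F j\<close> is orthogonal to a dense set of directions.\<close>
  have sum0: "(F i + F j) \<bullet> d = 0" if d: "d \<in> D" for d
  proof -
    obtain i' j' \<theta>' where ij': "i' \<in> I" "j' \<in> I" "\<And>k. k \<in> I \<Longrightarrow> F k \<bullet> d = \<theta>' * (of_bool (k = i') - of_bool (k = j'))"
      using F[OF d] by blast
    have "(\<Sum>k\<in>I. F k \<bullet> d) = (\<Sum>k\<in>I. \<theta>' * (of_bool (k = i') - of_bool (k = j')))"
      by (rule sum.cong) (use ij' in auto)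
    also have "\<dots> = 0"
      using I ij' by (simp add: sum_distrib_left[symmetric] sum_subtractf of_bool_def)
    finally have "(\<Sum>k\<in>I. F k \<bullet> d) = 0" .
    moreover have "(\<Sum>k\<in>I. F k \<bullet> d) = (\<Sum>k\<in>{i, j}. F k \<bullet> d)"
      by (rule sum.mono_neutral_right) (use I ij zero in auto)
    ultimately show ?thesis using \<open>i \<noteq> j\<close> by (simp add: inner_add_left)
  qed
  have "F i + F j = 0"
  proof (rule ccontr)
    assume nz: "F i + F j \<noteq> 0"
    have "open {x. (F i + F j) \<bullet> x > 0}" by (intro open_Collect_less continuous_intros)
    moreover have "F i + F j \<in> {x. (F i + F j) \<bullet> x > 0}" using nz by simp
    moreover have "0 \<notin> {x. (F i + F j) \<bullet> x > 0}" by simp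
    ultimately obtain d c where "d \<in> D" "c > 0" "c *\<^sub>R d \<in> {x. (F i + F j) \<bullet> x > 0}"
      using D(2)[of "{x. (F i + F j) \<bullet> x > 0}"] by blast
    then show False using sum0[of d] by simp
  qed
  then have neg: "F i = - F j" by (simp add: eq_neg_iff_add_eq_0)
  have "norm (F i) \<le> 1"
  proof (rule ccontr)
    assume big: "\<not> norm (F i) \<le> 1"
    \<comment> \<open>If \<open>F i\<close> were longer than 1, its own direction would lie in this
      open cone. Some direction of \<open>D\<close> would then see a component above 1, against
      \<theta> \<le> 1.\<close>
    let ?U = "{x. F i \<bullet> x > norm x}"
    have "open ?U" by (intro open_Collect_less continuous_intros)
    moreover have "F i \<in> ?U"
    proof -
      have "norm (F i) * 1 < norm (F i) * norm (F i)" using big by (intro mult_strict_left_mono) auto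
      then show ?thesis by (simp add: power2_norm_eq_inner[symmetric] power2_eq_square)
    qed
    moreover have "0 \<notin> ?U" by simp
    ultimately obtain d c where d: "d \<in> D" "c > 0" "c *\<^sub>R d \<in> ?U" using D(2)[of ?U] by blast
    have "F i \<bullet> d > 1" using d D(1)[OF d(1)] by simp
    moreover obtain i' j' \<theta>' where "i' \<in> I" "j' \<in> I" "0 \<le> \<theta>'" "\<theta>' \<le> 1"
      "\<And>k. k \<in> I \<Longrightarrow> F k \<bullet> d = \<theta>' * (of_bool (k = i') - of_bool (k = j'))"
      using F[OF d(1)] by blast
    ultimately show False using ij(1) by (auto simp: of_bool_def split: if_splits)
  qed
  then show ?thesis using ij(1,2) neg zero by blast
qed

text \<open>A partition of the complement of \<open>S\<close> into finitely many open regions, which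
  may be disconnected or empty. Area is controlled only in the ball of radius \<open>r\<close>, so
  all conclusions concern points of that ball.\<close>

locale regions =
  fixes S :: "'a::euclidean_space set" and I :: "nat set" and V :: "nat \<Rightarrow> 'a set" and r :: real
  assumes closed_S: "closed S" and finite_I: "finite I"
    and open_V: "\<And>i. i \<in> I \<Longrightarrow> open (V i)"
    and disjoint_V: "\<And>i j. i \<in> I \<Longrightarrow> j \<in> I \<Longrightarrow> i \<noteq> j \<Longrightarrow> V i \<inter> V j = {}"
    and cover_V: "(\<Union>i\<in>I. V i) = - S" and I_nonempty: "I \<noteq> {}"
    and r_pos: "r > 0" and finite_area: "harea (S \<inter> cball 0 r) < top"
begin

definition X :: "'a set" where "X = S \<inter> cball 0 r"

definition \<nu> :: "'a measure" where "\<nu> = density area (indicator X)"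

lemma compact_X: "compact X"
  unfolding X_def by (rule closed_Int_compact[OF closed_S]) simp

lemma X_borel [measurable]: "X \<in> sets borel"
  using compact_X by (rule borel_compact)

lemma finite_area_X: "harea X < top"
  using finite_area by (simp add: X_def)

lemma sets_\<nu> [measurable_cong, simp]: "sets \<nu> = sets borel"
  and space_\<nu> [simp]: "space \<nu> = UNIV"
  by (simp_all add: \<nu>_def)

lemma emeasure_\<nu>: "B \<in> sets borel \<Longrightarrow> emeasure \<nu> B = harea (X \<inter> B)"
  unfolding \<nu>_def
  by (subst emeasure_density) (auto simp: indicator_inter_arith[symmetric] simp flip: emeasure_area)

lemma finite_measure_\<nu>: "finite_measure \<nu>"
  using finite_area_X by (intro finite_measureI) (auto simp: emeasure_\<nu>)

lemma frontier_V: "i \<in> I \<Longrightarrow> frontier (V i) \<inter> ball 0 r \<subseteq> X"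
proof
  fix x assume i: "i \<in> I" and x: "x \<in> frontier (V i) \<inter> ball 0 r"
  have "x \<in> S"
  proof (rule ccontr)
    assume "x \<notin> S"
    then obtain j where j: "j \<in> I" "x \<in> V j" using cover_V by blast
    have "x \<notin> V i" using x open_V[OF i] by (simp add: frontier_def interior_open)
    then have "i \<noteq> j" using j by auto
    then have "V j \<inter> closure (V i) = {}"
      using open_Int_closure_eq_empty[OF open_V[OF j(1)]] disjoint_V[OF j(1) i] by auto
    then show False using x j by (auto simp: frontier_def)
  qed
  then show "x \<in> X" using x by (auto simp: X_def)
qed

text \<open>The density of the crossing measure with respect to area on \<open>S\<close>. If
  \<open>S\<close> were smooth it would be the absolute value of the cosine between \<open>e\<close>
  and the normal; it carries no sign, which is supplied by \<open>jump\<close>.\<close>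

definition \<theta> :: "'a \<Rightarrow> 'a \<Rightarrow> real" where
  "\<theta> e = (SOME \<theta>. \<theta> \<in> borel_measurable borel \<and> (\<forall>x. 0 \<le> \<theta> x \<and> \<theta> x \<le> 1) \<and>
     slice_meas e X = density \<nu> (\<lambda>x. ennreal (\<theta> x)))"

lemma \<theta>:
  assumes e: "norm e = 1"
  shows "\<theta> e \<in> borel_measurable borel" "0 \<le> \<theta> e x" "\<theta> e x \<le> 1"
    "slice_meas e X = density \<nu> (\<lambda>x. ennreal (\<theta> e x))"
proof -
  have "\<exists>\<theta>. \<theta> \<in> borel_measurable borel \<and> (\<forall>x. 0 \<le> \<theta> x \<and> \<theta> x \<le> (1::real)) \<and>
     slice_meas e X = density \<nu> (\<lambda>x. ennreal (\<theta> x))"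
    using bounded_density[OF finite_measure_\<nu>, of "slice_meas e X"]
      emeasure_slice_meas_le[OF e compact_X finite_area_X]
    by (simp add: emeasure_\<nu> cong: measurable_cong_sets)
  from someI_ex[OF this]
  show "\<theta> e \<in> borel_measurable borel" "0 \<le> \<theta> e x" "\<theta> e x \<le> 1"
    "slice_meas e X = density \<nu> (\<lambda>x. ennreal (\<theta> e x))"
    by (auto simp: \<theta>_def[symmetric])
qed

definition jump :: "'a \<Rightarrow> nat \<Rightarrow> 'a \<Rightarrow> real" where
  "jump e i x = of_bool (on_side e (V i) x) - of_bool (on_side (- e) (V i) x)"

lemma jump_measurable [measurable]: "i \<in> I \<Longrightarrow> jump e i \<in> borel_measurable borel"
proof -
  assume i: "i \<in> I"
  have "jump e i = (\<lambda>x. indicator {x. on_side e (V i) x} x - indicator {x. on_side (- e) (V i) x} x)"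
    by (auto simp: jump_def indicator_def)
  then show ?thesis using on_side_borel[OF open_V[OF i]] by simp
qed

lemma abs_jump_le: "\<bar>jump e i x\<bar> \<le> 1"
  by (auto simp: jump_def)

text \<open>\<open>f i\<close> times \<open>\<nu>\<close> is a multiple of the distributional gradient of the indicator of \<open>V i\<close>.\<close>

definition f :: "nat \<Rightarrow> 'a \<Rightarrow> 'a" where
  "f i x = (\<Sum>b\<in>Basis. (\<theta> b x * jump b i x) *\<^sub>R b)"

lemma f_inner_Basis: "b \<in> Basis \<Longrightarrow> f i x \<bullet> b = \<theta> b x * jump b i x"
  unfolding f_def by (simp add: inner_sum_left inner_Basis if_distrib sum.delta cong: if_cong)

lemma f_measurable [measurable]: "i \<in> I \<Longrightarrow> f i \<in> borel_measurable borel"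
  unfolding f_def[abs_def] using \<theta>(1)[OF norm_Basis] by measurable

lemma f_outside_closure:
  assumes "x \<notin> closure (V i)"
  shows "f i x = 0"
proof -
  have "jump b i x = 0" for b
    using assms by (auto simp: jump_def dest: on_side_in_closure)
  then show ?thesis by (simp add: f_def)
qed

text \<open>The minus sign arises because \<open>jump\<close> is positive where the line enters the
  region, whereas the crossing formula counts exits positively.\<close>

lemma integral_jump:
  assumes e: "norm e = 1" and i: "i \<in> I"
    and \<psi>: "C1_grad \<psi> G" "\<And>x. x \<notin> ball 0 r \<Longrightarrow> \<psi> x = 0"
  shows "area_const TYPE('a) * (\<integral>x. indicator (V i \<inter> ball 0 r) x * (G x \<bullet> e) \<partial>lborel)
    = - (\<integral>x. \<psi> x * (\<theta> e x * jump e i x) \<partial>\<nu>)"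
proof -
  have [measurable]: "\<psi> \<in> borel_measurable borel"
    using C1_grad_continuous[OF \<psi>(1)] by (rule borel_measurable_continuous_onI)
  note [measurable] = \<theta>(1)[OF e] jump_measurable[OF i]
  have "area_const TYPE('a) * (\<integral>x. indicator (V i \<inter> ball 0 r) x * (G x \<bullet> e) \<partial>lborel)
    = (\<integral>x. \<psi> x * (of_bool (on_side (- e) (V i) x) - of_bool (on_side e (V i) x)) \<partial>slice_meas e X)"
    by (rule integral_crossings[OF e compact_X finite_area_X open_V[OF i] frontier_V[OF i] \<psi>])
  also have "\<dots> = (\<integral>x. \<psi> x * (- jump e i x) \<partial>slice_meas e X)"
    by (simp add: jump_def)
  also have "\<dots> = (\<integral>x. \<theta> e x * (\<psi> x * (- jump e i x)) \<partial>\<nu>)"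
    unfolding \<theta>(4)[OF e] by (subst integral_density) (auto simp: \<theta>(2)[OF e])
  also have "\<dots> = - (\<integral>x. \<psi> x * (\<theta> e x * jump e i x) \<partial>\<nu>)"
    by (subst Bochner_Integration.integral_minus[symmetric]) (simp add: algebra_simps)
  finally show ?thesis .
qed

lemma integrable_bounded_\<nu>:
  "g \<in> borel_measurable borel \<Longrightarrow> (\<And>x. \<bar>g x\<bar> \<le> C) \<Longrightarrow> integrable \<nu> (g :: 'a \<Rightarrow> real)"
  by (rule finite_measure.integrable_const_bound[OF finite_measure_\<nu>, of _ C]) auto

lemma C1_test_bounded:
  assumes "C1_fun \<psi>" "\<And>x. x \<notin> ball 0 r \<Longrightarrow> \<psi> x = 0"
  obtains C where "\<And>x. \<bar>\<psi> (x::'a)\<bar> \<le> C"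
proof -
  have "bounded (\<psi> ` cball 0 r)"
    using C1_fun_continuous[OF assms(1)]
    by (intro compact_imp_bounded compact_continuous_image) (auto intro: continuous_on_subset)
  then obtain C where C: "\<forall>x\<in>cball 0 r. \<bar>\<psi> x\<bar> \<le> C" unfolding bounded_iff by auto
  have "\<bar>\<psi> x\<bar> \<le> max C 0" for x
    using C assms(2)[of x] by (cases "x \<in> ball 0 r") (auto intro: le_max_iff_disj[THEN iffD2])
  then show ?thesis by (rule that)
qed

lemma abs_\<theta>_jump_le: "norm e = 1 \<Longrightarrow> \<bar>\<theta> e x * jump e i x\<bar> \<le> 1"
  using \<theta>(2,3)[of e x] abs_jump_le[of e i x] by (auto simp: abs_mult intro: mult_le_one)

text \<open>The vector \<open>f i x\<close> is assembled from basis directions. It represents every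
  direction because the volume side of the crossing formula is linear in \<open>e\<close> with one
  constant for all directions, so both sides of the claim have the same integral against each test
  function.\<close>

lemma AE_f_inner:
  assumes e: "norm e = 1" and i: "i \<in> I"
  shows "AE x in \<nu>. x \<in> ball 0 r \<longrightarrow> f i x \<bullet> e = \<theta> e x * jump e i x"
proof -
  note [measurable] = \<theta>(1)[OF e] jump_measurable[OF i] f_measurable[OF i]
  define q where "q x = f i x \<bullet> e - \<theta> e x * jump e i x" for x
  have fe: "f i x \<bullet> e = (\<Sum>b\<in>Basis. (e \<bullet> b) * (\<theta> b x * jump b i x))" for x
    by (simp add: euclidean_inner[of "f i x" e] f_inner_Basis mult.commute)
  have "AE x in \<nu>. x \<in> ball 0 r \<longrightarrow> q x = 0"
  proof (rule C1_test_functions_separate[OF finite_measure_\<nu> sets_\<nu> r_pos])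
    show "q \<in> borel_measurable borel" unfolding q_def[abs_def] by measurable
    show "\<bar>q x\<bar> \<le> real DIM('a) + 1" for x
    proof -
      have "\<bar>f i x \<bullet> e\<bar> \<le> (\<Sum>b\<in>(Basis::'a set). 1)"
        unfolding fe
      proof (rule order_trans[OF sum_abs sum_mono])
        fix b :: 'a assume b: "b \<in> Basis"
        have "\<bar>e \<bullet> b\<bar> \<le> 1" using Basis_le_norm[OF b, of e] e by simp
        then show "\<bar>e \<bullet> b * (\<theta> b x * jump b i x)\<bar> \<le> 1"
          using abs_\<theta>_jump_le[OF norm_Basis[OF b], of x i] by (simp add: abs_mult mult_le_one)
      qed
      then show ?thesis unfolding q_def using abs_\<theta>_jump_le[OF e, of x i] by simp
    qed
    fix \<psi> :: "'a \<Rightarrow> real"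
    assume \<psi>: "C1_fun \<psi>" "\<And>x. x \<notin> ball 0 r \<Longrightarrow> \<psi> x = 0"
    then obtain G where G: "C1_grad \<psi> G" by (auto simp: C1_fun_def)
    obtain C where C: "\<And>x. \<bar>\<psi> x\<bar> \<le> C" using C1_test_bounded[OF \<psi>] by blast
    have [measurable]: "\<psi> \<in> borel_measurable borel" using C1_fun_measurable[OF \<psi>(1)] .
    have contG: "continuous_on UNIV G" using G by (simp add: C1_grad_def)
    have [measurable]: "V i \<in> sets borel" using open_V[OF i] by simp
    have int: "integrable \<nu> (\<lambda>x. \<psi> x * (\<theta> e' x * jump e' i x))" if e': "norm e' = 1" for e'
    proof (rule integrable_bounded_\<nu>[of _ C])
      show "(\<lambda>x. \<psi> x * (\<theta> e' x * jump e' i x)) \<in> borel_measurable borel"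
        using \<theta>(1)[OF e'] by measurable
      show "\<bar>\<psi> x * (\<theta> e' x * jump e' i x)\<bar> \<le> C" for x
        using mult_mono[OF C[of x] abs_\<theta>_jump_le[OF e', of x i]] C[of x]
        by (simp add: abs_mult)
    qed
    have intG: "integrable lborel (\<lambda>x. indicator (V i \<inter> ball 0 r) x * (G x \<bullet> v))" for v
    proof -
      have "set_integrable lborel (cball 0 r) (\<lambda>x. G x \<bullet> v)"
        unfolding set_integrable_def
        by (rule borel_integrable_compact) (auto intro!: continuous_intros continuous_on_subset[OF contG])
      then have "set_integrable lborel (V i \<inter> ball 0 r) (\<lambda>x. G x \<bullet> v)"
        by (rule set_integrable_subset) auto
      then show ?thesis by (simp add: set_integrable_def)
    qed
    have "(\<integral>x. \<psi> x * q x \<partial>\<nu>) = (\<integral>x. (\<Sum>b\<in>Basis. (e \<bullet> b) * (\<psi> x * (\<theta> b x * jump b i x))) - \<psi> x * (\<theta> e x * jump e i x) \<partial>\<nu>)"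
      unfolding q_def fe by (simp add: algebra_simps sum_distrib_left)
    also have "\<dots> = (\<Sum>b\<in>Basis. (e \<bullet> b) * (\<integral>x. \<psi> x * (\<theta> b x * jump b i x) \<partial>\<nu>)) - (\<integral>x. \<psi> x * (\<theta> e x * jump e i x) \<partial>\<nu>)"
      using int e by (subst Bochner_Integration.integral_diff) (auto simp: Bochner_Integration.integral_sum)
    also have "\<dots> = - area_const TYPE('a) * ((\<Sum>b\<in>Basis. (e \<bullet> b) * (\<integral>x. indicator (V i \<inter> ball 0 r) x * (G x \<bullet> b) \<partial>lborel))
        - (\<integral>x. indicator (V i \<inter> ball 0 r) x * (G x \<bullet> e) \<partial>lborel))"
    proof -
      have *: "(\<integral>x. \<psi> x * (\<theta> e' x * jump e' i x) \<partial>\<nu>)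
          = - area_const TYPE('a) * (\<integral>x. indicator (V i \<inter> ball 0 r) x * (G x \<bullet> e') \<partial>lborel)"
        if "norm e' = 1" for e'
        using integral_jump[OF that i G \<psi>(2)] by simp
      have "(\<Sum>b\<in>Basis. (e \<bullet> b) * (\<integral>x. \<psi> x * (\<theta> b x * jump b i x) \<partial>\<nu>))
        = (\<Sum>b\<in>Basis. - area_const TYPE('a) * ((e \<bullet> b) * (\<integral>x. indicator (V i \<inter> ball 0 r) x * (G x \<bullet> b) \<partial>lborel)))"
        by (rule sum.cong) (simp_all add: *)
      then show ?thesis by (simp only: *[OF e] sum_distrib_left[symmetric] right_diff_distrib)
    qed
    also have "(\<Sum>b\<in>Basis. (e \<bullet> b) * (\<integral>x. indicator (V i \<inter> ball 0 r) x * (G x \<bullet> b) \<partial>lborel))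
       = (\<integral>x. indicator (V i \<inter> ball 0 r) x * (G x \<bullet> e) \<partial>lborel)"
    proof -
      have "(\<integral>x. indicator (V i \<inter> ball 0 r) x * (G x \<bullet> e) \<partial>lborel)
        = (\<integral>x. (\<Sum>b\<in>Basis. (e \<bullet> b) * (indicator (V i \<inter> ball 0 r) x * (G x \<bullet> b))) \<partial>lborel)"
        by (subst euclidean_inner) (simp add: sum_distrib_left mult_ac)
      also have "\<dots> = (\<Sum>b\<in>Basis. (e \<bullet> b) * (\<integral>x. indicator (V i \<inter> ball 0 r) x * (G x \<bullet> b) \<partial>lborel))"
        using intG by (subst Bochner_Integration.integral_sum) auto
      finally show ?thesis by simp
    qed
    finally show "(\<integral>x. \<psi> x * q x \<partial>\<nu>) = 0" by simp
  qed
  then show ?thesis by eventually_elim (simp add: q_def)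
qed

section \<open>The regions on the two sides of a crossing\<close>

lemma connected_in_region:
  assumes C: "connected C" "C \<inter> S = {}" "C \<noteq> {}"
  shows "\<exists>i\<in>I. C \<subseteq> V i"
proof -
  obtain z where z: "z \<in> C" using C by blast
  then obtain i where i: "i \<in> I" "z \<in> V i" using C cover_V by blast
  let ?W = "\<Union>j\<in>I - {i}. V j"
  have "C \<subseteq> V i \<union> ?W" using C(2) cover_V by blast
  moreover have "V i \<inter> ?W \<inter> C = {}" using disjoint_V i by blast
  moreover have "open ?W" using open_V by blast
  ultimately have "V i \<inter> C = {} \<or> ?W \<inter> C = {}"
    using connectedD[OF C(1) open_V[OF i(1)]] by blast
  then have "?W \<inter> C = {}" using z i by blast
  then have "C \<subseteq> V i" using \<open>C \<subseteq> V i \<union> ?W\<close> by blast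
  then show ?thesis using i by blast
qed

text \<open>Between one hit and the next, and while it stays in the ball where \<open>X\<close> and
  \<open>S\<close> agree, the line is a connected set avoiding \<open>S\<close> and so runs in a
  single region.\<close>

lemma on_side_exists:
  assumes T: "finite (hits e X y)" and t: "y + t *\<^sub>R e \<in> ball 0 r"
  shows "\<exists>i\<in>I. on_side e (V i) (y + t *\<^sub>R e)"
proof -
  obtain d where d: "d > t" "{t<..<d} \<inter> hits e X y = {}" using finite_gap_right[OF T] by blast
  have "open ((\<lambda>s. y + s *\<^sub>R e) -` ball 0 r)"
    by (intro open_vimage open_ball continuous_intros)
  then obtain \<delta> where \<delta>: "\<delta> > 0" "ball t \<delta> \<subseteq> (\<lambda>s. y + s *\<^sub>R e) -` ball 0 r"
    using t open_contains_ball by (metis vimage_eq)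
  define d' where "d' = min d (t + \<delta>)"
  have d': "t < d'" using d \<delta> by (simp add: d'_def)
  let ?C = "(\<lambda>s. y + s *\<^sub>R e) ` {t<..<d'}"
  have "?C \<inter> S = {}"
  proof (rule equals0I)
    fix z assume "z \<in> ?C \<inter> S"
    then obtain s where s: "t < s" "s < d'" "z = y + s *\<^sub>R e" "z \<in> S" by auto
    have "s \<in> ball t \<delta>" using s by (auto simp: d'_def dist_real_def)
    then have "z \<in> X" using \<delta> s by (auto simp: X_def)
    then have "s \<in> {t<..<d} \<inter> hits e X y" using s by (auto simp: hits_def d'_def)
    with d show False by auto
  qed
  moreover have "connected ?C"
    by (intro connected_continuous_image continuous_intros connected_Ioo)
  moreover have "?C \<noteq> {}" using d' by auto
  ultimately obtain i where i: "i \<in> I" "?C \<subseteq> V i" using connected_in_region by blast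
  have "on_side e (V i) (y + t *\<^sub>R e)"
    unfolding on_side_def
  proof (intro exI[of _ "d' - t"] conjI allI impI)
    fix s assume "0 < s \<and> s < d' - t"
    then have "y + (t + s) *\<^sub>R e \<in> ?C" by auto
    then show "y + t *\<^sub>R e + s *\<^sub>R e \<in> V i" using i(2) by (auto simp: algebra_simps)
  qed (use d' in simp)
  with i show ?thesis by blast
qed

lemma hits_uminus: "hits (- e) X y = uminus ` hits e X y"
proof -
  have "t \<in> uminus ` hits e X y" if "t \<in> hits (- e) X y" for t
    using that by (intro image_eqI[of _ _ "- t"]) (auto simp: hits_def)
  then show ?thesis by (auto simp: hits_def)
qed

definition both_sides :: "'a \<Rightarrow> 'a \<Rightarrow> bool" where
  "both_sides e x \<longleftrightarrow> (\<exists>i\<in>I. on_side e (V i) x) \<and> (\<exists>i\<in>I. on_side (- e) (V i) x)"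

lemma both_sides_on_line:
  assumes T: "finite (hits e X y)" and t: "y + t *\<^sub>R e \<in> ball 0 r"
  shows "both_sides e (y + t *\<^sub>R e)"
  unfolding both_sides_def
  using on_side_exists[OF T t] on_side_exists[of "- e" y "- t"] T t by (simp add: hits_uminus)

lemma both_sides_borel [measurable]: "{x. both_sides e x} \<in> sets borel"
proof -
  have "{x. both_sides e x} = (\<Union>i\<in>I. {x. on_side e (V i) x}) \<inter> (\<Union>i\<in>I. {x. on_side (- e) (V i) x})"
    by (auto simp: both_sides_def)
  then show ?thesis using on_side_borel open_V finite_I by auto
qed

text \<open>On a line with finitely many hits every hit in the ball has a region on either side; the
  remaining lines count as zero in the crossing measure. So points without two sides have crossing
  measure zero, and the density vanishes at almost all of them.\<close>

lemma AE_both_sides: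
  assumes e: "norm e = 1"
  shows "AE x in \<nu>. x \<in> ball 0 r \<longrightarrow> \<theta> e x = 0 \<or> both_sides e x"
proof -
  note [measurable] = \<theta>(1)[OF e]
  define B where "B = ball 0 r - {x. both_sides e x}"
  have B[measurable]: "B \<in> sets borel" unfolding B_def by simp
  have "slice_sum e X (indicator B) y = (0::ennreal)" for y
    using both_sides_on_line[of e y] by (auto simp: slice_sum_def B_def indicator_def intro!: sum.neutral)
  then have "emeasure (slice_meas e X) B = 0"
    by (simp add: emeasure_slice_meas[OF e compact_X])
  then have "(\<integral>\<^sup>+x. ennreal (\<theta> e x) * indicator B x \<partial>\<nu>) = 0"
    unfolding \<theta>(4)[OF e] by (simp add: emeasure_density)
  then have "AE x in \<nu>. ennreal (\<theta> e x) * indicator B x = 0"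
    by (subst (asm) nn_integral_0_iff_AE) auto
  then show ?thesis
    by eventually_elim (use \<theta>(2)[OF e] in \<open>auto simp: B_def indicator_def ennreal_eq_0_iff intro: antisym\<close>)
qed

lemma jump_eq:
  assumes i: "i \<in> I" "on_side e (V i) x" and j: "j \<in> I" "on_side (- e) (V j) x" and k: "k \<in> I"
  shows "jump e k x = of_bool (k = i) - of_bool (k = j)"
  using on_side_unique[OF i(2), of "V k"] on_side_unique[OF j(2), of "V k"]
    disjoint_V[OF i(1) k] disjoint_V[OF j(1) k] i j
  by (auto simp: jump_def)

text \<open>Where the density in some direction vanishes, all components in that direction are zero,
  and the pattern required by \<open>two_jumps\<close> holds with equal indices.\<close>

lemma AE_two_jumps:
  "AE x in \<nu>. x \<in> ball 0 r \<longrightarrow>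
    (\<exists>i\<in>I. \<exists>j\<in>I. f i x = - f j x \<and> norm (f i x) \<le> 1 \<and> (\<forall>k\<in>I - {i, j}. f k x = 0))"
proof -
  obtain D :: "'a set" where D: "countable D" "\<And>e. e \<in> D \<Longrightarrow> norm e = 1"
    "\<And>U. open U \<Longrightarrow> U \<noteq> {} \<Longrightarrow> 0 \<notin> U \<Longrightarrow> \<exists>e\<in>D. \<exists>c>0. c *\<^sub>R e \<in> U"
    using exists_dense_directions by metis
  have "AE x in \<nu>. \<forall>e\<in>D. x \<in> ball 0 r \<longrightarrow> \<theta> e x = 0 \<or> both_sides e x"
    using D AE_both_sides by (subst AE_ball_countable) auto
  moreover have "AE x in \<nu>. \<forall>e\<in>D. \<forall>i\<in>I. x \<in> ball 0 r \<longrightarrow> f i x \<bullet> e = \<theta> e x * jump e i x"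
    unfolding AE_ball_countable[OF D(1)]
    by (intro ballI AE_finite_allI[OF finite_I] AE_f_inner D(2))
  ultimately show ?thesis
  proof eventually_elim
    case (elim x)
    show ?case
    proof (intro impI two_jumps[of I D "\<lambda>i. f i x", OF finite_I I_nonempty D(2,3)])
      fix e assume x: "x \<in> ball 0 r" and e: "e \<in> D"
      show "\<exists>i\<in>I. \<exists>j\<in>I. \<exists>\<theta>. 0 \<le> \<theta> \<and> \<theta> \<le> (1::real) \<and>
        (\<forall>k\<in>I. f k x \<bullet> e = \<theta> * (of_bool (k = i) - of_bool (k = j)))"
      proof (cases "\<theta> e x = 0")
        case True
        obtain i where "i \<in> I" using I_nonempty by blast
        then show ?thesis using elim x e True by (intro bexI[of _ i] exI[of _ 0]) auto
      next
        case False
        then have "both_sides e x" using elim x e by blast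
        then obtain i j where ij: "i \<in> I" "on_side e (V i) x" "j \<in> I" "on_side (- e) (V j) x"
          unfolding both_sides_def by blast
        then have "\<forall>k\<in>I. f k x \<bullet> e = \<theta> e x * (of_bool (k = i) - of_bool (k = j))"
          using elim x e jump_eq[OF ij] by simp
        then show ?thesis using \<theta>(2,3)[OF D(2)[OF e]] ij by blast
      qed
    qed auto
  qed
qed

text \<open>A line in direction \<open>e\<close> meets \<open>perp e\<close> only at its base point,
  so on this hyperplane the crossing measure equals the area of \<open>S\<close>. A density bounded
  by 1 with full integral is 1 almost everywhere.\<close>

lemma AE_\<theta>_perp:
  assumes e: "norm e = 1"
  shows "AE x in \<nu>. x \<in> perp e \<longrightarrow> \<theta> e x = 1"
proof -
  note [measurable] = \<theta>(1)[OF e]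
  define B where "B = perp e \<inter> X"
  have B[measurable]: "B \<in> sets borel" unfolding B_def by simp
  have ee: "e \<bullet> e = 1" using e by (simp add: dot_square_norm)
  have "emeasure \<nu> B = emeasure (hperp e) B"
    unfolding emeasure_\<nu>[OF B] emeasure_hperp[OF B] by (simp add: B_def Int_ac)
  also have "\<dots> = (\<integral>\<^sup>+y. indicator B y \<partial>hperp e)" by simp
  also have "\<dots> = (\<integral>\<^sup>+y. slice_sum e X (indicator B) y \<partial>hperp e)"
  proof (rule nn_integral_cong_AE)
    have "AE y in hperp e. y \<in> perp e"
      unfolding hperp_def by (subst AE_density) (auto simp: indicator_def)
    with AE_finite_hits[OF e compact_X finite_area_X]
    show "AE y in hperp e. indicator B y = (slice_sum e X (indicator B) y :: ennreal)"
    proof eventually_elim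
      case (elim y)
      have "hits e (X \<inter> B) y = (if y \<in> B then {0} else {})"
        using elim(2) by (auto simp: hits_def B_def perp_def inner_add_left ee)
      then show ?case using elim by (simp add: slice_sum_indicator)
    qed
  qed
  also have "\<dots> = emeasure (slice_meas e X) B" by (simp add: emeasure_slice_meas[OF e compact_X])
  also have "\<dots> = (\<integral>\<^sup>+x. ennreal (\<theta> e x) * indicator B x \<partial>\<nu>)"
    unfolding \<theta>(4)[OF e] by (simp add: emeasure_density)
  finally have eq: "emeasure \<nu> B = (\<integral>\<^sup>+x. ennreal (\<theta> e x) * indicator B x \<partial>\<nu>)" .
  have le: "ennreal (\<theta> e x) * indicator B x \<le> indicator B x" for x
    using \<theta>(3)[OF e, of x] by (auto simp: indicator_def ennreal_le_1)
  interpret finite_measure \<nu> by (rule finite_measure_\<nu>)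
  have "(\<integral>\<^sup>+x. indicator B x - ennreal (\<theta> e x) * indicator B x \<partial>\<nu>)
      = (\<integral>\<^sup>+x. indicator B x \<partial>\<nu>) - (\<integral>\<^sup>+x. ennreal (\<theta> e x) * indicator B x \<partial>\<nu>)"
    by (rule nn_integral_diff) (use le eq in \<open>auto simp flip: eq\<close>)
  also have "\<dots> = 0" by (simp flip: eq)
  finally have "AE x in \<nu>. indicator B x - ennreal (\<theta> e x) * indicator B x = 0"
    by (subst (asm) nn_integral_0_iff_AE) auto
  moreover have "AE x in \<nu>. x \<in> X"
    unfolding \<nu>_def by (subst AE_density) (auto simp: indicator_def)
  ultimately show ?thesis
  proof eventually_elim
    case (elim x)
    show ?case
    proof
      assume "x \<in> perp e"
      with elim have "1 - ennreal (\<theta> e x) = 0" by (simp add: B_def)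
      then have "ennreal 1 \<le> ennreal (\<theta> e x)" by (simp add: diff_eq_0_iff_ennreal)
      then have "1 \<le> \<theta> e x" using \<theta>(2)[OF e, of x] by (simp add: ennreal_le_iff)
      then show "\<theta> e x = 1" using \<theta>(3)[OF e, of x] by simp
    qed
  qed
qed

text \<open>Where \<open>S\<close> lies in the hyperplane \<open>perp e\<close>, the component of
  \<open>f i x\<close> along \<open>e\<close> is 1 while its norm is at most 1, which forces
  \<open>f i x = e\<close>. The opposite region is the only partner left.\<close>

lemma AE_flat:
  assumes e: "norm e = 1"
  shows "AE x in \<nu>. x \<in> ball 0 r \<inter> perp e \<longrightarrow> both_sides e x \<and>
    (\<forall>i\<in>I. \<forall>j\<in>I. i \<noteq> j \<longrightarrow> on_side e (V i) x \<longrightarrow> on_side (- e) (V j) x \<longrightarrow>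
      f i x = e \<and> f j x = - e \<and> (\<forall>k\<in>I - {i, j}. f k x = 0))"
proof -
  have "AE x in \<nu>. \<forall>i\<in>I. x \<in> ball 0 r \<longrightarrow> f i x \<bullet> e = \<theta> e x * jump e i x"
    using AE_f_inner[OF e] finite_I by (intro AE_finite_allI) auto
  with AE_\<theta>_perp[OF e] AE_both_sides[OF e] AE_two_jumps show ?thesis
  proof eventually_elim
    case (elim x)
    show ?case
    proof (intro impI conjI ballI)
      assume x: "x \<in> ball 0 r \<inter> perp e"
      then have \<theta>1: "\<theta> e x = 1" using elim by blast
      then show "both_sides e x" using elim x by auto
      fix i j assume ij: "i \<in> I" "j \<in> I" "i \<noteq> j" "on_side e (V i) x" "on_side (- e) (V j) x"
      have fk: "f k x \<bullet> e = of_bool (k = i) - of_bool (k = j)" if "k \<in> I" for k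
        using elim x that \<theta>1 jump_eq[OF ij(1,4,2,5) that] by simp
      then have fi: "f i x \<bullet> e = 1" and fj: "f j x \<bullet> e = - 1" using ij by auto
      obtain i' j' where ij': "i' \<in> I" "j' \<in> I" "f i' x = - f j' x" "norm (f i' x) \<le> 1"
        "\<And>k. k \<in> I - {i', j'} \<Longrightarrow> f k x = 0" using elim x by blast
      have "f i x \<noteq> 0" "f j x \<noteq> 0" using fi fj by auto
      then have "i \<in> {i', j'}" "j \<in> {i', j'}" using ij'(5) ij(1,2) by blast+
      then have same: "{i, j} = {i', j'}" and neg: "f i x = - f j x" and n1: "norm (f i x) \<le> 1"
        using ij(3) ij'(3,4) by auto
      have "(norm (f i x - e))\<^sup>2 = (norm (f i x))\<^sup>2 - 2 * (f i x \<bullet> e) + (norm e)\<^sup>2"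
        by (simp add: power2_norm_eq_inner inner_diff_left inner_diff_right inner_commute)
      also have "\<dots> \<le> 0" using n1 e fi by (simp add: power_le_one)
      finally have "f i x = e" by simp
      then show "f i x = e" "f j x = - e" using neg by (simp, metis minus_minus)
      show "f k x = 0" if "k \<in> I - {i, j}" for k using that ij'(5) same by auto
    qed
  qed
qed

text \<open>The divergence theorem for the field that equals \<open>w i\<close> on region i,
  localised by \<psi>: expand each \<open>w i\<close> in the basis and add the crossing
  formulas.\<close>

lemma integral_divergence:
  assumes \<psi>: "C1_grad \<psi> G" "\<And>x. x \<notin> ball 0 r \<Longrightarrow> \<psi> x = 0"
  shows "area_const TYPE('a) * (\<Sum>i\<in>I. \<integral>x. indicator (V i \<inter> ball 0 r) x * (G x \<bullet> w i) \<partial>lborel)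
    = - (\<integral>x. \<psi> x * (\<Sum>i\<in>I. w i \<bullet> f i x) \<partial>\<nu>)"
proof -
  have C1: "C1_fun \<psi>" using \<psi> by (auto simp: C1_fun_def)
  obtain C where C: "\<And>x. \<bar>\<psi> x\<bar> \<le> C" using C1_test_bounded[OF C1 \<psi>(2)] by blast
  have [measurable]: "\<psi> \<in> borel_measurable borel" using C1_fun_measurable[OF C1] .
  have contG: "continuous_on UNIV G" using \<psi> by (simp add: C1_grad_def)
  have int: "integrable \<nu> (\<lambda>x. \<psi> x * (\<theta> b x * jump b i x))" if b: "b \<in> Basis" and i: "i \<in> I" for b i
  proof (rule integrable_bounded_\<nu>[of _ C])
    show "(\<lambda>x. \<psi> x * (\<theta> b x * jump b i x)) \<in> borel_measurable borel"
      using \<theta>(1)[OF norm_Basis[OF b]] jump_measurable[OF i] by measurable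
    show "\<bar>\<psi> x * (\<theta> b x * jump b i x)\<bar> \<le> C" for x
      using mult_mono[OF C[of x] abs_\<theta>_jump_le[OF norm_Basis[OF b], of x i]] C[of x]
      by (simp add: abs_mult)
  qed
  have intG: "integrable lborel (\<lambda>x. indicator (V i \<inter> ball 0 r) x * (G x \<bullet> v))" if "i \<in> I" for v i
  proof -
    have "set_integrable lborel (cball 0 r) (\<lambda>x. G x \<bullet> v)"
      unfolding set_integrable_def
      by (rule borel_integrable_compact) (auto intro!: continuous_intros continuous_on_subset[OF contG])
    then have "set_integrable lborel (V i \<inter> ball 0 r) (\<lambda>x. G x \<bullet> v)"
      by (rule set_integrable_subset) (use open_V[OF that] in auto)
    then show ?thesis by (simp add: set_integrable_def)
  qed
  have one: "area_const TYPE('a) * (\<integral>x. indicator (V i \<inter> ball 0 r) x * (G x \<bullet> w i) \<partial>lborel)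
      = - (\<integral>x. \<psi> x * (w i \<bullet> f i x) \<partial>\<nu>)" and intf: "integrable \<nu> (\<lambda>x. \<psi> x * (w i \<bullet> f i x))"
    if i: "i \<in> I" for i
  proof -
    have wf: "\<psi> x * (w i \<bullet> f i x) = (\<Sum>b\<in>Basis. (w i \<bullet> b) * (\<psi> x * (\<theta> b x * jump b i x)))" for x
      by (subst euclidean_inner) (simp add: f_inner_Basis sum_distrib_left mult_ac)
    show "integrable \<nu> (\<lambda>x. \<psi> x * (w i \<bullet> f i x))"
      unfolding wf by (intro Bochner_Integration.integrable_sum integrable_mult_right int i)
    have "(\<integral>x. indicator (V i \<inter> ball 0 r) x * (G x \<bullet> w i) \<partial>lborel)
        = (\<integral>x. (\<Sum>b\<in>Basis. (w i \<bullet> b) * (indicator (V i \<inter> ball 0 r) x * (G x \<bullet> b))) \<partial>lborel)"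
      by (subst euclidean_inner) (simp add: sum_distrib_left mult_ac)
    also have "\<dots> = (\<Sum>b\<in>Basis. (w i \<bullet> b) * (\<integral>x. indicator (V i \<inter> ball 0 r) x * (G x \<bullet> b) \<partial>lborel))"
      using intG[OF i] by (subst Bochner_Integration.integral_sum) auto
    finally have "area_const TYPE('a) * (\<integral>x. indicator (V i \<inter> ball 0 r) x * (G x \<bullet> w i) \<partial>lborel)
       = (\<Sum>b\<in>Basis. (w i \<bullet> b) * (area_const TYPE('a) * (\<integral>x. indicator (V i \<inter> ball 0 r) x * (G x \<bullet> b) \<partial>lborel)))"
      by (simp add: sum_distrib_left mult_ac)
    also have "\<dots> = (\<Sum>b\<in>Basis. (w i \<bullet> b) * (- (\<integral>x. \<psi> x * (\<theta> b x * jump b i x) \<partial>\<nu>)))"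
      by (intro sum.cong refl arg_cong2[where f = "(*)"] integral_jump[OF norm_Basis i \<psi>])
    also have "\<dots> = - (\<integral>x. \<psi> x * (w i \<bullet> f i x) \<partial>\<nu>)"
      unfolding wf using int[OF _ i] by (subst Bochner_Integration.integral_sum) (auto simp: sum_negf)
    finally show "area_const TYPE('a) * (\<integral>x. indicator (V i \<inter> ball 0 r) x * (G x \<bullet> w i) \<partial>lborel)
      = - (\<integral>x. \<psi> x * (w i \<bullet> f i x) \<partial>\<nu>)" .
  qed
  have "area_const TYPE('a) * (\<Sum>i\<in>I. \<integral>x. indicator (V i \<inter> ball 0 r) x * (G x \<bullet> w i) \<partial>lborel)
    = (\<Sum>i\<in>I. - (\<integral>x. \<psi> x * (w i \<bullet> f i x) \<partial>\<nu>))"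
    unfolding sum_distrib_left by (rule sum.cong) (simp_all add: one)
  also have "\<dots> = - (\<integral>x. \<psi> x * (\<Sum>i\<in>I. w i \<bullet> f i x) \<partial>\<nu>)"
    unfolding sum_distrib_left using intf by (subst Bochner_Integration.integral_sum) (auto simp: sum_negf)
  finally show ?thesis .
qed

end


section \<open>Separation by sliding images\<close>

lemma homotopic_with_canonI:
  fixes h :: "real \<Rightarrow> 'a::euclidean_space \<Rightarrow> 'b::euclidean_space"
  assumes "continuous_on ({0..1} \<times> S) (\<lambda>(t, x). h t x)"
    and "\<And>t x. t \<in> {0..1} \<Longrightarrow> x \<in> S \<Longrightarrow> h t x \<in> T"
    and "\<And>x. x \<in> S \<Longrightarrow> h 0 x = f x" "\<And>x. x \<in> S \<Longrightarrow> h 1 x = g x"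
  shows "homotopic_with_canon (\<lambda>_. True) S T f g"
  by (subst homotopic_with)
    (auto intro!: exI[of _ "\<lambda>(t, x). h t x"] simp: assms assms(1)[unfolded split_beta'] image_subset_iff_funcset[symmetric] split_beta'
      simp flip: subtopology_Times)

text \<open>A path from \<open>a\<close> to \<open>b\<close> avoiding the image deforms the Borsuk map based at \<open>a\<close> into the one based
  at \<open>b\<close> after the homotopy, hence also before it; but those based in different components of the
  complement of a compact set are not homotopic.\<close>

lemma homotopy_separation:
  fixes A :: "'a::euclidean_space set" and \<Phi> :: "real \<Rightarrow> 'a \<Rightarrow> 'a"
  assumes A: "closed A" and dim: "2 \<le> DIM('a)"
    and cont: "continuous_on ({0..1} \<times> frontier A) (\<lambda>(t, x). \<Phi> t x)"
    and init: "\<And>x. x \<in> frontier A \<Longrightarrow> \<Phi> 0 x = x"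
    and supp: "\<And>t x. t \<in> {0..1} \<Longrightarrow> x \<in> frontier A \<Longrightarrow> \<Phi> t x = x \<or> norm x \<le> R \<and> norm (\<Phi> t x) \<le> R"
    and a: "a \<in> interior A" "norm a > R" and b: "b \<notin> A" "norm b > R"
  shows "\<not> path_component (- \<Phi> 1 ` frontier A) a b"
proof
  assume "path_component (- \<Phi> 1 ` frontier A) a b"
  then obtain g where g: "path g" "path_image g \<subseteq> - \<Phi> 1 ` frontier A" "pathstart g = a" "pathfinish g = b"
    unfolding path_component_def by blast
  have ag: "a \<in> path_image g" and bg: "b \<in> path_image g"
    using g pathstart_in_path_image pathfinish_in_path_image by metis+
  have "bounded (path_image g)" using g(1) by (rule bounded_path_image)
  then obtain c where c: "\<And>x. x \<in> path_image g \<Longrightarrow> norm x \<le> c" by (auto simp: bounded_iff)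
  \<comment> \<open>A sphere beyond the whole path and beyond all points that the homotopy
    moves.\<close>
  define R' where "R' = max c R + 1"
  have gR: "norm x < R'" if "x \<in> path_image g" for x using c[OF that] by (simp add: R'_def)
  have RR': "R < R'" by (simp add: R'_def)
  \<comment> \<open>The frontier is made compact by cutting it at the sphere and adding the cap
    \<open>S2\<close>. The homotopy is continued by the identity on the cap, consistently because
    points of norm above \<open>R\<close> stay fixed.\<close>
  define S1 where "S1 = frontier A \<inter> cball 0 R'"
  define S2 where "S2 = A \<inter> sphere 0 R'"
  define S where "S = S1 \<union> S2"
  define \<Psi> where "\<Psi> t x = (if x \<in> frontier A then \<Phi> t x else x)" for t x
  have S: "compact S" unfolding S_def S1_def S2_def
    using A by (intro compact_Un closed_Int_compact) auto
  have aS: "a \<notin> S" using a gR[OF ag] by (auto simp: S_def S1_def S2_def frontier_def)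
  have bS: "b \<notin> S" using b gR[OF bg] A by (auto simp: S_def S1_def S2_def frontier_def)
  have \<Psi>id: "\<Psi> t x = x" if "t \<in> {0..1}" "x \<in> S2" for t x
    using supp[of t x] that RR' by (auto simp: \<Psi>_def S2_def)
  have c1: "continuous_on ({0..1} \<times> S1) (\<lambda>(t, x). \<Psi> t x)"
  proof (rule continuous_on_eq[OF continuous_on_subset[OF cont]])
    show "{0..1} \<times> S1 \<subseteq> {0..1} \<times> frontier A" by (auto simp: S1_def)
  qed (auto simp: \<Psi>_def S1_def)
  have c2: "continuous_on ({0..1} \<times> S2) (\<lambda>(t, x). \<Psi> t x)"
    by (rule continuous_on_eq[OF continuous_on_snd[OF continuous_on_id]]) (auto simp: \<Psi>id)
  have "continuous_on ({0..1} \<times> S1 \<union> {0..1} \<times> S2) (\<lambda>(t, x). \<Psi> t x)"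
    by (rule continuous_on_closed_Un[OF _ _ c1 c2])
      (auto simp: S1_def S2_def A intro!: closed_Times closed_Int)
  then have c\<Psi>: "continuous_on ({0..1} \<times> S) (\<lambda>(t, x). \<Psi> t x)"
    by (simp add: S_def Sigma_Un_distrib2)
  have \<Psi>0: "\<Psi> 0 x = x" for x using init by (simp add: \<Psi>_def)
  have ne: "\<Psi> t x \<noteq> p" if "t \<in> {0..1}" "x \<in> S" "p \<notin> S" "norm p > R" for t x p
    using supp[of t x] that by (auto simp: \<Psi>_def)
  let ?B = "\<lambda>p x. (x - p) /\<^sub>R norm (x - p)"
  have hom: "homotopic_with_canon (\<lambda>_. True) S (sphere 0 1) (?B p) (\<lambda>x. ?B p (\<Psi> 1 x))"
    if p: "p \<notin> S" "norm p > R" for p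
  proof (rule homotopic_with_canonI[where h = "\<lambda>t x. ?B p (\<Psi> t x)"])
    have "continuous_on ({0..1} \<times> S) (\<lambda>z. ?B p ((\<lambda>(t, x). \<Psi> t x) z))"
      using c\<Psi> ne p by (intro continuous_intros) (auto simp: split_beta)
    then show "continuous_on ({0..1} \<times> S) (\<lambda>(t, x). ?B p (\<Psi> t x))" by (simp add: split_beta)
  qed (use ne p \<Psi>0 in auto)
  define T where "T = \<Psi> 1 ` S"
  have c\<Psi>1: "continuous_on S (\<Psi> 1)"
  proof -
    have "continuous_on S (\<lambda>x. (\<lambda>(t, x). \<Psi> t x) (1, x))"
      by (rule continuous_on_compose2[OF c\<Psi>]) (auto intro!: continuous_intros)
    then show ?thesis by simp
  qed
  have T: "compact T" unfolding T_def using c\<Psi>1 S by (rule compact_continuous_image)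
  have Tg: "path_image g \<inter> T = {}"
  proof (rule equals0I)
    fix z assume z: "z \<in> path_image g \<inter> T"
    then obtain x where x: "x \<in> S" "z = \<Psi> 1 x" by (auto simp: T_def)
    show False
    proof (cases "x \<in> frontier A")
      case True
      then show ?thesis using x z g(2) by (auto simp: \<Psi>_def)
    next
      case False
      then have "x \<in> S2" using x by (auto simp: S_def S1_def)
      then have "z \<in> sphere 0 R'" using x \<Psi>id[of 1 x] by (auto simp: S2_def)
      then show ?thesis using gR[of z] z by auto
    qed
  qed
  have "connected_component (- T) a b"
    unfolding connected_component_def using g(1) ag bg Tg connected_path_image by blast
  then have "homotopic_with_canon (\<lambda>_. True) T (sphere 0 1) (?B a) (?B b)"
    using ag bg Tg T dim by (subst Borsuk_maps_homotopic_in_connected_component_eq) auto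
  then have "homotopic_with_canon (\<lambda>_. True) S (sphere 0 1) (?B a \<circ> \<Psi> 1) (?B b \<circ> \<Psi> 1)"
    by (rule homotopic_with_compose_continuous_right[where p = "\<lambda>_. True"]) (auto simp: c\<Psi>1 T_def)
  then have "homotopic_with_canon (\<lambda>_. True) S (sphere 0 1) (\<lambda>x. ?B a (\<Psi> 1 x)) (\<lambda>x. ?B b (\<Psi> 1 x))"
    by (simp add: o_def)
  then have "homotopic_with_canon (\<lambda>_. True) S (sphere 0 1) (?B a) (?B b)"
    using hom[OF aS a(2)] hom[OF bS b(2)] by (meson homotopic_with_symD homotopic_with_trans)
  then have "connected_component (- S) a b"
    using Borsuk_maps_homotopic_in_connected_component_eq[OF S aS bS dim] by simp
  then obtain C where C: "connected C" "C \<subseteq> - S" "a \<in> C" "b \<in> C"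
    by (auto simp: connected_component_def)
  \<comment> \<open>Off \<open>S\<close>, a point of \<open>A\<close> in the large ball is neither
    on the frontier nor on the sphere, hence in the open set \<open>?P\<close>. The point
    \<open>a\<close> lies in \<open>?P\<close> and \<open>b\<close> in the disjoint open set
    \<open>?Q\<close>.\<close>
  let ?P = "interior A \<inter> ball 0 R'" and ?Q = "- (A \<inter> cball 0 R')"
  have "C \<subseteq> ?P \<union> ?Q"
    using C(2) A by (auto simp: S_def S1_def S2_def frontier_def)
  moreover have "open ?Q" by (intro open_Compl closed_Int A closed_cball)
  moreover have "?P \<inter> ?Q \<inter> C = {}" using interior_subset by auto
  ultimately have "?P \<inter> C = {} \<or> ?Q \<inter> C = {}" using connectedD[OF C(1), of ?P ?Q] by auto
  then show False using a b C(3,4) gR[OF ag] by auto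
qed

text \<open>The sliding condition is what makes the reflection of the homotopy in the boundary a continuous
  homotopy of the doubled set.\<close>

lemma sliding_separation:
  fixes u :: "'a::euclidean_space" and \<phi> :: "real \<Rightarrow> 'a \<Rightarrow> 'a"
  assumes u: "norm u = 1" and dim: "2 \<le> DIM('a)"
    and E: "\<And>x. x \<in> E \<Longrightarrow> x \<bullet> u \<ge> 0"
    and cont: "continuous_on ({0..1} \<times> E) (\<lambda>(t, x). \<phi> t x)"
    and init: "\<And>x. x \<in> E \<Longrightarrow> \<phi> 0 x = x"
    and supp: "\<And>t x. t \<in> {0..1} \<Longrightarrow> x \<in> E \<Longrightarrow> \<phi> t x = x \<or> norm x \<le> R \<and> norm (\<phi> t x) \<le> R"
    and half: "\<And>t x. t \<in> {0..1} \<Longrightarrow> x \<in> E \<Longrightarrow> \<phi> t x \<bullet> u \<ge> 0"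
    and slide: "\<And>t x. t \<in> {0..1} \<Longrightarrow> x \<in> E \<Longrightarrow> x \<bullet> u = 0 \<Longrightarrow> \<phi> t x \<bullet> u = 0"
    and C: "closed C" "\<And>x. x \<in> C \<Longrightarrow> x \<notin> E \<Longrightarrow> x \<bullet> u \<ge> 0 \<Longrightarrow> \<exists>\<epsilon>>0. \<forall>z\<in>ball x \<epsilon>. z \<bullet> u \<ge> 0 \<longrightarrow> z \<in> C"
    and a: "a \<in> C" "a \<notin> E" "a \<bullet> u \<ge> 0" "norm a > R" and b: "b \<notin> C" "b \<bullet> u \<ge> 0" "norm b > R"
  shows "\<not> path_component ({x. x \<bullet> u \<ge> 0} - \<phi> 1 ` E) a b"
proof
  assume pc: "path_component ({x. x \<bullet> u \<ge> 0} - \<phi> 1 ` E) a b"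
  have uu: "u \<bullet> u = 1" using u by (simp add: dot_square_norm)
  \<comment> \<open>\<sigma> is the reflection in the boundary hyperplane; \<rho> in the next line
    folds the space onto the half-space.\<close>
  define \<sigma> where "\<sigma> x = x - (2 * (x \<bullet> u)) *\<^sub>R u" for x
  define \<rho> where "\<rho> x = x + (\<bar>x \<bullet> u\<bar> - x \<bullet> u) *\<^sub>R u" for x
  have \<rho>u: "\<rho> x \<bullet> u \<ge> 0" for x by (simp add: \<rho>_def inner_add_left uu)
  have \<rho>pos: "\<rho> x = x" if "x \<bullet> u \<ge> 0" for x using that by (simp add: \<rho>_def)
  have \<rho>neg: "\<rho> x = \<sigma> x" if "x \<bullet> u \<le> 0" for x using that by (simp add: \<rho>_def \<sigma>_def algebra_simps)
  have \<sigma>u: "\<sigma> x \<bullet> u = - (x \<bullet> u)" for x by (simp add: \<sigma>_def inner_diff_left uu)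
  have \<sigma>fix: "\<sigma> x = x" if "x \<bullet> u = 0" for x using that by (simp add: \<sigma>_def)
  have \<sigma>\<sigma>: "\<sigma> (\<sigma> x) = x" for x unfolding \<sigma>_def[of "\<sigma> x"] \<sigma>u by (simp add: \<sigma>_def)
  have n\<sigma>: "norm (\<sigma> x) = norm x" for x
  proof -
    have "\<sigma> x \<bullet> \<sigma> x = x \<bullet> x - 2 * (2 * (x \<bullet> u)) * (x \<bullet> u) + (2 * (x \<bullet> u)) * (2 * (x \<bullet> u)) * (u \<bullet> u)"
      unfolding \<sigma>_def inner_diff_left inner_diff_right inner_scaleR_left inner_scaleR_right
        inner_commute[of u x] by (simp only: algebra_simps)
    then show ?thesis by (simp add: norm_eq_sqrt_inner uu)
  qed
  have c\<rho>: "continuous_on UNIV \<rho>" unfolding \<rho>_def by (intro continuous_intros)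
  have c\<sigma>: "continuous_on UNIV \<sigma>" unfolding \<sigma>_def by (intro continuous_intros)
  \<comment> \<open>\<open>C\<close> doubled across the boundary. Its frontier folds into
    \<open>E\<close>, because near a point off \<open>E\<close> all of the half-space belongs to
    \<open>C\<close>.\<close>
  define A where "A = \<rho> -` C"
  have A: "closed A" unfolding A_def by (rule closed_vimage[OF C(1) c\<rho>])
  have frE: "\<rho> x \<in> E" if x: "x \<in> frontier A" for x
  proof (rule ccontr)
    assume nE: "\<rho> x \<notin> E"
    have "x \<in> A" using x A frontier_subset_closed by blast
    then have "\<rho> x \<in> C" by (simp add: A_def)
    then obtain \<epsilon> where \<epsilon>: "\<epsilon> > 0" "\<forall>z\<in>ball (\<rho> x) \<epsilon>. z \<bullet> u \<ge> 0 \<longrightarrow> z \<in> C" using C(2) nE \<rho>u by blast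
    have "open (\<rho> -` ball (\<rho> x) \<epsilon>)" by (rule open_vimage[OF open_ball c\<rho>])
    moreover have "\<rho> -` ball (\<rho> x) \<epsilon> \<subseteq> A" using \<epsilon> \<rho>u by (auto simp: A_def)
    moreover have "x \<in> \<rho> -` ball (\<rho> x) \<epsilon>" using \<epsilon> by simp
    ultimately have "x \<in> interior A" by (meson interior_maximal subsetD)
    then show False using x by (simp add: frontier_def)
  qed
  \<comment> \<open>Below the boundary the homotopy is conjugated with the reflection. On the
    boundary the branches agree: \<sigma> fixes \<open>x\<close>, and by the sliding condition also
    its image. The condition is written with a minus sign to match
    \<open>continuous_on_cases_le\<close>.\<close>
  define \<Phi> where "\<Phi> t x = (if - (x \<bullet> u) \<le> 0 then \<phi> t x else \<sigma> (\<phi> t (\<sigma> x)))" for t x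
  have "\<not> path_component (- \<Phi> 1 ` frontier A) a b"
  proof (rule homotopy_separation[OF A dim])
    have "continuous_on ({0..1::real} \<times> frontier A)
        (\<lambda>z. if - (snd z \<bullet> u) \<le> 0 then \<phi> (fst z) (snd z) else \<sigma> (\<phi> (fst z) (\<sigma> (snd z))))"
    proof (rule continuous_on_cases_le)
      show "continuous_on {z \<in> {0..1::real} \<times> frontier A. - (snd z \<bullet> u) \<le> 0} (\<lambda>z. \<phi> (fst z) (snd z))"
      proof (rule continuous_on_subset[of "{0..1} \<times> E"])
        show "continuous_on ({0..1} \<times> E) (\<lambda>z. \<phi> (fst z) (snd z))" using cont by (simp add: split_beta)
        show "{z \<in> {0..1::real} \<times> frontier A. - (snd z \<bullet> u) \<le> 0} \<subseteq> {0..1} \<times> E"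
          using frE \<rho>pos by fastforce
      qed
      have "continuous_on {z \<in> {0..1::real} \<times> frontier A. 0 \<le> - (snd z \<bullet> u)} (\<lambda>z. (\<lambda>(t, x). \<phi> t x) (fst z, \<sigma> (snd z)))"
      proof (rule continuous_on_compose2[OF cont])
        show "continuous_on {z \<in> {0..1::real} \<times> frontier A. 0 \<le> - (snd z \<bullet> u)} (\<lambda>z. (fst z, \<sigma> (snd z)))"
          by (intro continuous_intros continuous_on_compose2[OF c\<sigma>]) auto
        show "(\<lambda>z. (fst z, \<sigma> (snd z))) ` {z \<in> {0..1::real} \<times> frontier A. 0 \<le> - (snd z \<bullet> u)} \<subseteq> {0..1} \<times> E"
          using frE \<rho>neg by fastforce
      qed
      then show "continuous_on {z \<in> {0..1::real} \<times> frontier A. 0 \<le> - (snd z \<bullet> u)} (\<lambda>z. \<sigma> (\<phi> (fst z) (\<sigma> (snd z))))"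
        by (intro continuous_on_compose2[OF c\<sigma>]) auto
      show "continuous_on ({0..1} \<times> frontier A) (\<lambda>z. - (snd z \<bullet> u))" by (intro continuous_intros)
      fix z assume z: "z \<in> {0..1::real} \<times> frontier A" "- (snd z \<bullet> u) = 0"
      then have "snd z \<in> E" using frE[of "snd z"] \<rho>pos[of "snd z"] by auto
      then show "\<phi> (fst z) (snd z) = \<sigma> (\<phi> (fst z) (\<sigma> (snd z)))"
        using z slide[of "fst z" "snd z"] by (auto simp: \<sigma>fix)
    qed
    then show "continuous_on ({0..1} \<times> frontier A) (\<lambda>(t, x). \<Phi> t x)"
      by (simp add: \<Phi>_def split_beta)
    show "\<Phi> 0 x = x" if "x \<in> frontier A" for x
      using frE[OF that] init \<rho>pos[of x] \<rho>neg[of x] by (auto simp: \<Phi>_def \<sigma>\<sigma>)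
    show "\<Phi> t x = x \<or> norm x \<le> R \<and> norm (\<Phi> t x) \<le> R" if t: "t \<in> {0..1}" and x: "x \<in> frontier A" for t x
    proof (cases "x \<bullet> u \<ge> 0")
      case True
      then show ?thesis using supp[OF t, of x] frE[OF x] by (simp add: \<Phi>_def \<rho>pos)
    next
      case False
      then show ?thesis using supp[OF t, of "\<sigma> x"] frE[OF x] by (auto simp: \<Phi>_def \<rho>neg n\<sigma> \<sigma>\<sigma>)
    qed
    have "a \<in> A" "a \<notin> frontier A" using a frE[of a] by (auto simp: A_def \<rho>pos)
    then show "a \<in> interior A" using A by (simp add: frontier_def)
    show "b \<notin> A" using b by (simp add: A_def \<rho>pos)
  qed (use a b in auto)
  moreover have "{x. x \<bullet> u \<ge> 0} - \<phi> 1 ` E \<subseteq> - \<Phi> 1 ` frontier A"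
  proof
    fix z assume z: "z \<in> {x. x \<bullet> u \<ge> 0} - \<phi> 1 ` E"
    show "z \<in> - \<Phi> 1 ` frontier A"
    proof
      assume "z \<in> \<Phi> 1 ` frontier A"
      then obtain x where x: "x \<in> frontier A" "z = \<Phi> 1 x" by auto
      show False
      proof (cases "x \<bullet> u \<ge> 0")
        case True
        then show ?thesis using x z frE[OF x(1)] by (auto simp: \<Phi>_def \<rho>pos)
      next
        case False
        then have s: "\<sigma> x \<in> E" "z = \<sigma> (\<phi> 1 (\<sigma> x))" using x frE[OF x(1)] by (auto simp: \<Phi>_def \<rho>neg)
        \<comment> \<open>Here \<open>z\<close> lies in the closed half-space and is also the mirror
          image of a point of it, so both are on the boundary and coincide.\<close>
        have "\<phi> 1 (\<sigma> x) \<bullet> u \<ge> 0" using half[of 1] s(1) by simp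
        moreover have "z \<bullet> u = - (\<phi> 1 (\<sigma> x) \<bullet> u)" using s(2) \<sigma>u by simp
        ultimately have "\<phi> 1 (\<sigma> x) \<bullet> u = 0" using z by simp
        then have "z = \<phi> 1 (\<sigma> x)" using s(2) \<sigma>fix by simp
        then show ?thesis using z s(1) by blast
      qed
    qed
  qed
  ultimately show False using pc path_component_of_subset by blast
qed

text \<open>The end point \<open>b\<close> may lie among the moving points. A path to it is
  therefore prolonged straight out of the half-space to a far point \<open>b'\<close>; the images
  stay in the half-space, so the added segment avoids them.\<close>

lemma sliding_separation_boundary:
  fixes u :: "'a::euclidean_space" and \<phi> :: "real \<Rightarrow> 'a \<Rightarrow> 'a"
  assumes u: "norm u = 1" and dim: "2 \<le> DIM('a)"
    and cont: "continuous_on ({0..1} \<times> E) (\<lambda>(t, x). \<phi> t x)"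
    and init: "\<And>x. x \<in> E \<Longrightarrow> \<phi> 0 x = x"
    and supp: "\<And>t x. t \<in> {0..1} \<Longrightarrow> x \<in> E \<Longrightarrow> \<phi> t x = x \<or> norm x \<le> R \<and> norm (\<phi> t x) \<le> R"
    and half: "\<And>t x. t \<in> {0..1} \<Longrightarrow> x \<in> E \<Longrightarrow> \<phi> t x \<bullet> u \<ge> 0"
    and C: "closed C" "\<And>x. x \<in> C \<Longrightarrow> x \<bullet> u \<ge> 0" "frontier C \<subseteq> E"
    and a: "a \<in> C" "a \<notin> E" "norm a > R" and b: "b \<bullet> u = 0" "b \<notin> \<phi> 1 ` E"
  shows "\<not> path_component ({x. x \<bullet> u \<ge> 0} - \<phi> 1 ` E) a b"
proof
  assume pc: "path_component ({x. x \<bullet> u \<ge> 0} - \<phi> 1 ` E) a b"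
  have uu: "u \<bullet> u = 1" using u by (simp add: dot_square_norm)
  \<comment> \<open>The length is chosen so that \<open>s - norm b\<close> exceeds \<open>R\<close>,
    which is a lower bound for the norm of \<open>b'\<close>.\<close>
  define s where "s = \<bar>R\<bar> + norm b + 1"
  define b' where "b' = b - s *\<^sub>R u"
  have s: "s > 0" by (simp add: s_def add_nonneg_pos)
  have b'u: "b' \<bullet> u < 0" using s by (simp add: b'_def inner_diff_left b uu)
  have nb: "norm b' > R"
  proof -
    have "norm (s *\<^sub>R u) \<le> norm b' + norm b"
      using norm_triangle_ineq4[of b b'] by (simp add: b'_def)
    then show ?thesis using u s by (simp add: s_def)
  qed
  have sep: "\<not> path_component (- \<phi> 1 ` frontier C) a b'"
  proof (rule homotopy_separation[OF C(1) dim])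
    show "continuous_on ({0..1} \<times> frontier C) (\<lambda>(t, x). \<phi> t x)"
      by (rule continuous_on_subset[OF cont]) (use C(3) in auto)
    show "a \<in> interior C" using a C by (auto simp: frontier_def)
    show "b' \<notin> C" using b'u C(2) by force
  qed (use C(3) init supp a nb in auto)
  have "path_component (- \<phi> 1 ` frontier C) a b"
    by (rule path_component_of_subset[OF _ pc]) (use C(3) in auto)
  moreover have "path_component (- \<phi> 1 ` frontier C) b b'"
  proof (rule path_component_of_subset)
    show "closed_segment b b' \<subseteq> - \<phi> 1 ` frontier C"
    proof
      fix z assume "z \<in> closed_segment b b'"
      then obtain t where t: "0 \<le> t" "t \<le> 1" "z = (1 - t) *\<^sub>R b + t *\<^sub>R b'" by (auto simp: in_segment)
      then have zb: "z = b - (t * s) *\<^sub>R u" by (simp add: b'_def algebra_simps)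
      show "z \<in> - \<phi> 1 ` frontier C"
      proof (cases "t = 0")
        case True
        then show ?thesis using zb b(2) C(3) by auto
      next
        case False
        then have "t * s > 0" using t s by simp
        moreover have "z \<bullet> u = - (t * s)" unfolding zb by (simp add: inner_diff_left b uu)
        ultimately have "z \<bullet> u < 0" by simp
        moreover have "\<phi> 1 x \<bullet> u \<ge> 0" if "x \<in> frontier C" for x using half[of 1 x] that C(3) by auto
        ultimately show ?thesis by force
      qed
    qed
    show "path_component (closed_segment b b') b b'"
      by (metis connected_segment(1) convex_closed_segment convex_imp_path_connected ends_in_segment path_connected_component)
  qed
  ultimately show False using sep path_component_trans by blast
qed


section \<open>The regular simplex\<close>

abbreviation first_axis :: "real^'n::{finite,linorder}" where
  "first_axis \<equiv> axis (Min UNIV) 1"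

lemma half_space_eq: "half_space = {x. x \<bullet> first_axis \<ge> 0}"
  and sliding_boundary_eq: "sliding_boundary = {x. x \<bullet> first_axis = 0}"
  by (simp_all add: half_space_def sliding_boundary_def inner_axis)

section \<open>The Gram matrix of the vertices\<close>

lemma bij_coord_number: "bij_betw (coord_number :: 'n::{finite,linorder} \<Rightarrow> nat) UNIV {1..CARD('n)}"
proof -
  have less: "coord_number i < coord_number j" if "i < j" for i j :: 'n
    unfolding coord_number_def by (rule psubset_card_mono) (use that in auto)
  have inj: "inj (coord_number :: 'n \<Rightarrow> nat)"
    by (rule injI) (metis less less_irrefl linorder_neq_iff)
  have "range (coord_number :: 'n \<Rightarrow> nat) \<subseteq> {1..CARD('n)}"
    by (auto simp: coord_number_def Suc_le_eq card_gt_0_iff intro!: card_mono)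
  then have "range (coord_number :: 'n \<Rightarrow> nat) = {1..CARD('n)}"
    by (rule card_subset_eq[rotated]) (auto simp: card_image[OF inj])
  with inj show ?thesis by (simp add: bij_betw_def)
qed

lemma coord_number_Min: "coord_number (Min UNIV :: 'n::{finite,linorder}) = 1"
proof -
  have "{..Min UNIV :: 'n} = {Min UNIV}" by (auto intro: antisym)
  then show ?thesis by (simp add: coord_number_def)
qed

lemma simplex_coeff_square:
  assumes "1 \<le> j" "j \<le> n"
  shows "(simplex_coeff n j)\<^sup>2 = (real n + 1) * (real n - real j + 1) / (real n * (real n - real j + 2))"
proof -
  have "0 \<le> (real n + 1) * (real n - real j + 1) / (real n * (real n - real j + 2))"
    using assms by (intro divide_nonneg_nonneg mult_nonneg_nonneg) auto
  then show ?thesis unfolding simplex_coeff_def by simp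
qed

text \<open>Each term equals (n+1)/n times the difference of 1/(n-j+1) and 1/(n-j+2), so the sum
  telescopes.\<close>

lemma simplex_coeff_sum:
  assumes "1 \<le> k" "k \<le> n + 1"
  shows "(\<Sum>j=1..<k. (simplex_coeff n j / (real n - real j + 1))\<^sup>2)
    = (real n + 1) / real n * (1 / (real n - real k + 2) - 1 / (real n + 1))"
  using assms
proof (induction k rule: dec_induct)
  case base
  then show ?case by simp
next
  case (step k)
  define y where "y = real n - real k + 1"
  have y: "y > 0" "real n > 0" using step by (auto simp: y_def)
  have "(simplex_coeff n k / (real n - real k + 1))\<^sup>2 = (real n + 1) * y / (real n * (y + 1)) / y\<^sup>2"
    using step by (simp add: power_divide simplex_coeff_square y_def)
  also have "\<dots> = (real n + 1) / real n * (1 / (y * (y + 1)))"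
    using y by (simp add: power2_eq_square)
  also have "1 / (y * (y + 1)) = 1 / y - 1 / (y + 1)"
    using y by (simp add: divide_simps)
  finally have "(simplex_coeff n k / (real n - real k + 1))\<^sup>2 = (real n + 1) / real n * (1 / y - 1 / (y + 1))" .
  then have "(\<Sum>j=1..<Suc k. (simplex_coeff n j / (real n - real j + 1))\<^sup>2)
     = (real n + 1) / real n * (1 / (y + 1) - 1 / (real n + 1)) + (real n + 1) / real n * (1 / y - 1 / (y + 1))"
    using step by (simp add: y_def)
  also have "\<dots> = (real n + 1) / real n * (1 / y - 1 / (real n + 1))" by (simp add: algebra_simps)
  finally show ?case by (simp add: y_def)
qed

definition vertex_coord :: "nat \<Rightarrow> nat \<Rightarrow> nat \<Rightarrow> real" where
  "vertex_coord n k j = (if j < k then simplex_coeff n j / (real n - real j + 1)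
     else if j = k then - simplex_coeff n k else 0)"

lemma simplex_vertex_inner:
  "(simplex_vertex k :: real^'n::{finite,linorder}) \<bullet> simplex_vertex l
    = (\<Sum>j=1..CARD('n). vertex_coord CARD('n) k j * vertex_coord CARD('n) l j)"
proof -
  have "(simplex_vertex k :: real^'n::{finite,linorder}) \<bullet> simplex_vertex l
     = (\<Sum>i\<in>UNIV. vertex_coord CARD('n) k (coord_number (i::'n)) * vertex_coord CARD('n) l (coord_number i))"
    by (simp add: inner_vec_def simplex_vertex_def vertex_coord_def Let_def)
  also have "\<dots> = (\<Sum>j=1..CARD('n). vertex_coord CARD('n) k j * vertex_coord CARD('n) l j)"
    by (rule sum.reindex_bij_betw[OF bij_coord_number])
  finally show ?thesis .
qed

text \<open>The vertices \<open>k\<close> and \<open>l\<close> share their coordinates before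
  \<open>k\<close>, and those of vertex \<open>k\<close> vanish after \<open>k\<close>. Only the
  telescoping sum and one negative product at position \<open>k\<close> remain.\<close>

lemma vertex_coord_sum_less:
  assumes "1 \<le> k" "k < l" "l \<le> n + 1" "n \<ge> 1"
  shows "(\<Sum>j=1..n. vertex_coord n k j * vertex_coord n l j) = - 1 / n"
proof -
  have kn: "k \<le> n" using assms by simp
  have "(\<Sum>j=1..n. vertex_coord n k j * vertex_coord n l j)
      = (\<Sum>j\<in>insert k {1..<k}. vertex_coord n k j * vertex_coord n l j)"
    by (rule sum.mono_neutral_right) (use assms kn in \<open>auto simp: vertex_coord_def\<close>)
  also have "\<dots> = vertex_coord n k k * vertex_coord n l k + (\<Sum>j=1..<k. vertex_coord n k j * vertex_coord n l j)"
    by simp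
  also have "(\<Sum>j=1..<k. vertex_coord n k j * vertex_coord n l j)
      = (\<Sum>j=1..<k. (simplex_coeff n j / (real n - real j + 1))\<^sup>2)"
    by (rule sum.cong) (use assms in \<open>auto simp: vertex_coord_def power2_eq_square\<close>)
  also have "\<dots> = (real n + 1) / real n * (1 / (real n - real k + 2) - 1 / (real n + 1))"
    by (rule simplex_coeff_sum) (use assms in auto)
  also have "vertex_coord n k k * vertex_coord n l k = - ((simplex_coeff n k)\<^sup>2) / (real n - real k + 1)"
    using assms by (simp add: vertex_coord_def power2_eq_square)
  also have "(simplex_coeff n k)\<^sup>2 = (real n + 1) * (real n - real k + 1) / (real n * (real n - real k + 2))"
    by (rule simplex_coeff_square) (use assms kn in auto)
  also have "- ((real n + 1) * (real n - real k + 1) / (real n * (real n - real k + 2))) / (real n - real k + 1)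
      + (real n + 1) / real n * (1 / (real n - real k + 2) - 1 / (real n + 1)) = - 1 / n"
  proof -
    define y where "y = real n - real k + 1"
    have y: "y > 0" "real n > 0" and yk: "real n - real k + 1 = y" "real n - real k + 2 = y + 1"
      using kn assms by (auto simp: y_def)
    have "- ((real n + 1) * y / (real n * (y + 1))) / y = - ((real n + 1) / real n * (1 / (y + 1)))"
      using y by simp
    moreover have "(real n + 1) / real n * (1 / (real n + 1)) = 1 / real n"
      using y by simp
    ultimately show ?thesis unfolding yk right_diff_distrib by linarith
  qed
  finally show ?thesis .
qed

lemma vertex_coord_sum_same:
  assumes "1 \<le> k" "k \<le> n + 1" "n \<ge> 1"
  shows "(\<Sum>j=1..n. vertex_coord n k j * vertex_coord n k j) = 1"
proof -
  have pre: "(\<Sum>j=1..<k. vertex_coord n k j * vertex_coord n k j)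
      = (real n + 1) / real n * (1 / (real n - real k + 2) - 1 / (real n + 1))"
  proof -
    have "(\<Sum>j=1..<k. vertex_coord n k j * vertex_coord n k j)
        = (\<Sum>j=1..<k. (simplex_coeff n j / (real n - real j + 1))\<^sup>2)"
      by (rule sum.cong) (auto simp: vertex_coord_def power2_eq_square)
    also have "\<dots> = (real n + 1) / real n * (1 / (real n - real k + 2) - 1 / (real n + 1))"
      by (rule simplex_coeff_sum) (use assms in auto)
    finally show ?thesis .
  qed
  show ?thesis
  proof (cases "k = n + 1")
    case True
    then have "{1..n} = {1..<k}" by auto
    moreover have "real n - real k + 2 = 1" using True by simp
    ultimately have "(\<Sum>j=1..n. vertex_coord n k j * vertex_coord n k j) = (real n + 1) / real n * (1 - 1 / (real n + 1))"
      using pre by simp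
    also have "\<dots> = (real n + 1) / real n * (real n / (real n + 1))" using assms by (simp add: diff_divide_eq_iff)
    also have "\<dots> = 1" using assms by simp
    finally show ?thesis .
  next
    case False
    then have kn: "k \<le> n" using assms by simp
    have "(\<Sum>j=1..n. vertex_coord n k j * vertex_coord n k j)
        = (\<Sum>j\<in>insert k {1..<k}. vertex_coord n k j * vertex_coord n k j)"
      by (rule sum.mono_neutral_right) (use assms kn in \<open>auto simp: vertex_coord_def\<close>)
    also have "\<dots> = vertex_coord n k k * vertex_coord n k k + (\<Sum>j=1..<k. vertex_coord n k j * vertex_coord n k j)"
      by simp
    also have "vertex_coord n k k * vertex_coord n k k = (simplex_coeff n k)\<^sup>2"
      by (simp add: vertex_coord_def power2_eq_square)
    also have "\<dots> = (real n + 1) * (real n - real k + 1) / (real n * (real n - real k + 2))"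
      by (rule simplex_coeff_square) (use assms kn in auto)
    finally have eq: "(\<Sum>j=1..n. vertex_coord n k j * vertex_coord n k j)
       = (real n + 1) * (real n - real k + 1) / (real n * (real n - real k + 2))
         + (real n + 1) / real n * (1 / (real n - real k + 2) - 1 / (real n + 1))"
      unfolding pre .
    define y where "y = real n - real k + 1"
    have y: "y > 0" "real n > 0" and yk: "real n - real k + 1 = y" "real n - real k + 2 = y + 1"
      using kn assms by (auto simp: y_def)
    have "(real n + 1) * y / (real n * (y + 1)) = (real n + 1) / real n * (y / (y + 1))" by simp
    moreover have "y / (y + 1) + 1 / (y + 1) = 1" using y by (simp add: add_divide_distrib[symmetric])
    ultimately have "(real n + 1) * y / (real n * (y + 1)) + (real n + 1) / real n * (1 / (y + 1)) = (real n + 1) / real n"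
      by (simp only: distrib_left[symmetric] mult_1_right)
    also have "\<dots> = 1 + 1 / real n" using y by (simp add: add_divide_distrib)
    finally have "(real n + 1) * y / (real n * (y + 1)) + (real n + 1) / real n * (1 / (y + 1)) = 1 + 1 / real n" .
    moreover have "(real n + 1) / real n * (1 / (real n + 1)) = 1 / real n"
      using y by simp
    ultimately show ?thesis unfolding eq yk right_diff_distrib by linarith
  qed
qed

lemma simplex_vertex_gram:
  assumes "k \<in> {1..CARD('n) + 1}" "l \<in> {1..CARD('n) + 1}"
  shows "(simplex_vertex k :: real^'n::{finite,linorder}) \<bullet> simplex_vertex l = (if k = l then 1 else - 1 / CARD('n))"
proof -
  have n1: "CARD('n) \<ge> 1" by (simp add: Suc_le_eq)
  consider "k = l" | "k < l" | "l < k" by linarith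
  then show ?thesis
  proof cases
    case 1
    then show ?thesis using assms vertex_coord_sum_same[of k "CARD('n)"] n1 by (simp add: simplex_vertex_inner)
  next
    case 2
    then show ?thesis using assms vertex_coord_sum_less[of k l "CARD('n)"] n1 by (simp add: simplex_vertex_inner)
  next
    case 3
    then show ?thesis using assms vertex_coord_sum_less[of l k "CARD('n)"] n1
      by (simp add: simplex_vertex_inner mult.commute)
  qed
qed

lemma simplex_vertex_1: "(simplex_vertex 1 :: real^'n::{finite,linorder}) = - first_axis"
proof -
  have "coord_number (i::'n) = 1 \<longleftrightarrow> i = Min UNIV" for i
    using bij_coord_number[where 'n='n] coord_number_Min[where 'n='n]
    unfolding bij_betw_def inj_def by metis
  moreover have "coord_number (i::'n) \<noteq> 0" for i
  proof -
    have "coord_number i \<in> {1..CARD('n)}" using bij_coord_number[where 'n='n] by (metis bij_betw_def rangeI)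
    then show ?thesis by simp
  qed
  moreover have "simplex_coeff CARD('n) 1 = 1"
    by (simp add: simplex_coeff_def mult.commute)
  ultimately show ?thesis
    by (simp add: vec_eq_iff simplex_vertex_def Let_def axis_def) (metis less_irrefl)
qed

text \<open>Everything about the simplex is derived from here on from its Gram matrix, which fixes
  it up to isometry. Coordinates return only when the first vertex is identified with minus the
  first axis.\<close>

locale simplex_frame =
  fixes n :: nat and p :: "nat \<Rightarrow> 'a::euclidean_space"
  assumes n2: "n \<ge> 2" and dim_n: "DIM('a) = n"
    and gram: "\<And>k l. k \<in> {1..n+1} \<Longrightarrow> l \<in> {1..n+1} \<Longrightarrow> p k \<bullet> p l = (if k = l then 1 else - 1 / n)"
begin

definition N :: "nat set" where "N = {1..n+1}"

lemma finite_N [simp]: "finite N" and card_N: "card N = n + 1"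
  by (simp_all add: N_def)

lemma gram_N: "k \<in> N \<Longrightarrow> l \<in> N \<Longrightarrow> p k \<bullet> p l = (if k = l then 1 else - 1 / n)"
  using gram by (simp add: N_def)

lemma norm_p: "k \<in> N \<Longrightarrow> norm (p k) = 1"
  by (simp add: norm_eq_sqrt_inner gram_N)

lemma inj_p: "inj_on p N"
proof (rule inj_onI)
  fix k l assume kl: "k \<in> N" "l \<in> N" "p k = p l"
  show "k = l"
  proof (rule ccontr)
    assume "k \<noteq> l"
    then have "p k \<bullet> p l = - 1 / n" "p l \<bullet> p l = 1"
      using gram_N[OF kl(1,2)] gram_N[OF kl(2,2)] by simp_all
    then have "(1::real) = - 1 / n" using kl by metis
    moreover have "- 1 / real n < 0" using n2 by simp
    ultimately show False by linarith
  qed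
qed

lemma gram_sum:
  assumes l: "l \<in> N"
  shows "(\<Sum>k\<in>N. c k *\<^sub>R p k) \<bullet> p l = c l * (1 + 1 / n) - (\<Sum>k\<in>N. c k) / n"
proof -
  have "(\<Sum>k\<in>N. c k *\<^sub>R p k) \<bullet> p l = (\<Sum>k\<in>N. c k * (p k \<bullet> p l))" by (simp add: inner_sum_left)
  also have "\<dots> = (\<Sum>k\<in>N. (if k = l then c k * (1 + 1 / n) else 0) - c k / n)"
    by (rule sum.cong) (use l gram_N in \<open>auto simp: field_simps\<close>)
  also have "\<dots> = c l * (1 + 1 / n) - (\<Sum>k\<in>N. c k) / n"
    using l by (simp add: sum_subtractf sum_divide_distrib)
  finally show ?thesis .
qed

lemma sum_p: "(\<Sum>k\<in>N. p k) = 0"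
proof -
  have "(\<Sum>k\<in>N. p k) \<bullet> p l = 0" if "l \<in> N" for l
    using gram_sum[OF that, of "\<lambda>_. 1"] n2 by (simp add: card_N field_simps)
  then have "(\<Sum>k\<in>N. p k) \<bullet> (\<Sum>k\<in>N. p k) = 0" by (simp add: inner_sum_right)
  then show ?thesis by simp
qed

lemma sum_p_inner: "(\<Sum>k\<in>N. p k \<bullet> x) = 0"
  using sum_p by (metis inner_sum_left inner_zero_left)

lemma independent_p: "independent (p ` {1..n})"
proof (rule independent_if_scalars_zero)
  fix f x assume s: "(\<Sum>x\<in>p ` {1..n}. f x *\<^sub>R x) = 0" and x: "x \<in> p ` {1..n}"
  define c where "c k = (if k \<in> {1..n} then f (p k) else 0)" for k
  have inj: "inj_on p {1..n}" using inj_p by (rule inj_on_subset) (auto simp: N_def)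
  have "(\<Sum>k\<in>N. c k *\<^sub>R p k) = (\<Sum>k\<in>{1..n}. f (p k) *\<^sub>R p k)"
    by (rule sum.mono_neutral_cong_right) (auto simp: N_def c_def)
  also have "\<dots> = 0" using s unfolding sum.reindex[OF inj] by (simp add: o_def)
  finally have z: "(\<Sum>k\<in>N. c k *\<^sub>R p k) = 0" .
  have cl: "c l * (1 + 1 / n) = (\<Sum>k\<in>N. c k) / n" if "l \<in> N" for l
    using gram_sum[OF that, of c] z by simp
  have "(\<Sum>k\<in>N. c k) / n = 0" using cl[of "n+1"] by (simp add: N_def c_def)
  moreover have "1 + 1 / real n > 0" by (simp add: add_pos_nonneg)
  ultimately have c0: "c l = 0" if "l \<in> N" for l
    using cl[OF that] n2 by simp
  obtain l where l: "l \<in> {1..n}" "x = p l" using x by blast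
  then have "f x = c l" by (simp add: c_def)
  also have "c l = 0" using l by (intro c0) (auto simp: N_def)
  finally show "f x = 0" .
qed auto

lemma orthogonal_p_zero:
  assumes "\<And>l. l \<in> N \<Longrightarrow> y \<bullet> p l = 0"
  shows "y = 0"
proof -
  have inj: "inj_on p {1..n}" using inj_p by (rule inj_on_subset) (auto simp: N_def)
  have "UNIV \<subseteq> span (p ` {1..n})"
    using card_image[OF inj] by (intro card_ge_dim_independent[OF _ independent_p]) (simp_all add: dim_n)
  then have "y \<in> span (p ` {1..n})" by auto
  moreover have "orthogonal y x" if "x \<in> p ` {1..n}" for x
    using that assms by (auto simp: orthogonal_def N_def)
  ultimately have "orthogonal y y" by (rule orthogonal_to_span)
  then show ?thesis by (simp add: orthogonal_self)
qed

text \<open>The vertices form a tight frame: the difference of the two sides is orthogonal to every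
  vertex, and the vertices span the space.\<close>

lemma frame: "x = (\<Sum>k\<in>N. (n / (n + 1) * (p k \<bullet> x)) *\<^sub>R p k)"
proof -
  have "(x - (\<Sum>k\<in>N. (n / (n + 1) * (p k \<bullet> x)) *\<^sub>R p k)) \<bullet> p l = 0" if l: "l \<in> N" for l
  proof -
    have "(\<Sum>k\<in>N. (n / (n + 1) * (p k \<bullet> x)) *\<^sub>R p k) \<bullet> p l
        = n / (n + 1) * (p l \<bullet> x) * (1 + 1 / n) - (\<Sum>k\<in>N. n / (n + 1) * (p k \<bullet> x)) / n"
      by (rule gram_sum[OF l])
    also have "(\<Sum>k\<in>N. n / (n + 1) * (p k \<bullet> x)) = 0"
      by (simp only: sum_distrib_left[symmetric] sum_p_inner mult_zero_right)
    also have "n / (n + 1) * (p l \<bullet> x) * (1 + 1 / n) = p l \<bullet> x"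
    proof -
      have "1 + 1 / real n = (real n + 1) / real n" using n2 by (simp add: add_divide_distrib)
      then have "real n / (real n + 1) * (1 + 1 / real n) = 1" using n2 by simp
      then show ?thesis by (metis mult.assoc mult.commute mult.right_neutral of_nat_1 of_nat_add)
    qed
    finally show ?thesis unfolding inner_diff_left by (simp add: inner_commute)
  qed
  from orthogonal_p_zero[OF this] show ?thesis by simp
qed

lemma affine_independent_p: "\<not> affine_dependent (p ` N)"
proof
  assume "affine_dependent (p ` N)"
  then obtain U where U: "sum U (p ` N) = 0" "\<exists>v\<in>p ` N. U v \<noteq> 0" "(\<Sum>v\<in>p ` N. U v *\<^sub>R v) = 0"
    using affine_dependent_explicit_finite[of "p ` N"] by auto
  have "(\<Sum>k\<in>N. U (p k)) = 0" "(\<Sum>k\<in>N. U (p k) *\<^sub>R p k) = 0"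
    using U by (simp_all add: sum.reindex[OF inj_p])
  then have "U (p l) * (1 + 1 / n) = 0" if "l \<in> N" for l
    using gram_sum[OF that, of "\<lambda>k. U (p k)"] by simp
  moreover have "1 + 1 / real n \<noteq> 0" using n2 by (simp add: add_eq_0_iff field_simps)
  ultimately show False using U(2) by auto
qed

text \<open>The cone expressed by ties: the least of the numbers \<open>p k \<bullet> x\<close> is
  attained at least twice. This replaces faces of a polytope by linear inequalities.\<close>

definition walls :: "'a set" where
  "walls = {x. \<exists>i\<in>N. \<exists>j\<in>N. i \<noteq> j \<and> p i \<bullet> x = p j \<bullet> x \<and> (\<forall>k\<in>N. p i \<bullet> x \<le> p k \<bullet> x)}"

text \<open>The faces of a simplex are the hulls of subsets of its vertices, and dimension n-2 means
  n-1 vertices, that is, all but two.\<close>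

lemma skeleton_simplex:
  "s \<in> skeleton (int n - 2) (convex hull (p ` N)) \<longleftrightarrow>
    (\<exists>M\<subseteq>N. card M = n - 1 \<and> s \<in> convex hull (p ` M))"
proof
  assume "s \<in> skeleton (int n - 2) (convex hull (p ` N))"
  then obtain T where T: "T face_of convex hull (p ` N)" "aff_dim T = int n - 2" "s \<in> T"
    by (auto simp: skeleton_def)
  then obtain c where c: "c \<subseteq> p ` N" "T = convex hull c"
    using face_of_convex_hull_affine_independent[OF affine_independent_p] by auto
  then obtain M where M: "M \<subseteq> N" "c = p ` M" by (auto simp: subset_image_iff)
  have "\<not> affine_dependent c" using c affine_independent_p affine_dependent_subset by blast
  then have "int (card c) = aff_dim c + 1" by (rule aff_dim_affine_independent)
  then have "int (card c) - 1 = int n - 2"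
    using T(2) c(2) by (simp add: aff_dim_convex_hull)
  moreover have "card c = card M" using card_image[OF inj_on_subset[OF inj_p M(1)]] M(2) by simp
  ultimately have "card M = n - 1" using n2 by linarith
  with M c T show "\<exists>M\<subseteq>N. card M = n - 1 \<and> s \<in> convex hull (p ` M)" by blast
next
  assume "\<exists>M\<subseteq>N. card M = n - 1 \<and> s \<in> convex hull (p ` M)"
  then obtain M where M: "M \<subseteq> N" "card M = n - 1" "s \<in> convex hull (p ` M)" by blast
  have "convex hull (p ` M) face_of convex hull (p ` N)"
    unfolding face_of_convex_hull_affine_independent[OF affine_independent_p] using M by blast
  moreover have "aff_dim (convex hull (p ` M)) = int n - 2"
  proof -
    have "\<not> affine_dependent (p ` M)" using M affine_independent_p affine_dependent_subset by blast
    then have "int (card (p ` M)) = aff_dim (p ` M) + 1" by (rule aff_dim_affine_independent)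
    moreover have "card (p ` M) = n - 1" using card_image[OF inj_on_subset[OF inj_p M(1)]] M(2) by simp
    ultimately show ?thesis using n2 by (simp add: aff_dim_convex_hull of_nat_diff)
  qed
  ultimately show "s \<in> skeleton (int n - 2) (convex hull (p ` N))"
    using M(3) unfolding skeleton_def by blast
qed

text \<open>On the face that omits the vertices i and j, the products with \<open>p i\<close> and
  \<open>p j\<close> take the value -1/n, the least one possible on the simplex, so these two tie.
  Conversely, a tie at i and j leaves frame coefficients that can be shifted to be nonnegative and
  supported on the other vertices.\<close>

lemma cone_over_skeleton: "cone_over (skeleton (int n - 2) (convex hull (p ` N))) = walls"
proof (intro equalityI subsetI)
  fix x assume "x \<in> cone_over (skeleton (int n - 2) (convex hull (p ` N)))"
  then obtain v where v: "x \<in> half_line v" "half_line v \<inter> skeleton (int n - 2) (convex hull (p ` N)) \<noteq> {}"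
    unfolding cone_over_def by blast
  then obtain t s t' where ts: "t \<ge> 0" "x = t *\<^sub>R v" "t' \<ge> 0" "s = t' *\<^sub>R v"
    "s \<in> skeleton (int n - 2) (convex hull (p ` N))" unfolding half_line_def by blast
  then obtain M where M: "M \<subseteq> N" "card M = n - 1" "s \<in> convex hull (p ` M)"
    using skeleton_simplex by blast
  have "card (N - M) = 2" using M card_N n2 by (subst card_Diff_subset) (auto intro: finite_subset)
  then obtain i j where ij: "N - M = {i, j}" "i \<noteq> j" by (auto simp: card_2_iff)
  have eq: "p l \<bullet> s = - 1 / n" if l: "l \<in> N - M" for l
  proof -
    have "convex hull (p ` M) \<subseteq> {z. p l \<bullet> z = - 1 / n}"
      by (rule hull_minimal) (use l M gram_N in \<open>auto simp: convex_hyperplane\<close>)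
    then show ?thesis using M(3) by auto
  qed
  have ge: "p k \<bullet> s \<ge> - 1 / n" if k: "k \<in> N" for k
  proof -
    have "convex hull (p ` M) \<subseteq> {z. p k \<bullet> z \<ge> - 1 / n}"
    proof (rule hull_minimal)
      show "p ` M \<subseteq> {z. - 1 / n \<le> p k \<bullet> z}"
      proof clarify
        fix l assume "l \<in> M"
        then have "p k \<bullet> p l = (if k = l then 1 else - 1 / n)" using M(1) k by (intro gram_N) auto
        moreover have "- 1 / real n \<le> 1" by (rule order_trans[of _ 0]) auto
        ultimately show "- 1 / n \<le> p k \<bullet> p l" by simp
      qed
    qed (simp add: convex_halfspace_ge)
    then show ?thesis using M(3) by auto
  qed
  have "s \<noteq> 0" using eq[of i] ij n2 by auto
  then have t': "t' > 0" using ts by (cases "t' = 0") auto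
  have xs: "x = (t / t') *\<^sub>R s" using ts t' by simp
  have "p i \<bullet> s = - 1 / n" "p j \<bullet> s = - 1 / n" using eq ij by blast+
  then have "p i \<bullet> x = p j \<bullet> x" unfolding xs by simp
  moreover have "p i \<bullet> x \<le> p k \<bullet> x" if "k \<in> N" for k
  proof -
    have "p i \<bullet> s \<le> p k \<bullet> s" using ge[OF that] \<open>p i \<bullet> s = - 1 / n\<close> by simp
    then have "(t / t') * (p i \<bullet> s) \<le> (t / t') * (p k \<bullet> s)" using ts t' by (intro mult_left_mono) auto
    then show ?thesis unfolding xs by simp
  qed
  moreover have "i \<in> N" "j \<in> N" using ij by auto
  ultimately show "x \<in> walls" unfolding walls_def using ij(2) by blast
next
  fix x assume "x \<in> walls"
  then obtain i j where ij: "i \<in> N" "j \<in> N" "i \<noteq> j" "p i \<bullet> x = p j \<bullet> x" "\<And>k. k \<in> N \<Longrightarrow> p i \<bullet> x \<le> p k \<bullet> x"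
    unfolding walls_def by blast
  show "x \<in> cone_over (skeleton (int n - 2) (convex hull (p ` N)))"
  proof (cases "x = 0")
    case True
    \<comment> \<open>The origin lies on every half-line, so any point of the skeleton serves as a
      witness; n \<ge> 2 makes this vertex set nonempty.\<close>
    have "p 1 \<in> convex hull (p ` {1..n-1})" using n2 by (intro hull_inc) auto
    moreover have "{1..n-1} \<subseteq> N" "card {1..n-1} = n - 1" by (auto simp: N_def)
    ultimately have "p 1 \<in> skeleton (int n - 2) (convex hull (p ` N))" using skeleton_simplex by blast
    moreover have "p 1 \<in> half_line (p 1)" "x \<in> half_line (p 1)"
      unfolding half_line_def using True by (force intro: exI[of _ 1], force intro: exI[of _ 0])
    moreover have "p 1 \<noteq> 0" using norm_p[of 1] by (auto simp: N_def)
    ultimately show ?thesis unfolding cone_over_def by blast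
  next
    case False
    \<comment> \<open>Frame coefficients minus the smallest one. As the vertices sum to zero, a
      common shift leaves the represented point unchanged.\<close>
    define c where "c k = n / (n + 1) * (p k \<bullet> x - p i \<bullet> x)" for k
    have c0: "c k \<ge> 0" if "k \<in> N" for k using ij(5)[OF that] n2 by (simp add: c_def)
    have "x = (\<Sum>k\<in>N. (n / (n + 1) * (p k \<bullet> x)) *\<^sub>R p k) - (n / (n + 1) * (p i \<bullet> x)) *\<^sub>R (\<Sum>k\<in>N. p k)"
      using frame[of x] sum_p by simp
    also have "\<dots> = (\<Sum>k\<in>N. c k *\<^sub>R p k)"
      by (simp add: c_def scaleR_sum_right sum_subtractf[symmetric] algebra_simps)
    also have "\<dots> = (\<Sum>k\<in>N - {i, j}. c k *\<^sub>R p k)"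
      by (rule sum.mono_neutral_right) (use ij in \<open>auto simp: c_def\<close>)
    finally have x: "x = (\<Sum>k\<in>N - {i, j}. c k *\<^sub>R p k)" .
    define C where "C = (\<Sum>k\<in>N - {i, j}. c k)"
    have "C \<ge> 0" unfolding C_def by (intro sum_nonneg c0) auto
    moreover have "C \<noteq> 0"
    proof
      assume "C = 0"
      then have "\<forall>k\<in>N - {i, j}. c k = 0" unfolding C_def by (subst (asm) sum_nonneg_eq_0_iff) (auto intro: c0)
      then have "x = 0" by (subst x) (auto intro: sum.neutral)
      with False show False ..
    qed
    ultimately have C: "C > 0" by simp
    have "(\<Sum>k\<in>N - {i, j}. (c k / C) *\<^sub>R p k) \<in> convex hull (p ` (N - {i, j}))"
      by (rule convex_sum) (use C c0 in \<open>auto simp: C_def[symmetric] sum_divide_distrib[symmetric] intro: hull_inc\<close>)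
    moreover have "(\<Sum>k\<in>N - {i, j}. (c k / C) *\<^sub>R p k) = (1 / C) *\<^sub>R x"
      by (subst x) (simp add: scaleR_sum_right)
    moreover have "card (N - {i, j}) = n - 1"
      using ij by (subst card_Diff_subset) (auto simp: card_N)
    ultimately have "(1 / C) *\<^sub>R x \<in> skeleton (int n - 2) (convex hull (p ` N))"
      using skeleton_simplex by auto
    moreover have "(1 / C) *\<^sub>R x \<in> half_line x" "x \<in> half_line x"
      unfolding half_line_def using C by (auto intro: exI[of _ "1/C"] exI[of _ 1])
    ultimately show ?thesis using False unfolding cone_over_def by blast
  qed
qed

end

lemma simplex_frame_vertex:
  assumes "CARD('n) \<ge> 2"
  shows "simplex_frame CARD('n) (simplex_vertex :: nat \<Rightarrow> real^'n::{finite,linorder})"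
  by unfold_locales (use assms simplex_vertex_gram[where 'n='n] in auto)


section \<open>Cells, walls and the calibration\<close>

lemma harea_null_UN:
  assumes "countable I" "\<And>i. i \<in> I \<Longrightarrow> B i \<in> sets borel" "\<And>i. i \<in> I \<Longrightarrow> harea (B i) = 0"
  shows "harea (\<Union>i\<in>I. B i) = 0"
proof -
  have "(\<Union>i\<in>I. B i) \<in> null_sets area"
    using assms by (intro null_sets_UN') (auto simp: null_sets_def emeasure_area)
  then show ?thesis
    by (auto simp: null_sets_def emeasure_area)
qed

lemma harea_null_mono: "A \<subseteq> B \<Longrightarrow> harea B = 0 \<Longrightarrow> harea A = 0"
  using harea_mono[of A B] by simp

lemma perp_scaleR: "c \<noteq> 0 \<Longrightarrow> perp (c *\<^sub>R a) = perp a"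
  by (auto simp: perp_def)

lemma harea_perp_cball_finite:
  assumes "a \<noteq> 0"
  shows "harea (perp a \<inter> cball 0 r) < top"
  using harea_perp_bounded[of "a /\<^sub>R norm a" r] perp_scaleR[of "inverse (norm a)" a] assms by simp

text \<open>Infinitely many disjoint translates of a bounded piece of \<open>perp a \<inter> perp b\<close> fit into a bounded
  piece of \<open>perp a\<close>, which has finite measure.\<close>

lemma harea_codim_two:
  fixes a b :: "'a::euclidean_space"
  assumes ab: "(a \<bullet> b)\<^sup>2 < (a \<bullet> a) * (b \<bullet> b)"
  shows "harea (perp a \<inter> perp b) = 0"
proof -
  have a0: "a \<noteq> 0" using ab by auto
  \<comment> \<open>A multiple of the component of \<open>b\<close> orthogonal to \<open>a\<close>.
    Translating along \<open>v\<close> stays in \<open>perp a\<close> and leaves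
    \<open>perp b\<close>; the hypothesis is strict Cauchy-Schwarz and makes
    \<open>v \<bullet> b\<close> positive.\<close>
  define v where "v = (a \<bullet> a) *\<^sub>R b - (a \<bullet> b) *\<^sub>R a"
  have va: "v \<bullet> a = 0"
    unfolding v_def inner_diff_left inner_scaleR_left inner_commute[of b a] by simp
  have vb: "v \<bullet> b > 0"
    using ab unfolding v_def inner_diff_left inner_scaleR_left power2_eq_square by simp
  have Zr: "harea (perp a \<inter> perp b \<inter> cball 0 r) = 0" for r
  proof -
    define Z where "Z = perp a \<inter> perp b \<inter> cball 0 r"
    define T where "T m = (\<lambda>x. (1 / real (Suc m)) *\<^sub>R v + x) ` Z" for m
    have "compact Z" unfolding Z_def using closed_perp by (intro closed_Int_compact closed_Int) auto
    then have cT: "compact (T m)" for m unfolding T_def by (rule compact_translation)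
    have hT: "harea (T m) = harea Z" for m unfolding T_def by (rule harea_isometry) simp
    have "disjoint_family T"
      unfolding disjoint_family_on_def
    proof (intro ballI impI equals0I)
      fix k m x assume "k \<noteq> m" and x: "x \<in> T k \<inter> T m"
      have "y \<bullet> b = (1 / real (Suc l)) * (v \<bullet> b)" if "y \<in> T l" for y l
        using that by (auto simp: T_def Z_def perp_def inner_add_left)
      then have "x \<bullet> b = (1 / real (Suc k)) * (v \<bullet> b)" "x \<bullet> b = (1 / real (Suc m)) * (v \<bullet> b)"
        using x by blast+
      then have "1 / real (Suc k) = 1 / real (Suc m)" using vb by (metis mult_right_cancel less_irrefl)
      then show False using \<open>k \<noteq> m\<close> by simp
    qed
    moreover have "T m \<in> sets borel" for m using cT by (rule borel_compact)
    ultimately have "(\<Sum>m. harea (T m)) = harea (\<Union>m. T m)"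
      using suminf_emeasure[of T area] emeasure_area[of "\<Union>m. T m"]
      by (simp add: emeasure_area image_subset_iff sets.countable_UN)
    also have "(\<Union>m. T m) \<subseteq> perp a \<inter> cball 0 (norm v + \<bar>r\<bar>)"
    proof (rule UN_least, rule subsetI)
      fix m y assume "y \<in> T m"
      then obtain x where x: "x \<in> Z" "y = (1 / real (Suc m)) *\<^sub>R v + x" by (auto simp: T_def)
      have "norm y \<le> (1 / real (Suc m)) * norm v + norm x" using norm_triangle_ineq[of "(1 / real (Suc m)) *\<^sub>R v" x] x(2) by simp
      also have "(1 / real (Suc m)) * norm v \<le> 1 * norm v" by (intro mult_right_mono) auto
      finally have "norm y \<le> norm v + \<bar>r\<bar>" using x by (auto simp: Z_def)
      moreover have "y \<bullet> a = 0" using x va by (simp add: Z_def perp_def inner_add_left)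
      ultimately show "y \<in> perp a \<inter> cball 0 (norm v + \<bar>r\<bar>)" by (simp add: perp_def)
    qed
    then have "harea (\<Union>m. T m) \<le> harea (perp a \<inter> cball 0 (norm v + \<bar>r\<bar>))" by (rule harea_mono)
    also have "\<dots> < top" by (rule harea_perp_cball_finite[OF a0])
    finally have "(\<Sum>m::nat. harea Z) < top" by (simp add: hT)
    moreover have "harea Z < top"
      using harea_perp_cball_finite[OF a0, of r] harea_mono[of Z "perp a \<inter> cball 0 r"]
      by (auto simp: Z_def intro: le_less_trans)
    then obtain c where c: "harea Z = ennreal c" "c \<ge> 0" by (cases "harea Z") auto
    ultimately have "summable (\<lambda>_::nat. c)"
      by (intro summable_suminf_not_top) auto
    then have "c = 0" by (simp add: summable_const_iff)
    then show ?thesis using c by (simp add: Z_def)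
  qed
  have "perp a \<inter> perp b = (\<Union>r\<in>(UNIV::nat set). perp a \<inter> perp b \<inter> cball 0 (real r))"
    using real_arch_simple[where 'a=real] by auto
  moreover have "harea (\<Union>r\<in>(UNIV::nat set). perp a \<inter> perp b \<inter> cball 0 (real r)) = 0"
    by (rule harea_null_UN) (auto simp: Zr)
  ultimately show ?thesis by simp
qed

context simplex_frame
begin

text \<open>The inward unit normal of the half-space, since the first vertex points straight out of
  it.\<close>

definition u :: 'a where "u = - p 1"

lemma one_N: "1 \<in> N" and two_N: "2 \<in> N" and zero_not_N: "0 \<notin> N"
  using n2 by (auto simp: N_def)

lemma norm_u: "norm u = 1" and u_u: "u \<bullet> u = 1"
  using norm_p[OF one_N] gram_N[OF one_N one_N] by (simp_all add: u_def)

lemma inner_u: "x \<bullet> u = - (p 1 \<bullet> x)"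
  by (simp add: u_def inner_commute)

text \<open>The open cone over the facet opposite to \<open>p i\<close>, centred on
  \<open>- p i\<close>. In particular the first cell is centred on \<open>u\<close>.\<close>

definition cell :: "nat \<Rightarrow> 'a set" where
  "cell i = {x. \<forall>k\<in>N - {i}. p i \<bullet> x < p k \<bullet> x}"

definition closed_cell :: "nat \<Rightarrow> 'a set" where
  "closed_cell i = {x. \<forall>k\<in>N. p i \<bullet> x \<le> p k \<bullet> x}"

lemma open_cell: "open (cell i)"
proof -
  have "cell i = (\<Inter>k\<in>N - {i}. {x. p i \<bullet> x < p k \<bullet> x})" by (auto simp: cell_def)
  then show ?thesis by (auto intro!: open_INT open_Collect_less continuous_intros)
qed

lemma closed_closed_cell: "closed (closed_cell i)"
proof -
  have "closed_cell i = (\<Inter>k\<in>N. {x. p i \<bullet> x \<le> p k \<bullet> x})" by (auto simp: closed_cell_def)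
  then show ?thesis by (auto intro!: closed_INT closed_Collect_le continuous_intros)
qed

lemma cell_subset_closed_cell: "cell i \<subseteq> closed_cell i"
proof
  fix x assume x: "x \<in> cell i"
  have "p i \<bullet> x \<le> p k \<bullet> x" if "k \<in> N" for k
    using x that by (cases "k = i") (auto simp: cell_def intro: less_imp_le)
  then show "x \<in> closed_cell i" by (simp add: closed_cell_def)
qed

lemma cell_disjoint_closed_cell:
  assumes "i \<in> N" "j \<in> N" "i \<noteq> j"
  shows "cell i \<inter> closed_cell j = {}"
proof (rule equals0I)
  fix x assume "x \<in> cell i \<inter> closed_cell j"
  then have "p i \<bullet> x < p j \<bullet> x" "p j \<bullet> x \<le> p i \<bullet> x" using assms by (auto simp: cell_def closed_cell_def)
  then show False by simp
qed

lemma walls_eq: "walls = (\<Union>i\<in>N. \<Union>j\<in>N - {i}. closed_cell i \<inter> closed_cell j)"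
proof (intro equalityI subsetI)
  fix x assume "x \<in> walls"
  then obtain i j where "i \<in> N" "j \<in> N" "i \<noteq> j" "p i \<bullet> x = p j \<bullet> x" "\<forall>k\<in>N. p i \<bullet> x \<le> p k \<bullet> x"
    unfolding walls_def by blast
  then have "i \<in> N" "j \<in> N - {i}" "x \<in> closed_cell i \<inter> closed_cell j" by (auto simp: closed_cell_def)
  then show "x \<in> (\<Union>i\<in>N. \<Union>j\<in>N - {i}. closed_cell i \<inter> closed_cell j)" by blast
next
  fix x assume "x \<in> (\<Union>i\<in>N. \<Union>j\<in>N - {i}. closed_cell i \<inter> closed_cell j)"
  then obtain i j where ij: "i \<in> N" "j \<in> N" "i \<noteq> j" "x \<in> closed_cell i" "x \<in> closed_cell j" by blast
  then have "p i \<bullet> x = p j \<bullet> x" by (auto simp: closed_cell_def intro: antisym)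
  then show "x \<in> walls" using ij unfolding walls_def closed_cell_def by blast
qed

lemma closed_walls: "closed walls"
  unfolding walls_eq by (intro closed_UN finite_N finite_Diff ballI closed_Int closed_closed_cell)

lemma closed_cell_diff_walls: "i \<in> N \<Longrightarrow> x \<in> closed_cell i \<Longrightarrow> x \<notin> walls \<Longrightarrow> x \<in> cell i"
  unfolding cell_def walls_def closed_cell_def by (force simp: less_le)

lemma cell_disjoint_walls: "i \<in> N \<Longrightarrow> cell i \<inter> walls = {}"
proof (rule equals0I)
  fix x assume i: "i \<in> N" and x: "x \<in> cell i \<inter> walls"
  then obtain j k where "j \<in> N" "k \<in> N" "j \<noteq> k" "x \<in> closed_cell j" "x \<in> closed_cell k"
    unfolding walls_eq by blast
  then show False using cell_disjoint_closed_cell[OF i, of j] cell_disjoint_closed_cell[OF i, of k] x by blast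
qed

lemma exists_closed_cell: "\<exists>i\<in>N. x \<in> closed_cell i"
proof -
  have "Min ((\<lambda>k. p k \<bullet> x) ` N) \<in> (\<lambda>k. p k \<bullet> x) ` N" using one_N by (intro Min_in) auto
  then obtain i where i: "i \<in> N" "p i \<bullet> x = Min ((\<lambda>k. p k \<bullet> x) ` N)" by auto
  then have "x \<in> closed_cell i" by (auto simp: closed_cell_def)
  with i show ?thesis by blast
qed

lemma exists_cell: "x \<notin> walls \<Longrightarrow> \<exists>i\<in>N. x \<in> cell i"
  using exists_closed_cell closed_cell_diff_walls by blast

text \<open>Here \<open>p 1 \<bullet> x\<close> is the least of n+1 numbers with sum zero. It is
  therefore nonpositive, and it vanishes only if all of them do.\<close>

lemma closed_cell_1:
  assumes x: "x \<in> closed_cell 1"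
  shows "x \<bullet> u \<ge> 0" "x \<bullet> u = 0 \<Longrightarrow> x = 0"
proof -
  have le: "p 1 \<bullet> x \<le> p k \<bullet> x" if "k \<in> N" for k using x that by (simp add: closed_cell_def)
  have "(\<Sum>k\<in>N. p 1 \<bullet> x) \<le> (\<Sum>k\<in>N. p k \<bullet> x)" by (intro sum_mono le)
  then have "p 1 \<bullet> x \<le> 0" unfolding sum_p_inner by (simp add: card_N mult_le_0_iff)
  then show "x \<bullet> u \<ge> 0" by (simp add: inner_u)
  assume "x \<bullet> u = 0"
  then have "p 1 \<bullet> x = 0" by (simp add: inner_u)
  then have "p k \<bullet> x = 0" if "k \<in> N" for k
    using le sum_p_inner[of x] that by (simp add: sum_nonneg_eq_0_iff)
  then show "x = 0" by (intro orthogonal_p_zero) (simp add: inner_commute)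
qed

definition E :: "'a set" where "E = walls \<inter> {x. x \<bullet> u \<ge> 0}"

lemma closed_E: "closed E"
  unfolding E_def by (intro closed_Int closed_walls closed_Collect_le continuous_intros)

lemma inner_p_diff:
  assumes "i \<in> N" "j \<in> N" "i \<noteq> j"
  shows "(p i - p j) \<bullet> (p i - p j) = 2 * (1 + 1 / n)"
  using gram_N assms by (simp add: inner_diff_left inner_diff_right)

lemma p_diff_nonzero: "i \<in> N \<Longrightarrow> j \<in> N \<Longrightarrow> i \<noteq> j \<Longrightarrow> p i - p j \<noteq> 0"
  using inj_p by (auto simp: inj_on_def)

lemma closed_cells_perp: "i \<in> N \<Longrightarrow> j \<in> N \<Longrightarrow> x \<in> closed_cell i \<Longrightarrow> x \<in> closed_cell j \<Longrightarrow> x \<in> perp (p i - p j)"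
  by (auto simp: closed_cell_def perp_def inner_diff_right inner_commute intro: antisym)

lemma walls_subset_perp: "walls \<subseteq> (\<Union>(i, j)\<in>{(i, j). i \<in> N \<and> j \<in> N \<and> i \<noteq> j}. perp (p i - p j))"
  unfolding walls_eq using closed_cells_perp by blast

lemma finite_pairs: "finite {(i, j). i \<in> N \<and> j \<in> N \<and> i \<noteq> j}"
  by (rule finite_subset[of _ "N \<times> N"]) auto

lemma harea_walls_cball: "harea (walls \<inter> cball 0 r) < top"
proof -
  let ?P = "{(i, j). i \<in> N \<and> j \<in> N \<and> i \<noteq> j}"
  let ?B = "\<lambda>(i, j). perp (p i - p j) \<inter> cball 0 r"
  have B: "?B q \<in> sets borel" for q by (cases q) auto
  have "harea (walls \<inter> cball 0 r) \<le> harea (\<Union>q\<in>?P. ?B q)"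
    by (rule harea_mono) (use walls_subset_perp in fastforce)
  also have "\<dots> = emeasure area (\<Union>q\<in>?P. ?B q)"
    using B finite_pairs by (intro emeasure_area[symmetric] sets.finite_UN) auto
  also have "\<dots> \<le> (\<Sum>q\<in>?P. emeasure area (?B q))"
    using B finite_pairs by (intro emeasure_subadditive_finite) auto
  also have "\<dots> = (\<Sum>q\<in>?P. harea (?B q))" using B by (intro sum.cong refl emeasure_area) auto
  also have "\<dots> < top"
    using finite_pairs harea_perp_cball_finite[OF p_diff_nonzero] by (subst ennreal_sum_less_top) auto
  finally show ?thesis .
qed

text \<open>The normal \<open>u\<close> is parallel to no wall normal: its product with
  \<open>p i - p j\<close> is at most 1 + 1/n in absolute value, and the square of this is below the
  squared length 2(1 + 1/n) because 1/n < 1. So walls meet the boundary in codimension two, and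
  \<open>E\<close> has no boundary energy.\<close>

lemma harea_E_boundary: "harea (E \<inter> perp u) = 0"
proof -
  let ?P = "{(i, j). i \<in> N \<and> j \<in> N \<and> i \<noteq> j}"
  let ?B = "\<lambda>(i, j). perp u \<inter> perp (p i - p j)"
  have null: "harea (?B q) = 0" if "q \<in> ?P" for q
  proof -
    obtain i j where q: "q = (i, j)" "i \<in> N" "j \<in> N" "i \<noteq> j" using \<open>q \<in> ?P\<close> by auto
    have q0: "0 < 1 / real n" "1 / real n < 1" using n2 by auto
    have "(u \<bullet> (p i - p j))\<^sup>2 \<le> (1 + 1 / n)\<^sup>2"
    proof -
      have "\<bar>u \<bullet> (p i - p j)\<bar> \<le> 1 + 1 / n"
      proof -
        have "p 1 \<bullet> p i = 1 \<or> p 1 \<bullet> p i = - (1 / n)" "p 1 \<bullet> p j = 1 \<or> p 1 \<bullet> p j = - (1 / n)"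
          using gram_N[OF one_N q(2)] gram_N[OF one_N q(3)] by auto
        moreover have "u \<bullet> (p i - p j) = p 1 \<bullet> p j - p 1 \<bullet> p i" by (simp add: u_def inner_diff_right)
        ultimately show ?thesis using q0 by (elim disjE) linarith+
      qed
      then have "\<bar>u \<bullet> (p i - p j)\<bar>\<^sup>2 \<le> (1 + 1 / n)\<^sup>2" by (intro power_mono) auto
      then show ?thesis by simp
    qed
    also have "(1 + 1 / real n)\<^sup>2 < 2 * (1 + 1 / n)"
      unfolding power2_eq_square using q0 by (intro mult_strict_right_mono) linarith+
    finally show ?thesis using q harea_codim_two[of u "p i - p j"] by (simp add: u_u inner_p_diff)
  qed
  have "E \<inter> perp u \<subseteq> (\<Union>q\<in>?P. ?B q)"
    using walls_subset_perp by (fastforce simp: E_def)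
  moreover have "harea (\<Union>q\<in>?P. ?B q) = 0"
    by (rule harea_null_UN) (use null finite_pairs in \<open>auto intro: countable_finite\<close>)
  ultimately show ?thesis by (rule harea_null_mono)
qed

text \<open>Points where three of the products coincide. Away from this null set a point of a wall
  is adjacent to exactly two cells.\<close>

definition triple :: "'a set" where
  "triple = (\<Union>(i, j, k)\<in>{(i, j, k). i \<in> N \<and> j \<in> N \<and> k \<in> N \<and> i \<noteq> j \<and> i \<noteq> k \<and> j \<noteq> k}.
     perp (p i - p j) \<inter> perp (p i - p k))"

lemma triple_borel: "triple \<in> sets borel" and harea_triple: "harea triple = 0"
proof -
  let ?P = "{(i, j, k). i \<in> N \<and> j \<in> N \<and> k \<in> N \<and> i \<noteq> j \<and> i \<noteq> k \<and> j \<noteq> k}"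
  let ?B = "\<lambda>(i, j, k). perp (p i - p j) \<inter> perp (p i - p k)"
  have fin: "finite ?P" by (rule finite_subset[of _ "N \<times> N \<times> N"]) auto
  have B: "?B q \<in> sets borel" for q by (cases q) auto
  have null: "harea (?B q) = 0" if "q \<in> ?P" for q
  proof -
    obtain i j k where q: "q = (i, j, k)" "i \<in> N" "j \<in> N" "k \<in> N" "i \<noteq> j" "i \<noteq> k" "j \<noteq> k"
      using \<open>q \<in> ?P\<close> by auto
    have pos: "1 + 1 / real n > 0" by (simp add: add_pos_nonneg)
    have "(p i - p j) \<bullet> (p i - p k) = 1 + 1 / n"
      using gram_N q by (simp add: inner_diff_left inner_diff_right)
    then have "((p i - p j) \<bullet> (p i - p k))\<^sup>2 = (1 + 1 / n) * (1 + 1 / n)" by (simp add: power2_eq_square)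
    also have "\<dots> < (2 * (1 + 1 / n)) * (2 * (1 + 1 / n))" using pos by (intro mult_strict_mono) auto
    finally show ?thesis using q harea_codim_two[of "p i - p j" "p i - p k"] by (simp add: inner_p_diff)
  qed
  show "triple \<in> sets borel" unfolding triple_def using fin B by (intro sets.finite_UN) auto
  show "harea triple = 0" unfolding triple_def
    by (rule harea_null_UN) (use null B fin in \<open>auto intro: countable_finite\<close>)
qed

text \<open>The paired calibration: the differences \<open>w i - w j\<close> are the unit normals of the walls, and only
  \<open>w 1\<close> has a flux through the boundary of the half-space. Index 0 stands for the complement of the
  half-space.\<close>

definition w :: "nat \<Rightarrow> 'a" where
  "w i = (if i = 0 then 0 else sqrt (n / (2 * (n + 1))) *\<^sub>R ((1 / n) *\<^sub>R u - p i))"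

lemma w_0: "w 0 = 0"
  by (simp add: w_def)

lemma w_diff: "i \<in> N \<Longrightarrow> j \<in> N \<Longrightarrow> w i - w j = sqrt (n / (2 * (n + 1))) *\<^sub>R (p j - p i)"
  using zero_not_N by (auto simp: w_def algebra_simps)

text \<open>The factor in \<open>w\<close> is the reciprocal of the edge length of the
  simplex.\<close>

lemma norm_w_diff:
  assumes "i \<in> N" "j \<in> N" "i \<noteq> j"
  shows "norm (w i - w j) = 1"
proof -
  have nn: "real n > 0" using n2 by simp
  have "(w i - w j) \<bullet> (w i - w j) = (sqrt (n / (2 * (n + 1))))\<^sup>2 * ((p j - p i) \<bullet> (p j - p i))"
    by (simp only: w_diff[OF assms(1,2)] inner_scaleR_left inner_scaleR_right power2_eq_square mult.assoc)
  also have "\<dots> = n / (2 * (n + 1)) * (2 * (1 + 1 / n))"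
    using inner_p_diff[of j i] assms by simp
  also have "1 + 1 / real n = (real n + 1) / n" using nn by (simp add: add_divide_distrib)
  also have "n / (2 * (n + 1)) * (2 * ((real n + 1) / n)) = 1" using nn by simp
  finally show ?thesis by (simp add: norm_eq_sqrt_inner)
qed

definition \<alpha>\<^sub>n :: real where "\<alpha>\<^sub>n = sqrt ((n + 1) / (2 * n))"

text \<open>All vertices but the first have product 1/n with \<open>u\<close>, and the shift by
  \<open>(1 / n) *\<^sub>R u\<close> in \<open>w\<close> cancels exactly this. For the first, with
  product -1, the scaled sum 1 + 1/n remains, whose square after scaling is (n+1)/(2n).\<close>

lemma w_inner_u:
  assumes "i \<in> N"
  shows "w i \<bullet> u = (if i = 1 then \<alpha>\<^sub>n else 0)"
proof -
  have nn: "real n > 0" using n2 by simp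
  have i0: "i \<noteq> 0" using assms zero_not_N by metis
  show ?thesis
  proof (cases "i = 1")
    case True
    have "w i \<bullet> u = sqrt (n / (2 * (n + 1))) * (1 + 1 / n)"
    proof -
      have "p i \<bullet> u = - 1" using True u_u by (simp add: u_def)
      then show ?thesis using i0 by (simp add: w_def inner_diff_left u_u)
    qed
    also have "1 + 1 / real n = (real n + 1) / n" using nn by (simp add: add_divide_distrib)
    also have "sqrt (n / (2 * (n + 1))) * ((real n + 1) / n) = \<alpha>\<^sub>n"
    proof -
      have "(sqrt (n / (2 * (n + 1))) * ((real n + 1) / n))\<^sup>2 = (n + 1) / (2 * n)"
      proof -
        have "(sqrt (n / (2 * (n + 1))))\<^sup>2 = real n / (2 * (real n + 1))" by simp
        then have "(sqrt (n / (2 * (n + 1))) * ((real n + 1) / n))\<^sup>2 = real n / (2 * (real n + 1)) * ((real n + 1) / n)\<^sup>2"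
          by (simp only: power_mult_distrib)
        also have "\<dots> = (n + 1) / (2 * n)"
        proof -
          define a where "a = real n + 1"
          have "real n / (2 * a) * (a / n)\<^sup>2 = a / (2 * n)" using nn by (simp add: power2_eq_square a_def[symmetric] add_pos_pos)
          then show ?thesis by (simp add: a_def add.commute)
        qed
        finally show ?thesis .
      qed
      then show ?thesis unfolding \<alpha>\<^sub>n_def using nn by (intro real_sqrt_unique[symmetric]) auto
    qed
    finally show ?thesis using True by simp
  next
    case False
    then have "p i \<bullet> u = 1 / n" using gram_N[OF one_N assms] by (simp add: u_def inner_commute)
    then show ?thesis using False i0 by (simp add: w_def inner_diff_left u_u)
  qed
qed

end


section \<open>Regions of a competitor\<close>

text \<open>The compact set in the definition of a competitor is replaced by a ball: a point that
  moves, and its image, have norm at most \<open>R\<^sub>0\<close>.\<close>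

locale sliding_homotopy = simplex_frame +
  fixes \<phi> :: "real \<Rightarrow> 'a \<Rightarrow> 'a" and R\<^sub>0 :: real
  assumes continuous_\<phi>: "continuous_on ({0..1} \<times> E) (\<lambda>(t, x). \<phi> t x)"
    and \<phi>_0: "\<And>x. x \<in> E \<Longrightarrow> \<phi> 0 x = x"
    and \<phi>_support: "\<And>t x. t \<in> {0..1} \<Longrightarrow> x \<in> E \<Longrightarrow> \<phi> t x = x \<or> norm x \<le> R\<^sub>0 \<and> norm (\<phi> t x) \<le> R\<^sub>0"
    and \<phi>_half: "\<And>t x. t \<in> {0..1} \<Longrightarrow> x \<in> E \<Longrightarrow> \<phi> t x \<bullet> u \<ge> 0"
    and \<phi>_slide: "\<And>t x. t \<in> {0..1} \<Longrightarrow> x \<in> E \<Longrightarrow> x \<bullet> u = 0 \<Longrightarrow> \<phi> t x \<bullet> u = 0"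
    and R\<^sub>0_pos: "R\<^sub>0 > 0"
begin

definition F :: "'a set" where "F = \<phi> 1 ` E"

lemma F_half: "x \<in> F \<Longrightarrow> x \<bullet> u \<ge> 0"
  using \<phi>_half[of 1] by (auto simp: F_def)

lemma E_half: "x \<in> E \<Longrightarrow> x \<bullet> u \<ge> 0"
  by (simp add: E_def)

lemma F_far: "norm x > R\<^sub>0 \<Longrightarrow> x \<in> F \<longleftrightarrow> x \<in> E"
proof
  assume x: "norm x > R\<^sub>0" "x \<in> F"
  then obtain z where "z \<in> E" "x = \<phi> 1 z" by (auto simp: F_def)
  then show "x \<in> E" using \<phi>_support[of 1 z] x by auto
next
  assume x: "norm x > R\<^sub>0" "x \<in> E"
  then have "\<phi> 1 x = x" using \<phi>_support[of 1 x] by auto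
  then show "x \<in> F" using x by (metis F_def imageI)
qed

text \<open>\<open>F\<close> is the image of a compact part of \<open>E\<close> together with a far
  part on which the final map is the identity.\<close>

lemma closed_F: "closed F"
proof -
  have "F = \<phi> 1 ` (E \<inter> cball 0 (R\<^sub>0 + 1)) \<union> (E \<inter> {x. norm x \<ge> R\<^sub>0 + 1})"
  proof (intro equalityI subsetI)
    fix x assume "x \<in> F"
    then obtain z where z: "z \<in> E" "x = \<phi> 1 z" by (auto simp: F_def)
    show "x \<in> \<phi> 1 ` (E \<inter> cball 0 (R\<^sub>0 + 1)) \<union> (E \<inter> {x. norm x \<ge> R\<^sub>0 + 1})"
    proof (cases "norm z \<le> R\<^sub>0 + 1")
      case False
      then have "x = z" using \<phi>_support[of 1 z] z by auto
      with False z show ?thesis by auto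
    qed (use z in auto)
  next
    fix x assume "x \<in> \<phi> 1 ` (E \<inter> cball 0 (R\<^sub>0 + 1)) \<union> (E \<inter> {x. norm x \<ge> R\<^sub>0 + 1})"
    then show "x \<in> F" using F_far[of x] by (auto simp: F_def)
  qed
  moreover have "compact (\<phi> 1 ` (E \<inter> cball 0 (R\<^sub>0 + 1)))"
  proof (rule compact_continuous_image)
    have "continuous_on E (\<lambda>x. (\<lambda>(t, x). \<phi> t x) (1, x))"
      by (rule continuous_on_compose2[OF continuous_\<phi>]) (auto intro!: continuous_intros)
    then show "continuous_on (E \<inter> cball 0 (R\<^sub>0 + 1)) (\<phi> 1)"
      by (auto intro: continuous_on_subset)
    show "compact (E \<inter> cball 0 (R\<^sub>0 + 1))" by (rule closed_Int_compact[OF closed_E]) simp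
  qed
  moreover have "closed {x::'a. norm x \<ge> R\<^sub>0 + 1}" by (intro closed_Collect_le continuous_intros)
  ultimately show ?thesis using closed_E by (metis closed_Un closed_Int compact_imp_closed)
qed

text \<open>\<open>closed_cell i\<close> plays the role of \<open>C\<close> in
  \<open>sliding_separation\<close>: a point of it off the walls lies in the open cell.\<close>

lemma cells_separated:
  assumes i: "i \<in> N" and j: "j \<in> N" "i \<noteq> j"
    and a: "a \<in> cell i" "a \<bullet> u \<ge> 0" "norm a > R\<^sub>0" and b: "b \<in> cell j" "b \<bullet> u \<ge> 0" "norm b > R\<^sub>0"
  shows "\<not> path_component ({x. x \<bullet> u \<ge> 0} - F) a b"
  unfolding F_def
proof (rule sliding_separation[OF norm_u _ E_half continuous_\<phi> \<phi>_0 \<phi>_support \<phi>_half \<phi>_slide])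
  show "2 \<le> DIM('a)" using n2 dim_n by simp
  show "closed (closed_cell i)" by (rule closed_closed_cell)
  show "\<exists>\<epsilon>>0. \<forall>z\<in>ball x \<epsilon>. 0 \<le> z \<bullet> u \<longrightarrow> z \<in> closed_cell i"
    if "x \<in> closed_cell i" "x \<notin> E" "0 \<le> x \<bullet> u" for x
  proof -
    have "x \<in> cell i" using closed_cell_diff_walls[OF i that(1)] that by (auto simp: E_def)
    then obtain \<epsilon> where "\<epsilon> > 0" "ball x \<epsilon> \<subseteq> cell i" using open_cell open_contains_ball by blast
    then show ?thesis using cell_subset_closed_cell by blast
  qed
  show "a \<in> closed_cell i" using a cell_subset_closed_cell by blast
  show "a \<notin> E" using a cell_disjoint_walls[OF i] by (auto simp: E_def)
  show "b \<notin> closed_cell i" using b cell_disjoint_closed_cell[OF j(1) i] j(2) by blast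
qed (use a b in auto)

text \<open>The first closed cell lies in the half-space, so even its frontier in the whole space is
  part of \<open>E\<close>. This allows any uncovered boundary point as the end point, near or
  far.\<close>

lemma cell_1_separated:
  assumes a: "a \<in> cell 1" "norm a > R\<^sub>0" and b: "b \<bullet> u = 0" "b \<notin> F"
  shows "\<not> path_component ({x. x \<bullet> u \<ge> 0} - F) a b"
  unfolding F_def
proof (rule sliding_separation_boundary[OF norm_u _ continuous_\<phi> \<phi>_0 \<phi>_support \<phi>_half])
  show "2 \<le> DIM('a)" using n2 dim_n by simp
  show "closed (closed_cell 1)" by (rule closed_closed_cell)
  show "frontier (closed_cell 1) \<subseteq> E"
  proof
    fix x assume x: "x \<in> frontier (closed_cell 1)"
    then have xc: "x \<in> closed_cell 1" using closed_closed_cell frontier_subset_closed by blast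
    have "x \<in> walls"
    proof (rule ccontr)
      assume "x \<notin> walls"
      then have "x \<in> cell 1" using closed_cell_diff_walls[OF one_N xc] by blast
      then have "x \<in> interior (closed_cell 1)"
        using open_cell cell_subset_closed_cell interior_maximal by blast
      then show False using x by (simp add: frontier_def)
    qed
    then show "x \<in> E" using closed_cell_1(1)[OF xc] by (simp add: E_def)
  qed
  show "a \<in> closed_cell 1" using a cell_subset_closed_cell by blast
  show "a \<notin> E" using a cell_disjoint_walls[OF one_N] by (auto simp: E_def)
  show "b \<notin> \<phi> 1 ` E" using b by (simp add: F_def)
qed (use a b closed_cell_1 in auto)

definition O\<^sub>F :: "'a set" where "O\<^sub>F = {x. x \<bullet> u > 0} - F"

lemma open_O\<^sub>F: "open O\<^sub>F"
  unfolding O\<^sub>F_def by (intro open_Diff closed_F open_Collect_less continuous_intros)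

text \<open>The components of the complement of \<open>F\<close> that can be entered from far out in
  cell i. Taking the union over all far points makes it unnecessary to know that the far part of a
  cell is connected.\<close>

definition reach :: "nat \<Rightarrow> 'a set" where
  "reach i = {x. \<exists>a. a \<in> cell i \<and> norm a > R\<^sub>0 \<and> connected_component O\<^sub>F a x}"

text \<open>The second region also receives everything that cannot be connected to infinity; its vector
  \<open>w 2\<close> has no flux through the boundary, so this costs nothing.\<close>

definition V\<^sub>F :: "nat \<Rightarrow> 'a set" where
  "V\<^sub>F i = (if i = 0 then {x. x \<bullet> u < 0} else if i = 2 then O\<^sub>F - (\<Union>j\<in>N - {2}. reach j) else reach i)"

lemma reach_subset: "reach i \<subseteq> O\<^sub>F"
  unfolding reach_def using connected_component_in by blast

lemma open_reach: "open (reach i)"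
proof -
  have "reach i = (\<Union>a\<in>{a. a \<in> cell i \<and> norm a > R\<^sub>0}. connected_component_set O\<^sub>F a)"
    by (auto simp: reach_def)
  then show ?thesis using open_connected_component[OF open_O\<^sub>F] by auto
qed

lemma reach_component: "x \<in> reach i \<Longrightarrow> connected_component O\<^sub>F x y \<Longrightarrow> y \<in> reach i"
  unfolding reach_def using connected_component_trans by blast

lemma path_component_O\<^sub>F:
  "connected_component O\<^sub>F a b \<Longrightarrow> path_component ({x. x \<bullet> u \<ge> 0} - F) a b"
proof -
  assume "connected_component O\<^sub>F a b"
  then have "path_component O\<^sub>F a b" by (simp add: open_path_connected_component[OF open_O\<^sub>F])
  moreover have "O\<^sub>F \<subseteq> {x. x \<bullet> u \<ge> 0} - F" by (auto simp: O\<^sub>F_def)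
  ultimately show "path_component ({x. x \<bullet> u \<ge> 0} - F) a b" by (rule path_component_of_subset[rotated])
qed

lemma reach_disjoint:
  assumes "i \<in> N" "j \<in> N" "i \<noteq> j"
  shows "reach i \<inter> reach j = {}"
proof (rule equals0I)
  fix x assume "x \<in> reach i \<inter> reach j"
  then obtain a b where ab: "a \<in> cell i" "norm a > R\<^sub>0" "connected_component O\<^sub>F a x"
    "b \<in> cell j" "norm b > R\<^sub>0" "connected_component O\<^sub>F b x" by (auto simp: reach_def)
  then have "connected_component O\<^sub>F a b"
    using connected_component_sym connected_component_trans by metis
  moreover have "a \<in> O\<^sub>F" "b \<in> O\<^sub>F" using ab(3,6) connected_component_in by blast+
  ultimately show False
    using cells_separated[OF assms ab(1) _ ab(2) ab(4) _ ab(5)] path_component_O\<^sub>F by (auto simp: O\<^sub>F_def)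
qed

lemma reach_far:
  assumes i: "i \<in> N" and x: "norm x > R\<^sub>0" "x \<bullet> u > 0"
  shows "x \<in> reach i \<longleftrightarrow> x \<in> cell i"
proof
  assume xi: "x \<in> reach i"
  then have "x \<in> O\<^sub>F" using reach_subset by blast
  then have "x \<notin> walls" using F_far[OF x(1)] x(2) by (auto simp: O\<^sub>F_def E_def)
  then obtain j where j: "j \<in> N" "x \<in> cell j" using exists_cell by blast
  have "x \<in> reach j" using j x \<open>x \<in> O\<^sub>F\<close> by (auto simp: reach_def intro!: exI[of _ x])
  then have "i = j" using reach_disjoint[OF i j(1)] xi by blast
  then show "x \<in> cell i" using j by simp
next
  assume xi: "x \<in> cell i"
  then have "x \<notin> F" using F_far[OF x(1)] cell_disjoint_walls[OF i] by (auto simp: E_def)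
  then have "x \<in> O\<^sub>F" using x by (simp add: O\<^sub>F_def)
  then show "x \<in> reach i" using xi x by (auto simp: reach_def intro!: exI[of _ x])
qed

text \<open>Far out the regions of \<open>F\<close> are the cells cut by the half-space. This is
  what gives both sets the same flux against a cutoff whose gradient is supported there.\<close>

lemma V\<^sub>F_far:
  assumes i: "i \<in> N" and x: "norm x > R\<^sub>0"
  shows "x \<in> V\<^sub>F i \<longleftrightarrow> x \<in> cell i \<and> x \<bullet> u > 0"
proof (cases "x \<bullet> u > 0")
  case False
  then show ?thesis using i zero_not_N reach_subset[of i] by (auto simp: V\<^sub>F_def O\<^sub>F_def)
next
  case True
  note far = reach_far[OF _ x True]
  show ?thesis
  proof (cases "i = 2")
    case False
    then show ?thesis using far[OF i] True i zero_not_N by (auto simp: V\<^sub>F_def)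
  next
    case i2: True
    have "x \<in> V\<^sub>F 2 \<longleftrightarrow> x \<in> O\<^sub>F \<and> (\<forall>j\<in>N - {2}. x \<notin> cell j)"
      using far by (auto simp: V\<^sub>F_def)
    also have "\<dots> \<longleftrightarrow> x \<in> cell 2"
    proof
      assume h: "x \<in> O\<^sub>F \<and> (\<forall>j\<in>N - {2}. x \<notin> cell j)"
      then have "x \<notin> walls" using F_far[OF x] True by (auto simp: O\<^sub>F_def E_def)
      then show "x \<in> cell 2" using exists_cell h by blast
    next
      assume c: "x \<in> cell 2"
      then have "x \<in> O\<^sub>F" using far[OF two_N] reach_subset by blast
      then show "x \<in> O\<^sub>F \<and> (\<forall>j\<in>N - {2}. x \<notin> cell j)"
        using c cell_disjoint_closed_cell[OF two_N] cell_subset_closed_cell by blast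
    qed
    finally show ?thesis using i2 True by simp
  qed
qed

lemma V\<^sub>F_pos: "i \<in> N \<Longrightarrow> V\<^sub>F i \<subseteq> {x. x \<bullet> u > 0}"
  using reach_subset[of i] zero_not_N by (auto simp: V\<^sub>F_def O\<^sub>F_def)

text \<open>The second region is what remains of the open set \<open>O\<^sub>F\<close> after
  removing whole components, hence itself a union of components.\<close>

lemma open_V\<^sub>F: "open (V\<^sub>F i)"
proof -
  have "open (O\<^sub>F - (\<Union>j\<in>N - {2}. reach j))"
  proof -
    have "O\<^sub>F - (\<Union>j\<in>N - {2}. reach j) = (\<Union>x\<in>O\<^sub>F - (\<Union>j\<in>N - {2}. reach j). connected_component_set O\<^sub>F x)"
    proof (intro equalityI subsetI)
      fix x assume "x \<in> O\<^sub>F - (\<Union>j\<in>N - {2}. reach j)"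
      then show "x \<in> (\<Union>x\<in>O\<^sub>F - (\<Union>j\<in>N - {2}. reach j). connected_component_set O\<^sub>F x)"
        using connected_component_refl by blast
    next
      fix y assume "y \<in> (\<Union>x\<in>O\<^sub>F - (\<Union>j\<in>N - {2}. reach j). connected_component_set O\<^sub>F x)"
      then obtain x where x: "x \<in> O\<^sub>F" "\<And>j. j \<in> N - {2} \<Longrightarrow> x \<notin> reach j" "connected_component O\<^sub>F x y" by auto
      have "connected_component O\<^sub>F y x" using x(3) connected_component_sym by blast
      then have "y \<notin> reach j" if "j \<in> N - {2}" for j using reach_component x(2)[OF that] by blast
      moreover have "y \<in> O\<^sub>F" using x(3) connected_component_in by blast
      ultimately show "y \<in> O\<^sub>F - (\<Union>j\<in>N - {2}. reach j)" by blast
    qed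
    also have "open \<dots>" using open_connected_component[OF open_O\<^sub>F] by auto
    finally show ?thesis .
  qed
  moreover have "open {x::'a. x \<bullet> u < 0}" by (intro open_Collect_less continuous_intros)
  ultimately show ?thesis using open_reach by (simp add: V\<^sub>F_def)
qed

lemma V\<^sub>F_disjoint:
  assumes "i \<in> insert 0 N" "j \<in> insert 0 N" "i \<noteq> j"
  shows "V\<^sub>F i \<inter> V\<^sub>F j = {}"
proof (cases "i = 0 \<or> j = 0")
  case True
  have "V\<^sub>F 0 \<inter> V\<^sub>F k = {}" if "k \<in> N" for k
    using V\<^sub>F_pos[OF that] by (force simp: V\<^sub>F_def[of 0])
  then show ?thesis using assms True by blast
next
  case False
  then have ij: "i \<in> N" "j \<in> N" using assms by auto
  show ?thesis using reach_disjoint[OF ij assms(3)] False ij assms(3) by (auto simp: V\<^sub>F_def)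
qed

lemma V\<^sub>F_cover: "(\<Union>i\<in>insert 0 N. V\<^sub>F i) = - (F \<union> perp u)"
proof -
  have "(\<Union>i\<in>N. V\<^sub>F i) = O\<^sub>F"
  proof (intro equalityI subsetI)
    fix x assume "x \<in> (\<Union>i\<in>N. V\<^sub>F i)"
    then show "x \<in> O\<^sub>F" using reach_subset zero_not_N by (auto simp: V\<^sub>F_def split: if_splits)
  next
    fix x assume x: "x \<in> O\<^sub>F"
    show "x \<in> (\<Union>i\<in>N. V\<^sub>F i)"
    proof (cases "\<exists>j\<in>N - {2}. x \<in> reach j")
      case True
      then obtain j where "j \<in> N" "j \<noteq> 2" "x \<in> reach j" by blast
      then have "x \<in> V\<^sub>F j" using zero_not_N by (auto simp: V\<^sub>F_def)
      then show ?thesis using \<open>j \<in> N\<close> by blast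
    next
      case False
      then have "x \<in> V\<^sub>F 2" using x by (simp add: V\<^sub>F_def)
      then show ?thesis using two_N by blast
    qed
  qed
  moreover have "- (F \<union> perp u) = {x. x \<bullet> u < 0} \<union> O\<^sub>F"
    using F_half by (force simp: O\<^sub>F_def perp_def)
  ultimately show ?thesis by (simp add: V\<^sub>F_def[of 0])
qed

text \<open>Were \<open>b\<close> a limit of the first region, a path from far out in the first cell
  could be completed inside a small half-ball around \<open>b\<close>, which is convex and free of
  \<open>F\<close>. So \<open>w 1\<close> has no flux through boundary points that \<open>F\<close>
  leaves bare.\<close>

lemma V\<^sub>F_1_closure:
  assumes b: "b \<in> perp u" "b \<notin> F"
  shows "b \<notin> closure (V\<^sub>F 1)"
proof
  assume bc: "b \<in> closure (V\<^sub>F 1)"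
  obtain \<epsilon> where \<epsilon>: "\<epsilon> > 0" "ball b \<epsilon> \<subseteq> - F"
    using b(2) closed_F open_contains_ball[of "- F"] by (auto simp: open_Compl)
  then obtain x where x: "x \<in> V\<^sub>F 1" "dist x b < \<epsilon>" using bc by (auto simp: closure_approachable)
  then obtain a where a: "a \<in> cell 1" "norm a > R\<^sub>0" "connected_component O\<^sub>F a x"
    by (auto simp: V\<^sub>F_def reach_def)
  let ?H = "{x. x \<bullet> u \<ge> 0}"
  have "path_component (ball b \<epsilon> \<inter> ?H) x b"
  proof -
    have "?H = {x. u \<bullet> x \<ge> 0}" by (simp add: inner_commute)
    then have "convex (ball b \<epsilon> \<inter> ?H)" by (auto intro!: convex_Int convex_halfspace_ge)
    then have "path_connected (ball b \<epsilon> \<inter> ?H)" by (rule convex_imp_path_connected)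
    moreover have "x \<bullet> u > 0" using V\<^sub>F_pos[OF one_N] x(1) by auto
    ultimately show ?thesis
      using x b(1) \<epsilon>(1) by (auto simp: path_connected_component perp_def dist_commute)
  qed
  then have "path_component (?H - F) x b"
    by (rule path_component_of_subset[rotated]) (use \<epsilon>(2) in auto)
  moreover have "path_component (?H - F) a x" by (rule path_component_O\<^sub>F[OF a(3)])
  ultimately have "path_component (?H - F) a b" by (meson path_component_trans)
  then show False using cell_1_separated[OF a(1,2)] b by (simp add: perp_def)
qed

end


section \<open>Comparison of fluxes\<close>

lemma (in regions) integral_\<nu>:
  fixes g :: "'a \<Rightarrow> real"
  assumes [measurable]: "g \<in> borel_measurable borel"
  shows "(\<integral>x. g x \<partial>\<nu>) = (\<integral>x. indicator X x * g x \<partial>area)"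
proof -
  have "\<nu> = density area (\<lambda>x. ennreal (indicator X x))"
    unfolding \<nu>_def by (rule arg_cong[where f = "density area"]) (simp only: ennreal_indicator)
  then show ?thesis by (subst integral_density[symmetric, of g area "indicator X", simplified]) auto
qed

lemma (in regions) AE_X: "AE x in \<nu>. x \<in> X"
  unfolding \<nu>_def by (subst AE_density) (auto simp: indicator_def)

text \<open>Applied to \<open>E \<union> perp u\<close> and to \<open>F \<union> perp u\<close>.
  Including the lower half-space as region 0 makes the sliding boundary itself an interface, so that
  its flux comes from the same divergence theorem.\<close>

locale calibrated_regions = simplex_frame n p + regions S "{..n+1}" V r
  for n and p :: "nat \<Rightarrow> 'a::euclidean_space" and S :: "'a set" and V :: "nat \<Rightarrow> 'a set" and r +
  assumes V_0: "V 0 = {x. x \<bullet> u < 0}" and V_pos: "\<And>i. i \<in> N \<Longrightarrow> V i \<subseteq> {x. x \<bullet> u > 0}"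
    and S_half: "S \<subseteq> {x. x \<bullet> u \<ge> 0}"
begin

text \<open>The flux density of the calibration through \<open>S\<close>. Where regions i and j meet
  with unit normal \<open>e\<close> pointing into i, it is
  \<open>(w i - w j) \<bullet> e\<close>.\<close>

definition \<delta> :: "'a \<Rightarrow> real" where "\<delta> x = (\<Sum>i\<le>n+1. w i \<bullet> f i x)"

lemma \<delta>_measurable [measurable]: "\<delta> \<in> borel_measurable borel"
  unfolding \<delta>_def[abs_def] by (intro borel_measurable_sum borel_measurable_inner) (auto intro: f_measurable)

lemma \<delta>_bounded: "\<exists>C. \<forall>x. \<bar>\<delta> x\<bar> \<le> C"
proof -
  have nf: "norm (f i x) \<le> (\<Sum>b\<in>(Basis::'a set). 1)" for i x
    unfolding f_def
  proof (rule order_trans[OF norm_sum sum_mono])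
    fix b :: 'a assume "b \<in> Basis"
    then show "norm ((\<theta> b x * jump b i x) *\<^sub>R b) \<le> 1"
      using abs_\<theta>_jump_le[OF norm_Basis, of b x i] by simp
  qed
  have "\<bar>\<delta> x\<bar> \<le> (\<Sum>i\<le>n+1. norm (w i) * (\<Sum>b\<in>(Basis::'a set). 1))" for x
    unfolding \<delta>_def
    by (rule order_trans[OF sum_abs sum_mono])
      (rule order_trans[OF Cauchy_Schwarz_ineq2 mult_left_mono[OF nf norm_ge_zero]])
  then show ?thesis by blast
qed

lemma \<delta>_two:
  assumes "i \<le> n + 1" "j \<le> n + 1" "i \<noteq> j" "\<forall>k\<in>{..n+1} - {i, j}. f k x = 0"
  shows "\<delta> x = w i \<bullet> f i x + w j \<bullet> f j x"
proof -
  have "\<delta> x = (\<Sum>k\<in>{i, j}. w k \<bullet> f k x)"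
    unfolding \<delta>_def by (rule sum.mono_neutral_right) (use assms in auto)
  then show ?thesis using assms(3) by simp
qed

text \<open>The boundary is flat with normal \<open>u\<close>, and the region below carries the zero
  vector; only the region above contributes.\<close>

lemma AE_\<delta>_boundary:
  "AE x in \<nu>. x \<in> ball 0 r \<inter> perp u \<longrightarrow> (\<exists>i\<in>N. on_side u (V i) x \<and> \<delta> x = w i \<bullet> u)"
  using AE_flat[OF norm_u]
proof eventually_elim
  case (elim x)
  show ?case
  proof
    assume x: "x \<in> ball 0 r \<inter> perp u"
    then have xu: "x \<bullet> u = 0" by (simp add: perp_def)
    have side0: "on_side (- u) (V 0) x"
      unfolding on_side_def V_0 by (rule exI[of _ 1]) (simp add: inner_diff_left xu u_u)
    have "both_sides u x" using elim x by blast
    then obtain i where i: "i \<in> {..n+1}" "on_side u (V i) x" unfolding both_sides_def by blast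
    have "i \<noteq> 0"
    proof
      assume "i = 0"
      then obtain \<epsilon> where "\<epsilon> > 0" "\<forall>s. 0 < s \<and> s < \<epsilon> \<longrightarrow> x + s *\<^sub>R u \<in> V 0"
        using i(2) by (auto simp: on_side_def)
      then have "x + (\<epsilon> / 2) *\<^sub>R u \<in> V 0" by simp
      then show False using \<open>\<epsilon> > 0\<close> by (simp add: V_0 inner_add_left xu u_u)
    qed
    then have iN: "i \<in> N" using i(1) by (auto simp: N_def)
    have fi: "f i x = u" and f0: "f 0 x = - u" and z: "\<forall>k\<in>{..n+1} - {i, 0}. f k x = 0"
      using elim x i \<open>i \<noteq> 0\<close> side0 by blast+
    have "\<delta> x = w i \<bullet> f i x + w 0 \<bullet> f 0 x"
      by (rule \<delta>_two) (use i z \<open>i \<noteq> 0\<close> in auto)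
    then show "\<exists>i\<in>N. on_side u (V i) x \<and> \<delta> x = w i \<bullet> u"
      using iN i(2) fi by (auto simp: w_0)
  qed
qed

text \<open>Away from the boundary region 0 has no trace. The two remaining densities are opposite,
  and Cauchy-Schwarz is applied to the unit vector \<open>w i - w j\<close>.\<close>

lemma AE_\<delta>_interior: "AE x in \<nu>. x \<in> ball 0 r - perp u \<longrightarrow> \<delta> x \<le> 1"
  using AE_two_jumps AE_X
proof eventually_elim
  case (elim x)
  show ?case
  proof
    assume x: "x \<in> ball 0 r - perp u"
    have "x \<bullet> u > 0" using x elim S_half by (force simp: X_def perp_def less_le)
    have f0: "f 0 x = 0"
    proof (rule f_outside_closure)
      have "closure (V 0) \<subseteq> {x. x \<bullet> u \<le> 0}"
        by (rule closure_minimal) (auto simp: V_0 intro!: closed_Collect_le continuous_intros)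
      then show "x \<notin> closure (V 0)" using \<open>x \<bullet> u > 0\<close> by auto
    qed
    obtain i j where ij: "i \<in> {..n+1}" "j \<in> {..n+1}" "f i x = - f j x" "norm (f i x) \<le> 1"
      "\<forall>k\<in>{..n+1} - {i, j}. f k x = 0" using elim x by blast
    show "\<delta> x \<le> 1"
    proof (cases "i = j \<or> i = 0 \<or> j = 0")
      case True
      have self: "v = 0" if "v = - v" for v :: 'a
        using that by (simp add: eq_neg_iff_add_eq_0 scaleR_2[symmetric])
      have "f i x = 0" "f j x = 0" using ij(3) f0 True self[of "f i x"] by auto
      then have "f k x = 0" if "k \<le> n + 1" for k using ij(5) that by (cases "k \<in> {i, j}") auto
      then show ?thesis by (simp add: \<delta>_def)
    next
      case False
      then have N: "i \<in> N" "j \<in> N" using ij by (auto simp: N_def)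
      have "\<delta> x = w i \<bullet> f i x + w j \<bullet> f j x" by (rule \<delta>_two) (use ij False in auto)
      also have "\<dots> = (w i - w j) \<bullet> f i x" using ij(3) by (simp add: inner_diff_left)
      also have "\<dots> \<le> norm (w i - w j) * norm (f i x)" by (rule norm_cauchy_schwarz)
      also have "\<dots> \<le> 1" using norm_w_diff[OF N] False ij(4) by simp
      finally show ?thesis .
    qed
  qed
qed

lemma flux:
  assumes "C1_grad \<psi> G" "\<And>x. x \<notin> ball 0 r \<Longrightarrow> \<psi> x = 0"
  shows "area_const TYPE('a) * (\<Sum>i\<le>n+1. \<integral>x. indicator (V i \<inter> ball 0 r) x * (G x \<bullet> w i) \<partial>lborel)
    = - (\<integral>x. \<psi> x * \<delta> x \<partial>\<nu>)"
  unfolding \<delta>_def by (rule integral_divergence[OF assms])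

end

section \<open>Equality of flux and area for the cone\<close>

context simplex_frame
begin

definition V\<^sub>E :: "nat \<Rightarrow> 'a set" where
  "V\<^sub>E i = (if i = 0 then {x. x \<bullet> u < 0} else cell i \<inter> {x. x \<bullet> u > 0})"

lemma insert_0_N: "{..n+1} = insert 0 N"
  by (auto simp: N_def)

lemma harea_Un_finite:
  assumes "harea (A \<inter> cball 0 r) < top" "harea (B \<inter> cball 0 r) < top"
  shows "harea ((A \<union> B) \<inter> cball 0 r) < top"
proof -
  have "harea ((A \<union> B) \<inter> cball 0 r) \<le> harea (A \<inter> cball 0 r) + harea (B \<inter> cball 0 r)"
    unfolding harea_def Int_Un_distrib2 by (rule hausdorff_measure_Un_le)
  also have "\<dots> < top" using assms by simp
  finally show ?thesis .
qed

lemma harea_E_cball: "harea (E \<inter> cball 0 r) < top"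
  by (rule le_less_trans[OF harea_mono harea_walls_cball[of r]]) (auto simp: E_def)

lemma harea_u_cball: "harea (perp u \<inter> cball 0 r) < top"
  by (rule harea_perp_bounded[OF norm_u])

lemma calibrated_E:
  assumes "r > 0"
  shows "calibrated_regions n p (E \<union> perp u) V\<^sub>E r"
proof unfold_locales
  show "closed (E \<union> perp u)" using closed_E closed_perp by (rule closed_Un)
  show "open (V\<^sub>E i)" for i
    unfolding V\<^sub>E_def using open_cell by (auto intro!: open_Int open_Collect_less continuous_intros)
  show "V\<^sub>E i \<inter> V\<^sub>E j = {}" if ij: "i \<in> {..n+1}" "j \<in> {..n+1}" "i \<noteq> j" for i j
  proof (cases "i = 0 \<or> j = 0")
    case False
    then have "i \<in> N" "j \<in> N" using ij by (auto simp: N_def)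
    then have "cell i \<inter> cell j = {}"
      using cell_disjoint_closed_cell[of i j] cell_subset_closed_cell[of j] ij(3) by blast
    then show ?thesis using False by (auto simp: V\<^sub>E_def)
  qed (use ij in \<open>auto simp: V\<^sub>E_def\<close>)
  show "(\<Union>i\<in>{..n+1}. V\<^sub>E i) = - (E \<union> perp u)"
  proof (intro equalityI subsetI)
    fix x assume "x \<in> (\<Union>i\<in>{..n+1}. V\<^sub>E i)"
    then obtain i where i: "i \<in> insert 0 N" "x \<in> V\<^sub>E i" unfolding insert_0_N by blast
    show "x \<in> - (E \<union> perp u)"
    proof (cases "i = 0")
      case False
      then show ?thesis using i cell_disjoint_walls[of i] by (auto simp: V\<^sub>E_def E_def perp_def)
    qed (use i in \<open>auto simp: V\<^sub>E_def E_def perp_def\<close>)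
  next
    fix x assume x: "x \<in> - (E \<union> perp u)"
    then consider "x \<bullet> u < 0" | "x \<bullet> u > 0" "x \<notin> walls" by (force simp: perp_def E_def)
    then show "x \<in> (\<Union>i\<in>{..n+1}. V\<^sub>E i)"
    proof cases
      case 1
      then have "x \<in> V\<^sub>E 0" by (simp add: V\<^sub>E_def)
      then show ?thesis by blast
    next
      case 2
      then obtain i where "i \<in> N" "x \<in> cell i" using exists_cell by blast
      then have "i \<noteq> 0" using zero_not_N by metis
      then have "x \<in> V\<^sub>E i" using 2 \<open>x \<in> cell i\<close> by (simp add: V\<^sub>E_def)
      then show ?thesis using \<open>i \<in> N\<close> unfolding insert_0_N by blast
    qed
  qed
  show "harea ((E \<union> perp u) \<inter> cball 0 r) < top"
    by (rule harea_Un_finite[OF harea_E_cball harea_u_cball])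
  show "V\<^sub>E i \<subseteq> {x. x \<bullet> u > 0}" if "i \<in> N" for i
    using that zero_not_N by (auto simp: V\<^sub>E_def)
  show "E \<union> perp u \<subseteq> {x. x \<bullet> u \<ge> 0}" by (auto simp: E_def perp_def)
qed (use assms in \<open>auto simp: V\<^sub>E_def\<close>)

text \<open>Moving along \<open>w i - w j\<close>, a positive multiple of \<open>p j - p i\<close>,
  lowers the product with \<open>p i\<close>, raises the one with \<open>p j\<close> and keeps all
  others, which are strictly larger off \<open>triple\<close>. Exchanging i and j yields the other
  side.\<close>

lemma on_side_V\<^sub>E:
  assumes i: "i \<in> N" and j: "j \<in> N" "i \<noteq> j"
    and x: "x \<in> closed_cell i" "x \<in> closed_cell j" "x \<notin> triple" "x \<bullet> u > 0"
  shows "on_side (w i - w j) (V\<^sub>E i) x"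
proof -
  define q where "q = sqrt (n / (2 * (n + 1)))"
  have q: "q > 0" using n2 by (simp add: q_def)
  define e where "e = w i - w j"
  have e: "e = q *\<^sub>R (p j - p i)" unfolding e_def q_def by (rule w_diff[OF i j(1)])
  have b: "1 + 1 / real n > 0" by (simp add: add_pos_nonneg)
  have pi: "p i \<bullet> e = - q * (1 + 1 / n)" "p j \<bullet> e = q * (1 + 1 / n)"
    using gram_N[OF i i] gram_N[OF i j(1)] gram_N[OF j(1) j(1)] gram_N[OF j(1) i] j(2)
    by (simp_all add: e inner_diff_right algebra_simps)
  have pk: "p k \<bullet> e = 0" if "k \<in> N" "k \<noteq> i" "k \<noteq> j" for k
    using gram_N[OF that(1) i] gram_N[OF that(1) j(1)] that by (simp add: e inner_diff_right)
  have eq: "p i \<bullet> x = p j \<bullet> x" using x i j by (auto simp: closed_cell_def intro: antisym)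
  have strict: "p i \<bullet> x < p k \<bullet> x" if k: "k \<in> N" "k \<noteq> i" "k \<noteq> j" for k
  proof -
    have "p i \<bullet> x \<le> p k \<bullet> x" using x(1) k(1) by (simp add: closed_cell_def)
    moreover have "p i \<bullet> x \<noteq> p k \<bullet> x"
    proof
      assume "p i \<bullet> x = p k \<bullet> x"
      then have "x \<in> perp (p i - p j) \<inter> perp (p i - p k)"
        using eq by (simp add: perp_def inner_diff_right inner_commute)
      then have "x \<in> triple" unfolding triple_def using i j k by blast
      with x(3) show False ..
    qed
    ultimately show ?thesis by simp
  qed
  have "open ((\<lambda>s. x + s *\<^sub>R e) -` {x. x \<bullet> u > 0})"
    by (intro open_vimage open_Collect_less continuous_intros)
  moreover have "0 \<in> (\<lambda>s. x + s *\<^sub>R e) -` {x. x \<bullet> u > 0}" using x(4) by simp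
  ultimately obtain \<epsilon> where \<epsilon>: "\<epsilon> > 0" "ball 0 \<epsilon> \<subseteq> (\<lambda>s. x + s *\<^sub>R e) -` {x. x \<bullet> u > 0}"
    using open_contains_ball by blast
  have "x + s *\<^sub>R e \<in> V\<^sub>E i" if s: "0 < s" "s < \<epsilon>" for s
  proof -
    have sq: "s * (q * (1 + 1 / n)) > 0" using s q b by simp
    have "p i \<bullet> (x + s *\<^sub>R e) < p k \<bullet> (x + s *\<^sub>R e)" if k: "k \<in> N" "k \<noteq> i" for k
    proof (cases "k = j")
      case True
      then show ?thesis using sq eq pi by (simp add: inner_add_right)
    next
      case False
      then show ?thesis using sq strict[OF k(1,2)] pk[OF k(1,2)] pi by (simp add: inner_add_right)
    qed
    moreover have "s \<in> ball 0 \<epsilon>" using s by simp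
    then have "(x + s *\<^sub>R e) \<bullet> u > 0" using \<epsilon>(2) by blast
    moreover have "i \<noteq> 0" using i zero_not_N by metis
    ultimately show ?thesis using i by (auto simp: V\<^sub>E_def cell_def)
  qed
  then show ?thesis unfolding on_side_def e_def[symmetric] using \<epsilon>(1) by blast
qed

text \<open>The closed first cell touches the boundary at the origin alone, and the origin belongs
  to the cone.\<close>

lemma closure_V\<^sub>E_1: "x \<in> closure (V\<^sub>E 1) \<Longrightarrow> x \<in> perp u \<Longrightarrow> x \<in> E"
proof -
  assume x: "x \<in> closure (V\<^sub>E 1)" "x \<in> perp u"
  have "closure (V\<^sub>E 1) \<subseteq> closed_cell 1"
    by (rule closure_minimal[OF _ closed_closed_cell]) (use cell_subset_closed_cell in \<open>auto simp: V\<^sub>E_def\<close>)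
  then have "x = 0" using closed_cell_1(2)[of x] x by (auto simp: perp_def)
  moreover have "\<exists>i\<in>N. \<exists>j\<in>N. i \<noteq> j"
    by (rule bexI[OF _ one_N], rule bexI[OF _ two_N]) simp
  ultimately show "x \<in> E" by (simp add: E_def walls_def)
qed

text \<open>The cone attains equality: almost everywhere on a wall the normal is exactly
  \<open>w i - w j\<close>, so the density is 1. On the boundary it is 0, since the first region
  touches it only in a null set.\<close>

lemma flux_E:
  fixes \<psi> :: "'a \<Rightarrow> real"
  assumes r: "r > 0" and \<psi>: "C1_grad \<psi> G" "\<And>x. x \<notin> ball 0 r \<Longrightarrow> \<psi> x = 0"
  shows "area_const TYPE('a) * (\<Sum>i\<le>n+1. \<integral>x. indicator (V\<^sub>E i \<inter> ball 0 r) x * (G x \<bullet> w i) \<partial>lborel)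
    = - (\<integral>x. indicator (E - perp u) x * \<psi> x \<partial>area)"
proof -
  interpret E: calibrated_regions n p "E \<union> perp u" V\<^sub>E r by (rule calibrated_E[OF r])
  have [measurable]: "\<psi> \<in> borel_measurable borel"
    using C1_grad_continuous[OF \<psi>(1)] by (rule borel_measurable_continuous_onI)
  have [measurable]: "E \<in> sets borel" using closed_E by simp
  have null_triple: "AE x in E.\<nu>. x \<notin> triple"
  proof -
    have "E.X \<inter> triple \<subseteq> triple" by simp
    then have "emeasure E.\<nu> triple = 0"
      using harea_null_mono[OF _ harea_triple] triple_borel by (simp add: E.emeasure_\<nu>)
    then show ?thesis using triple_borel by (intro AE_not_in) (simp add: null_sets_def)
  qed
  have null_boundary: "AE x in E.\<nu>. x \<notin> E \<inter> perp u"
  proof -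
    have "harea (E.X \<inter> (E \<inter> perp u)) = 0" by (rule harea_null_mono[OF _ harea_E_boundary]) auto
    then have "emeasure E.\<nu> (E \<inter> perp u) = 0" by (simp add: E.emeasure_\<nu>)
    then show ?thesis by (intro AE_not_in) (simp add: null_sets_def)
  qed
  \<comment> \<open>All pairs of cells are treated at once so that a single null set serves,
    whichever wall a point turns out to lie on.\<close>
  have flat: "AE x in E.\<nu>. \<forall>i\<in>N. \<forall>j\<in>N - {i}. x \<in> ball 0 r \<inter> perp (w i - w j) \<longrightarrow>
     on_side (w i - w j) (V\<^sub>E i) x \<longrightarrow> on_side (- (w i - w j)) (V\<^sub>E j) x \<longrightarrow> E.\<delta> x = 1"
  proof (intro AE_finite_allI finite_N finite_Diff)
    fix i j assume ij: "i \<in> N" "j \<in> N - {i}"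
    then have ij': "i \<le> n + 1" "j \<le> n + 1" "i \<noteq> j" by (auto simp: N_def)
    have e: "norm (w i - w j) = 1" using norm_w_diff ij by auto
    show "AE x in E.\<nu>. x \<in> ball 0 r \<inter> perp (w i - w j) \<longrightarrow>
      on_side (w i - w j) (V\<^sub>E i) x \<longrightarrow> on_side (- (w i - w j)) (V\<^sub>E j) x \<longrightarrow> E.\<delta> x = 1"
      using E.AE_flat[OF e]
    proof eventually_elim
      case (elim x)
      show ?case
      proof (intro impI)
        assume x: "x \<in> ball 0 r \<inter> perp (w i - w j)" "on_side (w i - w j) (V\<^sub>E i) x" "on_side (- (w i - w j)) (V\<^sub>E j) x"
        have f: "E.f i x = w i - w j" "E.f j x = - (w i - w j)" "\<forall>k\<in>{..n+1} - {i, j}. E.f k x = 0"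
          using elim x ij' by auto
        have "E.\<delta> x = w i \<bullet> E.f i x + w j \<bullet> E.f j x" by (rule E.\<delta>_two) (use ij' f in auto)
        also have "\<dots> = (w i - w j) \<bullet> (w i - w j)" unfolding f by (simp add: inner_diff_left inner_diff_right)
        also have "\<dots> = 1" using e by (simp add: dot_square_norm)
        finally show "E.\<delta> x = 1" .
      qed
    qed
  qed
  have "(\<integral>x. \<psi> x * E.\<delta> x \<partial>E.\<nu>) = (\<integral>x. \<psi> x * indicator (E - perp u) x \<partial>E.\<nu>)"
  proof (rule integral_cong_AE)
    show "AE x in E.\<nu>. \<psi> x * E.\<delta> x = \<psi> x * indicator (E - perp u) x"
      using null_triple null_boundary flat E.AE_\<delta>_boundary E.AE_X
    proof eventually_elim
      case (elim x)
      show ?case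
      proof (cases "x \<in> ball 0 r")
        case False
        then show ?thesis using \<psi>(2) by simp
      next
        case xb: True
        show ?thesis
        proof (cases "x \<in> perp u")
          case True
          then obtain i where i: "i \<in> N" "on_side u (V\<^sub>E i) x" "E.\<delta> x = w i \<bullet> u" using elim xb by blast
          have "i \<noteq> 1"
            using on_side_in_closure[OF i(2)] closure_V\<^sub>E_1 True elim by blast
          then show ?thesis using i w_inner_u True by simp
        next
          case False
          then have xE: "x \<in> E" "x \<bullet> u > 0"
            using elim(5) unfolding E.X_def by (auto simp: E_def perp_def less_le)
          then obtain i j where ij: "i \<in> N" "j \<in> N - {i}" "x \<in> closed_cell i" "x \<in> closed_cell j"
            unfolding E_def walls_eq by blast
          have "on_side (w i - w j) (V\<^sub>E i) x" "on_side (- (w i - w j)) (V\<^sub>E j) x"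
            using on_side_V\<^sub>E[of i j x] on_side_V\<^sub>E[of j i x] ij elim(1) xE(2) by auto
          moreover have "x \<in> perp (w i - w j)"
            using closed_cells_perp[of j i x] ij w_diff[of i j] by (auto simp: perp_def)
          ultimately have "E.\<delta> x = 1" using elim(3) ij(1,2) xb by blast
          then show ?thesis using xE False by simp
        qed
      qed
    qed
  qed (use E.\<delta>_measurable in measurable)
  also have "\<dots> = (\<integral>x. indicator E.X x * (\<psi> x * indicator (E - perp u) x) \<partial>area)"
    by (rule E.integral_\<nu>) measurable
  also have "\<dots> = (\<integral>x. indicator (E - perp u) x * \<psi> x \<partial>area)"
    by (intro Bochner_Integration.integral_cong) (use \<psi>(2) in \<open>auto simp: E.X_def indicator_def\<close>)
  finally show ?thesis using E.flux[OF \<psi>] by simp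
qed

end

section \<open>The flux estimate for the competitor and the comparison\<close>

context sliding_homotopy
begin

lemma calibrated_F:
  assumes "r > 0" "harea (F \<inter> cball 0 r) < top"
  shows "calibrated_regions n p (F \<union> perp u) V\<^sub>F r"
proof unfold_locales
  show "closed (F \<union> perp u)" using closed_F closed_perp by (rule closed_Un)
  show "open (V\<^sub>F i)" for i by (rule open_V\<^sub>F)
  show "V\<^sub>F i \<inter> V\<^sub>F j = {}" if "i \<in> {..n+1}" "j \<in> {..n+1}" "i \<noteq> j" for i j
    using that V\<^sub>F_disjoint unfolding insert_0_N by blast
  show "(\<Union>i\<in>{..n+1}. V\<^sub>F i) = - (F \<union> perp u)" unfolding insert_0_N by (rule V\<^sub>F_cover)
  show "harea ((F \<union> perp u) \<inter> cball 0 r) < top"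
    by (rule harea_Un_finite[OF assms(2) harea_u_cball])
  show "V\<^sub>F i \<subseteq> {x. x \<bullet> u > 0}" if "i \<in> N" for i by (rule V\<^sub>F_pos[OF that])
  show "F \<union> perp u \<subseteq> {x. x \<bullet> u \<ge> 0}" using F_half by (auto simp: perp_def)
qed (use assms in \<open>auto simp: V\<^sub>F_def\<close>)

text \<open>The estimate matching \<open>flux_E\<close>: the density is at most 1 on
  \<open>F\<close> in the open half-space, and on the boundary it is either 0 or
  \<open>\<alpha>\<^sub>n\<close>.\<close>

lemma flux_F:
  fixes \<psi> :: "'a \<Rightarrow> real"
  assumes r: "r > 0" and fin: "harea (F \<inter> cball 0 r) < top"
    and \<psi>: "C1_grad \<psi> G" "\<And>x. x \<notin> ball 0 r \<Longrightarrow> \<psi> x = 0" "\<And>x. 0 \<le> \<psi> x" "\<And>x. \<psi> x \<le> 1"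
  shows "- (area_const TYPE('a) * (\<Sum>i\<le>n+1. \<integral>x. indicator (V\<^sub>F i \<inter> ball 0 r) x * (G x \<bullet> w i) \<partial>lborel))
    \<le> (\<integral>x. indicator (F - perp u) x * \<psi> x \<partial>area) + \<alpha>\<^sub>n * (\<integral>x. indicator (F \<inter> perp u) x * \<psi> x \<partial>area)"
proof -
  interpret F: calibrated_regions n p "F \<union> perp u" V\<^sub>F r by (rule calibrated_F[OF r fin])
  have [measurable]: "\<psi> \<in> borel_measurable borel"
    using C1_grad_continuous[OF \<psi>(1)] by (rule borel_measurable_continuous_onI)
  have [measurable]: "F \<in> sets borel" using closed_F by simp
  have \<alpha>0: "\<alpha>\<^sub>n \<ge> 0" by (simp add: \<alpha>\<^sub>n_def)
  note [measurable] = F.\<delta>_measurable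
  obtain C where C: "\<And>x. \<bar>F.\<delta> x\<bar> \<le> C" using F.\<delta>_bounded by blast
  have int: "integrable F.\<nu> (\<lambda>x. \<psi> x * indicator A x)" if "A \<in> sets borel" for A
    by (rule F.integrable_bounded_\<nu>[of _ 1]) (use that \<psi>(3,4) in \<open>auto simp: indicator_def\<close>)
  have conv: "(\<integral>x. \<psi> x * indicator A x \<partial>F.\<nu>) = (\<integral>x. indicator A x * \<psi> x \<partial>area)"
    if A: "A \<in> sets borel" "A \<subseteq> F \<union> perp u" for A
  proof -
    note [measurable] = A(1)
    have norm: "\<psi> x = 0 \<or> norm x \<le> r" for x using \<psi>(2)[of x] by (cases "norm x < r") auto
    have "(\<integral>x. \<psi> x * indicator A x \<partial>F.\<nu>) = (\<integral>x. indicator F.X x * (\<psi> x * indicator A x) \<partial>area)"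
      by (rule F.integral_\<nu>) measurable
    also have "\<dots> = (\<integral>x. indicator A x * \<psi> x \<partial>area)"
      by (intro Bochner_Integration.integral_cong) (use norm A(2) in \<open>auto simp: F.X_def indicator_def\<close>)
    finally show ?thesis .
  qed
  have "(\<integral>x. \<psi> x * F.\<delta> x \<partial>F.\<nu>) \<le> (\<integral>x. \<psi> x * indicator (F - perp u) x + \<alpha>\<^sub>n * (\<psi> x * indicator (F \<inter> perp u) x) \<partial>F.\<nu>)"
  proof (rule integral_mono_AE)
    show "integrable F.\<nu> (\<lambda>x. \<psi> x * F.\<delta> x)"
    proof (rule F.integrable_bounded_\<nu>[of _ C])
      show "\<bar>\<psi> x * F.\<delta> x\<bar> \<le> C" for x
        using mult_mono[OF \<psi>(4)[of x] C[of x]] \<psi>(3)[of x] C[of x] by (simp add: abs_mult)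
    qed measurable
    show "integrable F.\<nu> (\<lambda>x. \<psi> x * indicator (F - perp u) x + \<alpha>\<^sub>n * (\<psi> x * indicator (F \<inter> perp u) x))"
      by (intro Bochner_Integration.integrable_add integrable_mult_right int) auto
    show "AE x in F.\<nu>. \<psi> x * F.\<delta> x \<le> \<psi> x * indicator (F - perp u) x + \<alpha>\<^sub>n * (\<psi> x * indicator (F \<inter> perp u) x)"
      using F.AE_\<delta>_boundary F.AE_\<delta>_interior F.AE_X
    proof eventually_elim
      case (elim x)
      show ?case
      proof (cases "x \<in> ball 0 r")
        case False
        then show ?thesis using \<psi>(2) by simp
      next
        case xb: True
        show ?thesis
        proof (cases "x \<in> perp u")
          case False
          then have "F.\<delta> x \<le> 1" "x \<in> F" using elim xb by (auto simp: F.X_def)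
          then show ?thesis using False mult_left_mono[of "F.\<delta> x" 1 "\<psi> x"] \<psi>(3)[of x] by simp
        next
          case True
          then obtain i where i: "i \<in> N" "on_side u (V\<^sub>F i) x" "F.\<delta> x = w i \<bullet> u" using elim xb by blast
          show ?thesis
          proof (cases "i = 1")
            case i1: True
            \<comment> \<open>The only place where \<open>\<alpha>\<^sub>n\<close> is charged: the
              first region lies above a boundary point only if \<open>F\<close> covers that
              point.\<close>
            then have "x \<in> F" using on_side_in_closure[OF i(2)] V\<^sub>F_1_closure[OF True] by blast
            then show ?thesis using True i i1 w_inner_u[OF one_N] by simp
          next
            case False
            then have "F.\<delta> x = 0" using i w_inner_u by simp
            then show ?thesis using \<alpha>0 \<psi>(3)[of x] by (simp add: indicator_def)
          qed
        qed
      qed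
    qed
  qed
  also have "\<dots> = (\<integral>x. \<psi> x * indicator (F - perp u) x \<partial>F.\<nu>) + \<alpha>\<^sub>n * (\<integral>x. \<psi> x * indicator (F \<inter> perp u) x \<partial>F.\<nu>)"
    by (subst Bochner_Integration.integral_add) (auto intro!: int integrable_mult_right)
  also have "\<dots> = (\<integral>x. indicator (F - perp u) x * \<psi> x \<partial>area) + \<alpha>\<^sub>n * (\<integral>x. indicator (F \<inter> perp u) x * \<psi> x \<partial>area)"
    by (subst (1 2) conv) auto
  finally show ?thesis using F.flux[OF \<psi>(1,2)] by simp
qed

lemma symmetric_difference_bounded: "E - F \<subseteq> cball 0 R\<^sub>0" "F - E \<subseteq> cball 0 R\<^sub>0"
proof -
  have "norm x \<le> R\<^sub>0" if "x \<in> E \<longleftrightarrow> x \<notin> F" for x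
    using F_far[of x] that by (cases "norm x \<le> R\<^sub>0") auto
  then show "E - F \<subseteq> cball 0 R\<^sub>0" "F - E \<subseteq> cball 0 R\<^sub>0" by auto
qed

text \<open>The gradient of the cutoff is supported where the regions of \<open>E\<close> and
  \<open>F\<close> coincide, so the volume sides of \<open>flux_E\<close> and \<open>flux_F\<close>
  are equal. Subtracting the common part of the two sets leaves their difference, on which the
  cutoff is 1.\<close>

theorem calibration_inequality:
  assumes fin: "harea (F - E) < top"
  shows "harea (E - F - perp u) \<le> harea (F - E - perp u) + ennreal \<alpha>\<^sub>n * harea ((F - E) \<inter> perp u)"
proof -
  \<comment> \<open>With \<open>R\<^sub>0 < R < r\<close> the cutoff is constant on a ball that
    strictly contains every difference of \<open>E\<close> and \<open>F\<close>, and it vanishes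
    outside the ball of radius \<open>r\<close>, where areas are no longer controlled.\<close>
  define r where "r = R\<^sub>0 + 2"
  define R where "R = R\<^sub>0 + 1"
  have Rr: "0 < R" "R < r" "R\<^sub>0 < R" "0 < r" using R\<^sub>0_pos by (auto simp: R_def r_def)
  define \<psi> :: "'a \<Rightarrow> real" where "\<psi> = plateau R r"
  note \<psi> = plateau[OF Rr(1,2), where 'a='a, folded \<psi>_def]
  obtain G where G: "C1_grad \<psi> G" using \<psi>(1) by (auto simp: C1_fun_def)
  have G0: "G x = 0" if "norm x < R" for x
  proof -
    have "((\<lambda>_. 1) has_derivative (\<lambda>h. 0)) (at x)" by simp
    then have "(\<psi> has_derivative (\<lambda>h. 0)) (at x)"
      by (rule has_derivative_transform_within_open[of _ _ _ _ "ball 0 R"]) (use that \<psi>(4) in auto)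
    moreover have "(\<psi> has_derivative (\<lambda>h. G x \<bullet> h)) (at x)" using G by (simp add: C1_grad_def)
    ultimately have "(\<lambda>h. 0) = (\<lambda>h. G x \<bullet> h)" by (rule has_derivative_unique)
    then have "G x \<bullet> G x = 0" by metis
    then show ?thesis by simp
  qed
  have fF: "harea (F \<inter> cball 0 r) < top"
  proof -
    have "harea (F \<inter> cball 0 r) \<le> harea ((F - E) \<union> (E \<inter> cball 0 r))" by (rule harea_mono) auto
    also have "\<dots> \<le> harea (F - E) + harea (E \<inter> cball 0 r)"
      unfolding harea_def by (rule hausdorff_measure_Un_le)
    also have "\<dots> < top" using fin harea_E_cball by simp
    finally show ?thesis .
  qed
  have same: "(\<integral>x. indicator (V\<^sub>F i \<inter> ball 0 r) x * (G x \<bullet> w i) \<partial>lborel)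
      = (\<integral>x. indicator (V\<^sub>E i \<inter> ball 0 r) x * (G x \<bullet> w i) \<partial>lborel)" if i: "i \<in> {..n+1}" for i
  proof (intro Bochner_Integration.integral_cong refl)
    fix x
    show "indicator (V\<^sub>F i \<inter> ball 0 r) x * (G x \<bullet> w i) = indicator (V\<^sub>E i \<inter> ball 0 r) x * (G x \<bullet> w i)"
    proof (cases "norm x < R")
      case False
      then have "norm x > R\<^sub>0" using Rr by simp
      then have "x \<in> V\<^sub>F i \<longleftrightarrow> x \<in> V\<^sub>E i"
        using i V\<^sub>F_far[of i x] zero_not_N unfolding insert_0_N by (auto simp: V\<^sub>F_def[of 0] V\<^sub>E_def)
      then show ?thesis by (simp add: indicator_def)
    qed (simp add: G0)
  qed
  let ?I = "\<lambda>A. \<integral>x. indicator A x * \<psi> x \<partial>area"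
  have "?I (E - perp u) = - (area_const TYPE('a) * (\<Sum>i\<le>n+1. \<integral>x. indicator (V\<^sub>E i \<inter> ball 0 r) x * (G x \<bullet> w i) \<partial>lborel))"
    using flux_E[OF Rr(4) G \<psi>(5)] by simp
  also have "\<dots> = - (area_const TYPE('a) * (\<Sum>i\<le>n+1. \<integral>x. indicator (V\<^sub>F i \<inter> ball 0 r) x * (G x \<bullet> w i) \<partial>lborel))"
    by (simp add: same)
  also have "\<dots> \<le> ?I (F - perp u) + \<alpha>\<^sub>n * ?I (F \<inter> perp u)"
    by (rule flux_F[OF Rr(4) fF G \<psi>(5) \<psi>(2,3)])
  finally have main: "?I (E - perp u) \<le> ?I (F - perp u) + \<alpha>\<^sub>n * ?I (F \<inter> perp u)" .
  have [measurable]: "E \<in> sets borel" "F \<in> sets borel" using closed_E closed_F by auto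
  have [measurable]: "\<psi> \<in> borel_measurable borel" using C1_fun_measurable[OF \<psi>(1)] .
  have finY: "harea ((E \<union> F) \<inter> cball 0 r) < top"
    by (rule harea_Un_finite[OF harea_E_cball fF])
  have int: "integrable area (\<lambda>x. indicator A x * \<psi> x)" if A: "A \<in> sets borel" "A \<subseteq> E \<union> F" for A
  proof (rule Bochner_Integration.integrable_bound)
    have "(E \<union> F) \<inter> cball 0 r \<in> sets borel" by auto
    then show "integrable area (indicator ((E \<union> F) \<inter> cball 0 r) :: 'a \<Rightarrow> real)"
      using finY by (intro integrable_real_indicator) (auto simp: emeasure_area)
    show "AE x in area. norm (indicator A x * \<psi> x) \<le> norm (indicator ((E \<union> F) \<inter> cball 0 r) x :: real)"
      using \<psi>(2,3,5) A(2) by (intro AE_I2) (auto simp: indicator_def)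
    show "(\<lambda>x. indicator A x * \<psi> x) \<in> borel_measurable area" using A(1) by measurable
  qed
  have split: "?I (A \<union> B) = ?I A + ?I B"
    if "A \<in> sets borel" "A \<subseteq> E \<union> F" "B \<in> sets borel" "B \<subseteq> E \<union> F" "A \<inter> B = {}" for A B
  proof -
    have "?I (A \<union> B) = (\<integral>x. indicator A x * \<psi> x + indicator B x * \<psi> x \<partial>area)"
      by (intro Bochner_Integration.integral_cong) (use that(5) in \<open>auto simp: indicator_def\<close>)
    also have "\<dots> = ?I A + ?I B" by (intro Bochner_Integration.integral_add int that)
    finally show ?thesis .
  qed
  have meas: "?I A = measure area A" "harea A = ennreal (measure area A)"
    if A: "A \<in> sets borel" "A \<subseteq> E \<union> F" "A \<subseteq> cball 0 R\<^sub>0" for A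
  proof -
    have "?I A = (\<integral>x. indicator A x \<partial>area)"
      by (intro Bochner_Integration.integral_cong) (use A(3) \<psi>(4) Rr in \<open>force simp: indicator_def\<close>)+
    then show "?I A = measure area A" by simp
    have "harea A \<le> harea ((E \<union> F) \<inter> cball 0 r)" by (rule harea_mono) (use A Rr in force)
    then have "emeasure area A \<noteq> top" using finY A by (auto simp: emeasure_area top_unique)
    then show "harea A = ennreal (measure area A)"
      using A(1) by (simp add: emeasure_area[symmetric] emeasure_eq_ennreal_measure)
  qed
  note bd = symmetric_difference_bounded
  \<comment> \<open>The part of the boundary shared by \<open>E\<close> and \<open>F\<close> would
    be charged with \<open>\<alpha>\<^sub>n\<close> for \<open>F\<close> only; it drops out because
    \<open>E\<close> meets the boundary in a null set.\<close>
  have I0: "?I (E \<inter> F \<inter> perp u) = 0"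
  proof -
    have "emeasure area (E \<inter> F \<inter> perp u) = 0"
      using harea_null_mono[OF _ harea_E_boundary, of "E \<inter> F \<inter> perp u"] by (auto simp: emeasure_area)
    then have "AE x in area. x \<notin> E \<inter> F \<inter> perp u" by (intro AE_not_in) (simp add: null_sets_def)
    then have "?I (E \<inter> F \<inter> perp u) = (\<integral>x. 0 \<partial>(area :: 'a measure))"
      by (intro integral_cong_AE) (auto elim!: eventually_mono)
    then show ?thesis by simp
  qed
  have "?I (E - perp u) = ?I (E - F - perp u) + ?I (E \<inter> F - perp u)"
    by (subst split[symmetric]) (auto intro!: arg_cong[where f = ?I])
  moreover have "?I (F - perp u) = ?I (F - E - perp u) + ?I (E \<inter> F - perp u)"
    by (subst split[symmetric]) (auto intro!: arg_cong[where f = ?I])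
  moreover have "?I (F \<inter> perp u) = ?I ((F - E) \<inter> perp u) + ?I (E \<inter> F \<inter> perp u)"
    by (subst split[symmetric]) (auto intro!: arg_cong[where f = ?I])
  ultimately have "?I (E - F - perp u) \<le> ?I (F - E - perp u) + \<alpha>\<^sub>n * ?I ((F - E) \<inter> perp u)"
    using main I0 by simp
  then have le: "measure area (E - F - perp u) \<le> measure area (F - E - perp u) + \<alpha>\<^sub>n * measure area ((F - E) \<inter> perp u)"
    using bd by (subst (asm) (1 2 3) meas(1)) auto
  have "harea (E - F - perp u) = ennreal (measure area (E - F - perp u))" by (rule meas(2)) (use bd in auto)
  also have "\<dots> \<le> ennreal (measure area (F - E - perp u) + \<alpha>\<^sub>n * measure area ((F - E) \<inter> perp u))"
    by (rule ennreal_leI[OF le])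
  also have "\<dots> = ennreal (measure area (F - E - perp u)) + ennreal \<alpha>\<^sub>n * ennreal (measure area ((F - E) \<inter> perp u))"
    by (simp add: ennreal_mult \<alpha>\<^sub>n_def)
  also have "ennreal (measure area (F - E - perp u)) = harea (F - E - perp u)" by (rule meas(2)[symmetric]) (use bd in auto)
  also have "ennreal (measure area ((F - E) \<inter> perp u)) = harea ((F - E) \<inter> perp u)" by (rule meas(2)[symmetric]) (use bd in auto)
  finally show ?thesis .
qed

end

theorem theorem13:
  fixes \<alpha> :: real
  assumes "CARD('n) \<ge> 3"
    and "\<alpha> \<in> {0..1}"
    and "\<alpha> \<ge> sqrt ((real CARD('n) + 1) / (2 * real CARD('n)))"
  shows "sliding_minimiser \<alpha> (simplex_half_cone :: (real^'n::{finite,linorder}) set)"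
proof -
  let ?n = "CARD('n)" and ?p = "simplex_vertex :: nat \<Rightarrow> real^'n::{finite,linorder}"
  have "?n \<ge> 2" using assms(1) by simp
  then interpret simplex_frame ?n ?p by (rule simplex_frame_vertex)
  have u: "u = first_axis" unfolding u_def simplex_vertex_1 by simp
  have half: "half_space = {x. x \<bullet> u \<ge> 0}" and bnd: "sliding_boundary = perp u"
    unfolding half_space_eq sliding_boundary_eq u perp_def by simp_all
  have harea: "hausdorff_measure (CARD('n) - 1) = (harea :: (real^'n::{finite,linorder}) set \<Rightarrow> ennreal)"
    by (simp add: harea_def)
  have energy: "sliding_energy \<alpha> A = harea (A - perp u) + ennreal \<alpha> * harea (A \<inter> perp u)" for A
    unfolding sliding_energy_def harea bnd ..
  have cone: "simplex_half_cone = E"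
    unfolding simplex_half_cone_def simplex_cone_def regular_simplex_def half E_def
    using cone_over_skeleton by (simp add: N_def)
  have \<alpha>: "\<alpha> \<ge> \<alpha>\<^sub>n" "\<alpha>\<^sub>n > 0" using assms(3) by (auto simp: \<alpha>\<^sub>n_def add.commute)
  show ?thesis
    unfolding sliding_minimiser_def cone
  proof (intro conjI allI impI)
    show "E \<subseteq> half_space" by (auto simp: E_def half)
    show "locally_finite_hausdorff (CARD('n) - 1) E"
      unfolding locally_finite_hausdorff_def harea
    proof
      fix x :: "real^'n::{finite,linorder}"
      have "harea (E \<inter> ball x 1) \<le> harea (E \<inter> cball 0 (norm x + 1))"
      proof (rule harea_mono)
        have "ball x 1 \<subseteq> cball 0 (norm x + 1)"
        proof
          fix y assume "y \<in> ball x 1"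
          then show "y \<in> cball 0 (norm x + 1)"
            using norm_triangle_ineq2[of y x] by (simp add: dist_norm norm_minus_commute)
        qed
        then show "E \<inter> ball x 1 \<subseteq> E \<inter> cball 0 (norm x + 1)" by auto
      qed
      also have "\<dots> < \<infinity>" using harea_E_cball by simp
      finally show "\<exists>V. open V \<and> x \<in> V \<and> harea (E \<inter> V) < \<infinity>"
        by (intro exI[of _ "ball x 1"]) auto
    qed
    fix F assume "sliding_competitor E F"
    then obtain \<phi> :: "real \<Rightarrow> real^'n::{finite,linorder} \<Rightarrow> real^'n::{finite,linorder}" and K where \<phi>: "continuous_on ({0..1} \<times> E) (\<lambda>(t, x). \<phi> t x)" "\<forall>x\<in>E. \<phi> 0 x = x"
      "F = \<phi> 1 ` E" "compact K"
      "(\<lambda>(t, x). \<phi> t x) ` ({0..1} \<times> (\<Union>t\<in>{0..1}. {x \<in> E. \<phi> t x \<noteq> x})) \<subseteq> K"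
      "\<forall>t\<in>{0..1}. (\<forall>x\<in>E. \<phi> t x \<in> half_space) \<and> (\<forall>x\<in>E \<inter> sliding_boundary. \<phi> t x \<in> sliding_boundary)"
      unfolding sliding_competitor_def Let_def by (elim exE conjE) (rule that)
    obtain R where R: "R > 0" "\<And>x. x \<in> K \<Longrightarrow> norm x \<le> R"
      using compact_imp_bounded[OF \<phi>(4)] bounded_pos by blast
    have support: "\<phi> t x = x \<or> norm x \<le> R \<and> norm (\<phi> t x) \<le> R" if tx: "t \<in> {0..1}" "x \<in> E" for t x
    proof (cases "\<phi> t x = x")
      case False
      then have "x \<in> (\<Union>t\<in>{0..1}. {x \<in> E. \<phi> t x \<noteq> x})" using tx by blast
      then have K: "\<phi> s x \<in> K" if "s \<in> {0..1}" for s using \<phi>(5) that by force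
      \<comment> \<open>A point that moves at some time has its whole trajectory in
        \<open>K\<close>; time 0 places the point itself there.\<close>
      have "\<phi> t x \<in> K" "\<phi> 0 x \<in> K" using K[OF tx(1)] K[of 0] by simp_all
      then show ?thesis using R(2) \<phi>(2) tx by auto
    qed simp
    interpret H: sliding_homotopy ?n ?p \<phi> R
    proof unfold_locales
      show "\<phi> t x \<bullet> u = 0" if "t \<in> {0..1}" "x \<in> E" "x \<bullet> u = 0" for t x
        using \<phi>(6) that by (auto simp: bnd perp_def)
      show "\<phi> t x \<bullet> u \<ge> 0" if "t \<in> {0..1}" "x \<in> E" for t x
        using \<phi>(6) that by (auto simp: half)
    qed (use \<phi>(1,2) support R in auto)
    have F: "F = H.F" by (simp add: \<phi>(3) H.F_def)
    show "sliding_energy \<alpha> (E - F) \<le> sliding_energy \<alpha> (F - E)"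
    proof (cases "harea (F - E) < top")
      case True
      have "harea ((E - F) \<inter> perp u) = 0"
        by (rule harea_null_mono[OF _ harea_E_boundary]) auto
      then have "sliding_energy \<alpha> (E - F) = harea (E - F - perp u)"
        by (simp add: energy)
      also have "\<dots> \<le> harea (F - E - perp u) + ennreal \<alpha>\<^sub>n * harea ((F - E) \<inter> perp u)"
        using H.calibration_inequality True by (simp add: F)
      also have "\<dots> \<le> harea (F - E - perp u) + ennreal \<alpha> * harea ((F - E) \<inter> perp u)"
        using \<alpha> by (intro add_left_mono mult_right_mono ennreal_leI) auto
      also have "\<dots> = sliding_energy \<alpha> (F - E)"
        by (simp add: energy)
      finally show ?thesis .
    next
      \<comment> \<open>A competitor of infinite area has infinite energy whichever part is
        infinite, the boundary part because \<alpha> is positive.\<close>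
      case False
      have "harea (F - E) \<le> harea (F - E - perp u) + harea ((F - E) \<inter> perp u)"
      proof -
        have "harea (F - E) \<le> harea ((F - E - perp u) \<union> ((F - E) \<inter> perp u))" by (rule harea_mono) auto
        also have "\<dots> \<le> harea (F - E - perp u) + harea ((F - E) \<inter> perp u)"
          unfolding harea_def by (rule hausdorff_measure_Un_le)
        finally show ?thesis .
      qed
      with False have "harea (F - E - perp u) = top \<or> harea ((F - E) \<inter> perp u) = top"
        by (auto simp: not_less top_unique)
      moreover have "ennreal \<alpha> \<noteq> 0" using \<alpha> by simp
      ultimately have "sliding_energy \<alpha> (F - E) = top"
        by (auto simp: energy ennreal_mult_top)
      then show ?thesis by simp
    qed
  qed
qed

end
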